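(* $\mathrm{PSL}(2,\mathbb{R})$ is a maximal closed subgroup of $\mathrm{Homeo}(\mathbb{S}^1)$; that is, the only closed subgroups of $\mathrm{Homeo}(\mathbb{S}^1)$ containing $\mathrm{PSL}(2,\mathbb{R})$ are $\mathrm{PSL}(2,\mathbb{R})$ and $\mathrm{Homeo}(\mathbb{S}^1)$.
   Context: $\mathrm{Homeo}(\mathbb{S}^1)$ is the group of orientation-preserving homeomorphisms of the circle with the uniform topology, induced by the metric $d(g_1,g_2)=\sup_{x}\max\{d_{\mathbb{S}^1}(g_1(x),g_2(x)),d_{\mathbb{S}^1}(g_1^{-1}(x),g_2^{-1}(x))\}$. $\mathrm{PSL}(2,\mathbb{R})$ is the subgroup of (orientation-preserving) Möbius transformations of $\mathbb{S}^1$ (those preserving the unit disc, restricted to the circle). *)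

theory Defs
  imports "HOL-Analysis.Analysis" "HOL-Algebra.Bij"
begin

abbreviation circle :: "complex set" where
  "circle \<equiv> sphere 0 1"

text \<open>A circle map preserves orientation if it lifts, through the covering \<open>t \<mapsto> cis t\<close>
  of the circle by the line, to an increasing continuous map of the line.\<close>

definition orientation_preserving :: "(complex \<Rightarrow> complex) \<Rightarrow> bool" where
  "orientation_preserving f \<longleftrightarrow>
     (\<exists>F :: real \<Rightarrow> real. continuous_on UNIV F \<and> strict_mono F \<and> (\<forall>t. f (cis t) = cis (F t)))"

text \<open>As in \<^const>\<open>Bij\<close>, maps of the circle are made extensional (equal to
  \<^const>\<open>undefined\<close> off the circle), so that each one is represented by exactly one function
  and the group operations can be inherited from \<^const>\<open>BijGroup\<close>.\<close>

definition Homeo_set :: "(complex \<Rightarrow> complex) set" where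
  "Homeo_set = {f \<in> extensional circle.
     (\<exists>g. homeomorphism circle circle f g) \<and> orientation_preserving f}"

definition Homeo :: "(complex \<Rightarrow> complex) monoid" where
  "Homeo = (BijGroup circle)\<lparr>carrier := Homeo_set\<rparr>"

text \<open>Distances on the circle are Euclidean. Outside \<^const>\<open>Homeo_set\<close> the value is set to 0
  because \<^const>\<open>Metric_space\<close> asks for nonnegativity and symmetry on the whole type.\<close>

definition Homeo_dist :: "(complex \<Rightarrow> complex) \<Rightarrow> (complex \<Rightarrow> complex) \<Rightarrow> real" where
  "Homeo_dist f g =
     (if f \<in> Homeo_set \<and> g \<in> Homeo_set
      then SUP x\<in>circle. max (dist (f x) (g x))
             (dist (inv_into circle f x) (inv_into circle g x))
      else 0)"

definition Homeo_topology :: "(complex \<Rightarrow> complex) topology" where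
  "Homeo_topology = Metric_space.mtopology Homeo_set Homeo_dist"

definition closed_subgroup :: "(complex \<Rightarrow> complex) set \<Rightarrow> bool" where
  "closed_subgroup G \<longleftrightarrow> subgroup G Homeo \<and> closedin Homeo_topology G"

definition moebius :: "complex \<Rightarrow> complex \<Rightarrow> complex \<Rightarrow> complex \<Rightarrow> complex \<Rightarrow> complex" where
  "moebius a b c d z = (a * z + b) / (c * z + d)"

text \<open>The condition on the open disc rules out a pole in the closed disc, since the
  map would then be unbounded on the open disc. Hence the convention \<open>x / 0 = 0\<close> never
  matters here.\<close>

definition PSL2R :: "(complex \<Rightarrow> complex) set" where
  "PSL2R = {restrict (moebius a b c d) circle | a b c d.
     a * d - b * c \<noteq> 0 \<and> moebius a b c d ` ball 0 1 = ball 0 1}"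

subsection \<open>Well-formedness of the definitions\<close>

lemma Homeo_set_subset_Bij: "Homeo_set \<subseteq> Bij circle"
proof
  fix f assume f: "f \<in> Homeo_set"
  then obtain g where g: "homeomorphism circle circle f g"
    by (auto simp: Homeo_set_def)
  then have "inj_on f circle"
    by (metis homeomorphism_def inj_on_inverseI)
  moreover have "f ` circle = circle"
    using g by (simp add: homeomorphism_def)
  ultimately show "f \<in> Bij circle"
    using f by (auto simp: Bij_def bij_betw_def Homeo_set_def)
qed

lemma Homeo_dist_integrand_bdd:
  assumes "f \<in> Homeo_set" "g \<in> Homeo_set"
  shows "bdd_above ((\<lambda>x. max (dist (f x) (g x))
           (dist (inv_into circle f x) (inv_into circle g x))) ` circle)"
proof (rule bdd_aboveI2)
  fix x :: complex assume x: "x \<in> circle"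
  have B: "f \<in> Bij circle" "g \<in> Bij circle"
    using assms Homeo_set_subset_Bij by auto
  have two: "dist u v \<le> 2" if "u \<in> circle" "v \<in> circle" for u v :: complex
    using that norm_triangle_ineq4 [of u v] by (simp add: dist_norm)
  have "f x \<in> circle" "g x \<in> circle"
    using B [THEN Bij_imp_funcset] x by (simp_all add: Pi_iff)
  moreover have "inv_into circle f x \<in> circle" "inv_into circle g x \<in> circle"
    using B [THEN Bij_inv_into_mem, OF x] by simp_all
  ultimately show "max (dist (f x) (g x))
      (dist (inv_into circle f x) (inv_into circle g x)) \<le> 2"
    using two by simp
qed

lemma Metric_space_Homeo: "Metric_space Homeo_set Homeo_dist"
proof -
  define h where "h f g x = max (dist (f x) (g x))
      (dist (inv_into circle f x) (inv_into circle g x))" for f g :: "complex \<Rightarrow> complex" and x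
  have d: "Homeo_dist f g = (SUP x\<in>circle. h f g x)"
    if "f \<in> Homeo_set" "g \<in> Homeo_set" for f g
    using that by (simp add: Homeo_dist_def h_def)
  have bdd: "bdd_above (h f g ` circle)" if "f \<in> Homeo_set" "g \<in> Homeo_set" for f g
    using Homeo_dist_integrand_bdd [OF that] unfolding h_def .
  have upper: "h f g x \<le> Homeo_dist f g"
    if "f \<in> Homeo_set" "g \<in> Homeo_set" "x \<in> circle" for f g x
    using cSUP_upper [OF that(3) bdd [OF that(1,2)]] d [OF that(1,2)] by simp
  have one: "1 \<in> circle" by simp
  have h0: "0 \<le> h f g x" for f g x
    by (simp add: h_def le_max_iff_disj)
  have ne: "circle \<noteq> {}" using one by blast
  show ?thesis
  proof
    fix f g
    show "0 \<le> Homeo_dist f g"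
      using upper [of f g 1] h0 [of f g 1] one by (fastforce simp: Homeo_dist_def)
    show "Homeo_dist f g = Homeo_dist g f"
      by (auto simp: Homeo_dist_def dist_commute)
  next
    fix f g assume fg: "f \<in> Homeo_set" "g \<in> Homeo_set"
    show "Homeo_dist f g = 0 \<longleftrightarrow> f = g"
    proof
      assume 0: "Homeo_dist f g = 0"
      have "f x = g x" if "x \<in> circle" for x
      proof -
        have "dist (f x) (g x) \<le> h f g x" by (simp add: h_def)
        also have "\<dots> \<le> 0" using upper [OF fg that] 0 by simp
        finally show ?thesis by simp
      qed
      then show "f = g"
        using fg by (intro extensionalityI [of f circle]) (auto simp: Homeo_set_def)
    next
      assume "f = g"
      then have "h f g = (\<lambda>x. 0)" by (auto simp: h_def)
      then show "Homeo_dist f g = 0" using d [OF fg] ne by simp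
    qed
  next
    fix f g k assume fgk: "f \<in> Homeo_set" "g \<in> Homeo_set" "k \<in> Homeo_set"
    have "h f k x \<le> Homeo_dist f g + Homeo_dist g k" if "x \<in> circle" for x
    proof -
      have "h f k x \<le> h f g x + h g k x"
        using dist_triangle [of "f x" "k x" "g x"]
          dist_triangle [of "inv_into circle f x" "inv_into circle k x" "inv_into circle g x"]
        unfolding h_def by linarith
      also have "\<dots> \<le> Homeo_dist f g + Homeo_dist g k"
        using upper fgk that by (meson add_mono)
      finally show ?thesis .
    qed
    then show "Homeo_dist f k \<le> Homeo_dist f g + Homeo_dist g k"
      unfolding d [OF fgk(1,3)] by (intro cSUP_least ne)
  qed
qed

lemma orientation_preserving_inverse:
  assumes fg: "\<And>t. g (f (cis t)) = cis t" and "orientation_preserving f"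
  shows "orientation_preserving g"
proof -
  obtain F where F: "continuous_on UNIV F" "strict_mono F" "\<And>t. f (cis t) = cis (F t)"
    using assms(2) unfolding orientation_preserving_def by blast
  have step: "F t + 2 * pi \<le> F (t + 2 * pi)" for t
  proof -
    have "cis (F (t + 2 * pi)) = cis (F t)"
      using F(3) by (metis cis_2pi cis_mult mult_1_right)
    then obtain n :: int where n: "F (t + 2 * pi) = F t + 2 * pi * n"
      unfolding complex_eq_iff cis.simps using sin_cos_eq_iff [of "F (t + 2 * pi)" "F t"] by blast
    have "F t < F (t + 2 * pi)" using F(2) by (simp add: strict_mono_less)
    then have "0 < n" using n by (simp add: zero_less_mult_iff)
    then have "2 * pi * 1 \<le> 2 * pi * real_of_int n" by (intro mult_left_mono) auto
    then show ?thesis using n by simp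
  qed
  have up: "F 0 + 2 * pi * real n \<le> F (2 * pi * real n)" for n
  proof (induction n)
    case (Suc n)
    then show ?case using step [of "2 * pi * real n"] by (simp add: algebra_simps)
  qed simp
  have down: "F (- (2 * pi * real n)) \<le> F 0 - 2 * pi * real n" for n
  proof (induction n)
    case (Suc n)
    then show ?case using step [of "- (2 * pi * real (Suc n))"] by (simp add: algebra_simps)
  qed simp
  have surj: "\<exists>t. F t = y" for y
  proof -
    obtain n where n: "\<bar>y - F 0\<bar> / (2 * pi) \<le> real n" using real_arch_simple by blast
    then have n': "\<bar>y - F 0\<bar> \<le> 2 * pi * real n" by (simp add: field_simps)
    have "F (- (2 * pi * real n)) \<le> y" "y \<le> F (2 * pi * real n)"
      using up [of n] down [of n] n' by linarith+
    moreover have "- (2 * pi * real n) \<le> 2 * pi * real n" by simp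
    ultimately show ?thesis
      using IVT' [of F "- (2 * pi * real n)" y "2 * pi * real n"] continuous_on_subset [OF F(1)]
      by blast
  qed
  define G where "G = inv_into UNIV F"
  have FG: "F (G y) = y" for y
    using surj [of y] unfolding G_def by (metis f_inv_into_f rangeI)
  have GF: "G (F t) = t" for t
    using strict_mono_imp_inj_on [OF F(2)] by (simp add: G_def inv_f_f)
  have mono: "strict_mono G"
    by (rule strict_monoI) (metis F(2) FG strict_mono_less)
  have "range G = UNIV" by (metis GF surjI)
  then have "continuous_on UNIV G"
    by (intro continuous_onI_mono) (simp_all add: strict_mono_less_eq [OF mono])
  moreover have "g (cis t) = cis (G t)" for t
    using fg [of "G t"] F(3) [of "G t"] FG [of t] by simp
  ultimately show ?thesis unfolding orientation_preserving_def using mono by blast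
qed

lemma subgroup_Homeo_set: "subgroup Homeo_set (BijGroup circle)"
proof -
  interpret B: group "BijGroup circle" by (rule group_BijGroup)
  have cis_in: "cis t \<in> circle" for t by simp
  show ?thesis
  proof
    show "Homeo_set \<subseteq> carrier (BijGroup circle)"
      using Homeo_set_subset_Bij by (simp add: BijGroup_def)
  next
    fix f g assume fg: "f \<in> Homeo_set" "g \<in> Homeo_set"
    obtain f' g' where h: "homeomorphism circle circle f f'" "homeomorphism circle circle g g'"
      using fg by (auto simp: Homeo_set_def)
    have "homeomorphism circle circle (compose circle f g) (g' \<circ> f')"
      by (rule homeomorphism_cong [OF homeomorphism_compose [OF h(2,1)]]) (auto simp: compose_def)
    moreover obtain F G where F: "continuous_on UNIV F" "strict_mono F" "\<And>t. f (cis t) = cis (F t)"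
        and G: "continuous_on UNIV G" "strict_mono G" "\<And>t. g (cis t) = cis (G t)"
      using fg unfolding Homeo_set_def orientation_preserving_def by blast
    have "continuous_on UNIV (F \<circ> G)"
      using continuous_on_compose [OF G(1) continuous_on_subset [OF F(1)]] by simp
    moreover have "strict_mono (F \<circ> G)"
      using F(2) G(2) by (simp add: strict_mono_def)
    moreover have "compose circle f g (cis t) = cis ((F \<circ> G) t)" for t
      using F(3) G(3) by (simp add: compose_def)
    ultimately have "\<exists>k. homeomorphism circle circle (compose circle f g) k"
        and "orientation_preserving (compose circle f g)"
      unfolding orientation_preserving_def by blast+
    then have "compose circle f g \<in> Homeo_set"
      by (auto simp: Homeo_set_def)
    then show "f \<otimes>\<^bsub>BijGroup circle\<^esub> g \<in> Homeo_set"
      using fg Homeo_set_subset_Bij by (auto simp: BijGroup_def)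
  next
    have "homeomorphism circle circle (\<lambda>x\<in>circle. x) id"
      by (rule homeomorphism_cong [OF homeomorphism_ident]) auto
    moreover have "orientation_preserving (\<lambda>x\<in>circle. x)"
      unfolding orientation_preserving_def
      by (rule exI [of _ "\<lambda>t. t"]) (auto simp: strict_mono_def)
    ultimately show "\<one>\<^bsub>BijGroup circle\<^esub> \<in> Homeo_set"
      by (auto simp: Homeo_set_def BijGroup_def)
  next
    fix f assume f: "f \<in> Homeo_set"
    then obtain g where g: "homeomorphism circle circle f g" by (auto simp: Homeo_set_def)
    define k where "k = restrict g circle"
    have k: "homeomorphism circle circle k f"
      unfolding k_def
      by (rule homeomorphism_cong [OF homeomorphism_symD [OF g]]) auto
    have "k (f (cis t)) = cis t" for t
      using homeomorphism_apply2 [OF k cis_in] .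
    then have "orientation_preserving k"
      using f orientation_preserving_inverse [of k f] by (auto simp: Homeo_set_def)
    then have kH: "k \<in> Homeo_set" using k by (auto simp: Homeo_set_def k_def)
    have "compose circle k f = (\<lambda>x\<in>circle. x)"
      using homeomorphism_apply2 [OF k] by (auto simp: compose_def restrict_def)
    then have "k \<otimes>\<^bsub>BijGroup circle\<^esub> f = \<one>\<^bsub>BijGroup circle\<^esub>"
      using f kH Homeo_set_subset_Bij by (auto simp: BijGroup_def)
    then have "inv\<^bsub>BijGroup circle\<^esub> f = k"
      using f kH Homeo_set_subset_Bij
      by (intro B.inv_equality) (auto simp: BijGroup_def)
    then show "inv\<^bsub>BijGroup circle\<^esub> f \<in> Homeo_set" using kH by simp
  qed
qed

lemma group_Homeo: "group Homeo"
  unfolding Homeo_def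
  by (rule group.subgroup_imp_group [OF group_BijGroup subgroup_Homeo_set])

end

theory Submission
  imports Defs
begin

text \<open>
  A closed group \<open>G\<close> acting transitively on cyclically ordered \<open>n\<close>-tuples for every \<open>n\<close> is the whole
  group, since its orbits on fine \<open>n\<close>-tuples approximate every homeomorphism. Transitivity is proved
  by induction on \<open>n\<close>, using for a finite set \<open>P\<close> the group \<open>Q P\<close> of all elements joined to the
  identity by a continuum inside the stabilizer of \<open>P\<close>. Its orbits are intervals, so it is transitive
  on the complementary intervals of \<open>P\<close> unless it has fixed points there; by equivariance a fixed
  point in one such interval forces \<open>Q P\<close> to be trivial. Hence only the nontriviality of \<open>Q P\<close> has to
  be propagated from \<open>n\<close> to \<open>n + 1\<close> points.

  Suppose it fails. A mountain-climbing argument shows that continua in the stabilizer of \<open>n\<close>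
  points are determined by their action on one further point, so that \<open>Q P\<close> acts freely and
  transitively on every complementary interval and depends continuously on the image of a point. For
  \<open>n \<ge> 3\<close> this is contradictory: fixing \<open>n - 1\<close> of the points, one obtains on one complementary interval a group
  resembling the affine group of the line, in which two fixed-point-free elements cannot cross; but
  the stabilizers of points of another interval provide such a crossing. For \<open>n = 2\<close> it means that
  the stabilizers of two points are the hyperbolic one-parameter groups of \<open>PSL2R\<close>, so that \<open>G\<close>
  normalizes \<open>PSL2R\<close>, and then \<open>G = PSL2R\<close>.
\<close>

text \<open>Stabilizers in \<open>G\<close> are not known to be locally connected, so there are no
  paths to work with. Continua through \<open>id\<close> survive products, inverses and conjugation,
  and their compactness pays twice: components of a compact Hausdorff space are quasi-components,
  and an injective evaluation on a compact set has a continuous inverse. Maps of the line carry the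
  topology of pointwise convergence, which for increasing maps already makes composition and
  inversion continuous. Passing to lifts replaces the cyclic order by the order of the line, at the
  price of bookkeeping modulo the period.

  The threshold between \<open>n = 2\<close> and \<open>n \<ge> 3\<close> arises because the
  contradiction compares groups that fix different points of one complementary interval of
  \<open>n - 1\<close> points while acting on another one; this takes \<open>n - 1 \<ge> 2\<close>.
  A single point leaves only one interval, on which the affine group is a genuine model, so that the
  Moebius group has to be recognized instead of being refuted.\<close>

unbundle no m_inv_syntax

section \<open>Groups of lifts and their continua\<close>

lemma fun_hausdorff:
  fixes f g :: "'a \<Rightarrow> 'b::t2_space"
  assumes "f \<noteq> g"
  shows "\<exists>U V. open U \<and> open V \<and> f \<in> U \<and> g \<in> V \<and> U \<inter> V = {}"
proof -
  obtain x where "f x \<noteq> g x" using assms by auto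
  then obtain U V where UV: "open U" "open V" "f x \<in> U" "g x \<in> V" "U \<inter> V = {}"
    by (metis hausdorff)
  have op: "open ((\<lambda>h::'a \<Rightarrow> 'b. h x) -` W)" if "open W" for W
    using that continuous_on_open_vimage[OF open_UNIV, of "\<lambda>h::'a \<Rightarrow> 'b. h x"] by simp
  let ?P = "\<lambda>W. (\<lambda>h::'a \<Rightarrow> 'b. h x) -` W"
  have "open (?P U) \<and> open (?P V) \<and> f \<in> ?P U \<and> g \<in> ?P V \<and> ?P U \<inter> ?P V = {}"
    using UV op[of U] op[of V] by (simp flip: vimage_Int)
  then show ?thesis by (intro exI)
qed

text \<open>The weaker instance comes first because the library has an arity of \<^class>\<open>t0_space\<close> for
  countable domains only, which would be in conflict with the second one.\<close>

instance "fun" :: (type, t2_space) t0_space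
proof
  fix f g :: "'a \<Rightarrow> 'b"
  assume "f \<noteq> g"
  from fun_hausdorff[OF this] show "\<exists>U. open U \<and> \<not> (f \<in> U \<longleftrightarrow> g \<in> U)" by (metis disjoint_iff)
qed

instance "fun" :: (type, t2_space) t2_space
  by intro_classes (rule fun_hausdorff)

lemma connected_partition_const:
  assumes "connected X" "a \<in> X" "A a" "\<And>x. x \<in> X \<Longrightarrow> \<exists>U. open U \<and> x \<in> U \<and> (\<forall>y\<in>U \<inter> X. A y = A x)"
    and "b \<in> X"
  shows "A b"
proof -
  have "(\<lambda>x. A x) constant_on X"
  proof (rule locally_constant_imp_constant)
    show "connected X" by fact
    fix x assume "x \<in> X"
    then obtain U where "open U" "x \<in> U" "\<forall>y\<in>U \<inter> X. A y = A x" using assms(4) by blast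
    then have "openin (top_of_set X) (X \<inter> U) \<and> x \<in> X \<inter> U \<and> (\<forall>y\<in>X \<inter> U. A y = A x)"
      using \<open>x \<in> X\<close> openin_open_Int[of U X] by blast
    then show "\<exists>T. openin (top_of_set X) T \<and> x \<in> T \<and> (\<forall>y\<in>T. A y = A x)" by (rule exI)
  qed
  then show ?thesis using assms unfolding constant_on_def by metis
qed

lemma shift_of_int:
  fixes F :: "real \<Rightarrow> real"
  assumes "\<And>t. F (t + L) = F t + L"
  shows "F (t + of_int k * L) = F t + of_int k * L"
proof (induction k rule: int_induct[where k = 0])
  case (step1 i)
  then show ?case using assms[of "t + of_int i * L"] by (simp add: algebra_simps)
next
  case (step2 i)
  then show ?case using assms[of "t + of_int (i - 1) * L"] by (simp add: algebra_simps)
qed simp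

text \<open>Continuity is not listed because increasing surjections of the line have it (lemma
  \<open>continuous\<close>). The quotient by the translation by \<open>L\<close> is the circle;
  \<open>L\<close> is \<open>2 * pi\<close> in the application.\<close>

locale lift_group =
  fixes \<Gamma> :: "(real \<Rightarrow> real) set" and L :: real
  assumes L_pos: "0 < L"
    and strict_mono: "g \<in> \<Gamma> \<Longrightarrow> strict_mono g"
    and surj: "g \<in> \<Gamma> \<Longrightarrow> surj g"
    and periodic: "g \<in> \<Gamma> \<Longrightarrow> g (t + L) = g t + L"
    and id_mem: "id \<in> \<Gamma>"
    and comp_mem: "g \<in> \<Gamma> \<Longrightarrow> h \<in> \<Gamma> \<Longrightarrow> g \<circ> h \<in> \<Gamma>"
    and inv_mem: "g \<in> \<Gamma> \<Longrightarrow> inv g \<in> \<Gamma>"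
begin

lemma less_iff [simp]: "g \<in> \<Gamma> \<Longrightarrow> g x < g y \<longleftrightarrow> x < y"
  using strict_mono strict_mono_less by blast

lemma le_iff [simp]: "g \<in> \<Gamma> \<Longrightarrow> g x \<le> g y \<longleftrightarrow> x \<le> y"
  using strict_mono strict_mono_less_eq by blast

lemma eq_iff [simp]: "g \<in> \<Gamma> \<Longrightarrow> g x = g y \<longleftrightarrow> x = y"
  using strict_mono strict_mono_eq by blast

lemma inj: "g \<in> \<Gamma> \<Longrightarrow> inj g"
  by (simp add: inj_def)

lemma inv_left [simp]: "g \<in> \<Gamma> \<Longrightarrow> inv g (g x) = x"
  by (simp add: inj)

lemma inv_right [simp]: "g \<in> \<Gamma> \<Longrightarrow> g (inv g x) = x"
  by (simp add: surj surj_f_inv_f)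

lemma inv_inv [simp]: "g \<in> \<Gamma> \<Longrightarrow> inv (inv g) = g"
  by (simp add: bij_def inj surj inv_inv_eq)

lemma inv_less: "g \<in> \<Gamma> \<Longrightarrow> inv g x < y \<longleftrightarrow> x < g y"
  using less_iff[of g "inv g x" y] by simp

lemma less_inv: "g \<in> \<Gamma> \<Longrightarrow> y < inv g x \<longleftrightarrow> g y < x"
  using less_iff[of g y "inv g x"] by simp

lemma inv_eq: "g \<in> \<Gamma> \<Longrightarrow> inv g x = y \<longleftrightarrow> x = g y"
  by auto

lemma periodic_int: "g \<in> \<Gamma> \<Longrightarrow> g (t + of_int k * L) = g t + of_int k * L"
  using periodic by (rule shift_of_int)

lemma ex_less: "g \<in> \<Gamma> \<Longrightarrow> g x < y \<Longrightarrow> \<exists>b>x. g b < y"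
  by (metis dense less_inv)

lemma ex_greater: "g \<in> \<Gamma> \<Longrightarrow> y < g x \<Longrightarrow> \<exists>b<x. y < g b"
  by (metis dense inv_less)

lemma continuous: "g \<in> \<Gamma> \<Longrightarrow> continuous_on A g"
  by (rule continuous_on_subset[of UNIV], rule continuous_onI_mono)
    (auto simp: surj)

text \<open>A point slightly to one side of \<open>h a\<close> acts as a barrier: convergence at
  this single point controls its image under \<open>F b\<close>, and monotonicity carries the bound
  over to \<open>h b\<close>. Hence pointwise convergence suffices for continuity of
  composition.\<close>

lemma continuous_on_app:
  fixes F :: "'a::topological_space \<Rightarrow> real \<Rightarrow> real"
  assumes "continuous_on A F" "F ` A \<subseteq> \<Gamma>" "continuous_on A h"
  shows "continuous_on A (\<lambda>a. F a (h a))"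
  unfolding continuous_on_def
proof (intro ballI order_tendstoI)
  fix a y assume a: "a \<in> A"
  have Ft: "((\<lambda>a. F a c) \<longlongrightarrow> F a c) (at a within A)" for c
    using continuous_on_product_then_coordinatewise[OF assms(1)] a by (auto simp: continuous_on_def)
  have ht: "(h \<longlongrightarrow> h a) (at a within A)"
    using assms(3) a by (auto simp: continuous_on_def)
  have inA: "\<forall>\<^sub>F b in at a within A. b \<in> A"
    by (simp add: eventually_at_filter)
  {
    assume "y < F a (h a)"
    then obtain c where c: "c < h a" "y < F a c" using ex_greater assms(2) a by blast
    show "\<forall>\<^sub>F b in at a within A. y < F b (h b)"
      using inA order_tendstoD(1)[OF Ft c(2)] order_tendstoD(1)[OF ht c(1)]
    proof eventually_elim
      case (elim b)
      then have "F b \<in> \<Gamma>" using assms(2) by auto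
      then show ?case using elim less_iff less_trans by metis
    qed
  next
    assume "F a (h a) < y"
    then obtain c where c: "c > h a" "F a c < y" using ex_less assms(2) a by blast
    show "\<forall>\<^sub>F b in at a within A. F b (h b) < y"
      using inA order_tendstoD(2)[OF Ft c(2)] order_tendstoD(2)[OF ht c(1)]
    proof eventually_elim
      case (elim b)
      then have "F b \<in> \<Gamma>" using assms(2) by auto
      then show ?case using elim less_iff less_trans by metis
    qed
  }
qed

lemma continuous_on_comp:
  fixes F :: "'a::topological_space \<Rightarrow> real \<Rightarrow> real"
  assumes "continuous_on A F" "F ` A \<subseteq> \<Gamma>" "continuous_on A H"
  shows "continuous_on A (\<lambda>a. F a \<circ> H a)"
  unfolding o_def
  by (rule continuous_on_coordinatewise_then_product,
      rule continuous_on_app[OF assms(1,2) continuous_on_product_then_coordinatewise[OF assms(3)]])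

text \<open>For increasing maps an inequality on \<open>inv (F a) x\<close> is one on a single value
  \<open>F a y\<close>, which is an open condition for pointwise convergence.\<close>

lemma continuous_on_inv_fun:
  fixes F :: "'a::topological_space \<Rightarrow> real \<Rightarrow> real"
  assumes "continuous_on A F" "F ` A \<subseteq> \<Gamma>"
  shows "continuous_on A (\<lambda>a. inv (F a))"
proof (intro continuous_on_coordinatewise_then_product)
  fix x
  show "continuous_on A (\<lambda>a. inv (F a) x)"
    unfolding continuous_on_def
  proof (intro ballI order_tendstoI)
    fix a y assume a: "a \<in> A"
    have Ft: "((\<lambda>a. F a c) \<longlongrightarrow> F a c) (at a within A)" for c
      using continuous_on_product_then_coordinatewise[OF assms(1)] a by (auto simp: continuous_on_def)
    have inA: "\<forall>\<^sub>F b in at a within A. b \<in> A"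
      by (simp add: eventually_at_filter)
    {
      assume "y < inv (F a) x"
      then have "F a y < x" using a assms(2) less_inv by blast
      from order_tendstoD(2)[OF Ft this] inA show "\<forall>\<^sub>F b in at a within A. y < inv (F b) x"
        by eventually_elim (use assms(2) less_inv in blast)
    next
      assume "inv (F a) x < y"
      then have "x < F a y" using a assms(2) inv_less by blast
      from order_tendstoD(1)[OF Ft this] inA show "\<forall>\<^sub>F b in at a within A. inv (F b) x < y"
        by eventually_elim (use assms(2) inv_less in blast)
    }
  qed
qed

definition fixers :: "real set \<Rightarrow> (real \<Rightarrow> real) set" where
  "fixers P = {g \<in> \<Gamma>. \<forall>p\<in>P. g p = p}"

definition Q :: "real set \<Rightarrow> (real \<Rightarrow> real) set" where
  "Q P = \<Union>{C. compact C \<and> connected C \<and> id \<in> C \<and> C \<subseteq> fixers P}"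

lemma fixersD: "g \<in> fixers P \<Longrightarrow> g \<in> \<Gamma>" "g \<in> fixers P \<Longrightarrow> p \<in> P \<Longrightarrow> g p = p"
  by (auto simp: fixers_def)

lemma Q_E:
  assumes "q \<in> Q P"
  obtains C where "compact C" "connected C" "id \<in> C" "C \<subseteq> fixers P" "C \<subseteq> Q P" "q \<in> C"
  using assms unfolding Q_def by blast

lemma Q_I: "compact C \<Longrightarrow> connected C \<Longrightarrow> id \<in> C \<Longrightarrow> C \<subseteq> fixers P \<Longrightarrow> q \<in> C \<Longrightarrow> q \<in> Q P"
  unfolding Q_def by blast

lemma Q_fixers: "Q P \<subseteq> fixers P"
  unfolding Q_def by blast

lemma Q_mem: "q \<in> Q P \<Longrightarrow> q \<in> \<Gamma>" and Q_fix: "q \<in> Q P \<Longrightarrow> p \<in> P \<Longrightarrow> q p = p"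
  using Q_fixers fixersD by blast+

lemma id_fixers: "id \<in> fixers P"
  by (simp add: fixers_def id_mem)

lemma id_Q: "id \<in> Q P"
  by (rule Q_I[of "{id}"]) (auto simp: id_fixers)

lemma comp_fixers: "g \<in> fixers P \<Longrightarrow> h \<in> fixers P \<Longrightarrow> g \<circ> h \<in> fixers P"
  by (simp add: fixers_def comp_mem)

lemma inv_fixers: "g \<in> fixers P \<Longrightarrow> inv g \<in> fixers P"
  by (simp add: fixers_def inv_mem inv_eq)

lemma continuous_on_left: "g \<in> \<Gamma> \<Longrightarrow> continuous_on A (\<lambda>c. g \<circ> c)"
  by (intro continuous_on_comp) (auto simp: continuous_on_id)

lemma continuous_on_right: "A \<subseteq> \<Gamma> \<Longrightarrow> continuous_on A (\<lambda>c. c \<circ> h)"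
  by (intro continuous_on_comp) (auto simp: continuous_on_id)

text \<open>The translate of the second continuum by \<open>q\<close> contains \<open>q\<close>, so
  it can be attached to the first one.\<close>

lemma Q_comp:
  assumes "q \<in> Q P" "q' \<in> Q P"
  shows "q \<circ> q' \<in> Q P"
proof -
  obtain C where C: "compact C" "connected C" "id \<in> C" "C \<subseteq> fixers P" "q \<in> C"
    using Q_E[OF assms(1)] by metis
  obtain D where D: "compact D" "connected D" "id \<in> D" "D \<subseteq> fixers P" "q' \<in> D"
    using Q_E[OF assms(2)] by metis
  let ?E = "(\<lambda>c. q \<circ> c) ` D"
  have cont: "continuous_on D (\<lambda>c. q \<circ> c)"
    using assms(1) Q_mem by (intro continuous_on_left) blast
  have "q \<in> ?E" using D(3) by (metis comp_id image_eqI)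
  then have "connected (C \<union> ?E)"
    using C D cont by (intro connected_Un connected_continuous_image) auto
  moreover have "compact (C \<union> ?E)"
    using C D cont by (intro compact_Un compact_continuous_image) auto
  moreover have "C \<union> ?E \<subseteq> fixers P" using C D comp_fixers by blast
  ultimately show ?thesis using C D by (intro Q_I[of "C \<union> ?E"]) auto
qed

lemma Q_I':
  assumes C: "compact C" "connected C" "C \<subseteq> fixers P" "c \<in> C" "d \<in> C"
  shows "d \<circ> inv c \<in> Q P"
proof -
  have sub: "C \<subseteq> \<Gamma>" using C fixersD by blast
  have c: "c \<in> \<Gamma>" using C sub by blast
  then have "id = c \<circ> inv c" by (auto simp: fun_eq_iff)
  moreover have "(\<lambda>x. x \<circ> inv c) ` C \<subseteq> fixers P"
    using C inv_fixers comp_fixers by blast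
  ultimately show ?thesis
    using C sub by (intro Q_I[of "(\<lambda>x. x \<circ> inv c) ` C"] connected_continuous_image
        compact_continuous_image continuous_on_right) auto
qed

lemma Q_inv:
  assumes "q \<in> Q P"
  shows "inv q \<in> Q P"
proof -
  obtain C where "compact C" "connected C" "id \<in> C" "C \<subseteq> fixers P" "q \<in> C"
    using Q_E[OF assms] by metis
  then show ?thesis using Q_I'[of C P q id] by simp
qed

lemma Q_conj:
  assumes "g \<in> \<Gamma>" "q \<in> Q P"
  shows "g \<circ> q \<circ> inv g \<in> Q (g ` P)"
proof -
  obtain C where C: "compact C" "connected C" "id \<in> C" "C \<subseteq> fixers P" "q \<in> C"
    using Q_E[OF assms(2)] by metis
  let ?f = "\<lambda>c. g \<circ> c \<circ> inv g"
  have sub: "C \<subseteq> \<Gamma>" using C fixersD by blast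
  have "continuous_on C ?f"
    using assms sub by (intro continuous_on_comp continuous_on_left) (auto intro: comp_mem)
  moreover have "?f id = id" using assms by (auto simp: fun_eq_iff)
  moreover have "?f ` C \<subseteq> fixers (g ` P)"
    using C assms unfolding fixers_def by (auto intro!: comp_mem inv_mem)
  ultimately show ?thesis
    using C by (intro Q_I[of "?f ` C"] connected_continuous_image compact_continuous_image)
      (auto simp: image_iff intro: bexI[of _ id])
qed

lemma Q_mono: "P \<subseteq> R \<Longrightarrow> Q R \<subseteq> Q P"
  unfolding Q_def fixers_def by blast

lemma Q_between:
  assumes q: "q \<in> Q P" "r \<in> Q P" and y: "q z \<le> y" "y \<le> r z"
  shows "\<exists>s\<in>Q P. s z = y"
proof -
  obtain C where C: "compact C" "connected C" "id \<in> C" "C \<subseteq> fixers P" "C \<subseteq> Q P" "q \<in> C"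
    using q(1) by (rule Q_E)
  obtain D where D: "compact D" "connected D" "id \<in> D" "D \<subseteq> fixers P" "D \<subseteq> Q P" "r \<in> D"
    using q(2) by (rule Q_E)
  have "connected (C \<union> D)" using C D by (intro connected_Un) auto
  then have "connected ((\<lambda>c. c z) ` (C \<union> D))"
    by (intro connected_continuous_image)
      (rule continuous_on_product_then_coordinatewise[OF continuous_on_id])
  then have "y \<in> (\<lambda>c. c z) ` (C \<union> D)"
    using connectedD_interval[of _ "q z" "r z" y] C(6) D(6) y by blast
  then show ?thesis using C D by blast
qed

text \<open>If \<open>z'\<close> is not reached, then, the orbit of \<open>z\<close> being an
  interval, its supremum \<open>e\<close> lies between \<open>z\<close> and \<open>z'\<close>. The
  orbit is invariant, so \<open>e\<close> is fixed by the whole group, against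
  \<open>moved\<close>.\<close>

lemma Q_transitive:
  assumes "z \<le> z'" and moved: "\<And>y. z \<le> y \<Longrightarrow> y \<le> z' \<Longrightarrow> \<exists>q\<in>Q P. q y \<noteq> y"
  shows "\<exists>q\<in>Q P. q z = z'"
proof (rule ccontr)
  assume no: "\<not> (\<exists>q\<in>Q P. q z = z')"
  define O' where "O' = (\<lambda>q. q z) ` Q P"
  have zO: "z \<in> O'" using id_Q unfolding O'_def by (metis id_apply image_eqI)
  have ub: "o' < z'" if o': "o' \<in> O'" for o'
  proof (rule ccontr)
    assume "\<not> o' < z'"
    then obtain r where "r \<in> Q P" "z' \<le> r z"
      using o' unfolding O'_def not_less by blast
    then show False using no Q_between[OF id_Q, of r P z z'] assms(1) by auto
  qed
  then have bdd: "bdd_above O'" by (meson bdd_aboveI2 less_imp_le bdd_above.I)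
  define e where "e = Sup O'"
  have le: "o' \<le> e" if "o' \<in> O'" for o' unfolding e_def using that bdd by (rule cSup_upper)
  have "z \<le> e" using le zO by blast
  moreover have "e \<le> z'" unfolding e_def using zO ub by (intro cSup_least) (auto intro: less_imp_le)
  moreover have inv: "q x \<in> O'" if q: "q \<in> Q P" "x \<in> O'" for q x
  proof -
    obtain r where "r \<in> Q P" "x = r z" using q(2) by (auto simp: O'_def)
    then have "(q \<circ> r) z = q x" "q \<circ> r \<in> Q P" using q Q_comp by auto
    then show ?thesis unfolding O'_def by (metis image_eqI)
  qed
  have up: "q e \<le> e" if "q \<in> Q P" for q
  proof (rule ccontr)
    assume "\<not> q e \<le> e"
    then have "inv q e < e" using inv_less[OF Q_mem[OF that]] by simp
    then obtain x where "x \<in> O'" "inv q e < x"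
      unfolding e_def using less_cSup_iff[of O'] bdd zO by auto
    then show False using le[OF inv[OF that, of x]] inv_less[OF Q_mem[OF that], of e x] by simp
  qed
  have "q e = e" if "q \<in> Q P" for q
  proof -
    have "inv q e \<le> e" using up Q_inv that by blast
    then have "e \<le> q e" using le_iff[OF Q_mem[OF that], of "inv q e" e] inv_right[OF Q_mem[OF that]] by simp
    then show ?thesis using up[OF that] by simp
  qed
  ultimately show False using moved by blast
qed

end

section \<open>Continuous arguments and the mountain-climbing principle\<close>

lemma cis_Arg2pi:
  assumes "x \<noteq> 0"
  shows "cis (Arg2pi x) = sgn x"
proof -
  have "of_real (cmod x) * cis (Arg2pi x) = x"
    using Arg2pi_eq[of x] by (simp add: cis_conv_exp)
  then show ?thesis using assms by (simp add: sgn_eq eq_divide_eq mult.commute)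
qed

text \<open>Both arguments lie in \<open>{0..pi}\<close>, and the positive real part keeps their
  difference away from \<open>- pi\<close>, so it is a principal argument.\<close>

lemma Arg2pi_diff:
  assumes "Im u \<ge> 0" "Im v \<ge> 0" "u \<noteq> 0" "v \<noteq> 0" "Re (sgn v / sgn u) > 0"
  shows "Arg (sgn v / sgn u) = Arg2pi v - Arg2pi u"
proof -
  define \<delta> where "\<delta> = Arg2pi v - Arg2pi u"
  have "Arg2pi u \<in> {0..pi}" "Arg2pi v \<in> {0..pi}"
    using assms Arg2pi_le_pi Arg2pi_ge_0 by auto
  then have d: "-pi \<le> \<delta>" "\<delta> \<le> pi" by (auto simp: \<delta>_def)
  have r: "sgn v / sgn u = cis \<delta>"
    using assms by (simp add: \<delta>_def cis_Arg2pi flip: cis_divide)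
  have "\<delta> \<noteq> -pi" using assms(5) r by auto
  then show ?thesis using d r Arg_cis[of \<delta>] by (simp add: \<delta>_def)
qed

lemma Re_sgn_divide_pos:
  fixes u v :: complex
  assumes "u \<noteq> 0" "dist (sgn v) (sgn u) < 1"
  shows "Re (sgn v / sgn u) > 0"
proof -
  have n: "norm (sgn u) = 1" using assms by (simp add: norm_sgn)
  then have "norm (sgn v / sgn u - 1) = norm (sgn v - sgn u)"
  proof -
    have "sgn v / sgn u - 1 = (sgn v - sgn u) / sgn u"
      using assms by (simp add: diff_divide_distrib sgn_zero_iff)
    then show ?thesis using n by (simp add: norm_divide)
  qed
  then have "norm (sgn v / sgn u - 1) < 1" using assms by (simp add: dist_norm)
  then show ?thesis using abs_Re_le_cmod[of "sgn v / sgn u - 1"] by simp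
qed

lemma continuous_lift_unique:
  fixes l l' :: "'a::topological_space \<Rightarrow> real"
  assumes C: "connected C" "continuous_on C l" "continuous_on C l'"
    and eq: "\<And>y. y \<in> C \<Longrightarrow> cis (l y) = cis (l' y)"
    and a: "a \<in> C" "l a = l' a" and y: "y \<in> C"
  shows "l y = l' y"
proof -
  have "(\<lambda>y. (l y - l' y) / (2 * pi)) ` C \<subseteq> \<int>"
  proof clarify
    fix y assume "y \<in> C"
    then have "cis (l y - l' y) = 1" using eq by (simp add: cis_divide[symmetric])
    then have "cos (l y - l' y) = 1" by (simp add: complex_eq_iff)
    then obtain n :: int where "l y - l' y = of_int n * 2 * pi" using cos_one_2pi_int by blast
    then show "(l y - l' y) / (2 * pi) \<in> \<int>" by simp
  qed
  moreover have "continuous_on C (\<lambda>y. (l y - l' y) / (2 * pi))"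
    using C by (intro continuous_intros) auto
  moreover have "1 \<le> norm (i - j)" if "i \<in> \<int>" "j \<in> \<int>" "i \<noteq> j" for i j :: real
  proof -
    obtain m n :: int where mn: "i = of_int m" "j = of_int n" using \<open>i \<in> \<int>\<close> \<open>j \<in> \<int>\<close> by (auto elim!: Ints_cases)
    then have "1 \<le> \<bar>m - n\<bar>" using \<open>i \<noteq> j\<close> by auto
    then have "(1::real) \<le> of_int \<bar>m - n\<bar>" by linarith
    then show ?thesis by (simp add: mn)
  qed
  ultimately have "(\<lambda>y. (l y - l' y) / (2 * pi)) constant_on C"
    using C(1) by (intro continuous_discrete_range_constant[of C])
      (auto simp: image_subset_iff intro!: exI[of _ 1])
  then have "(l y - l' y) / (2 * pi) = (l a - l' a) / (2 * pi)"
    using a y unfolding constant_on_def by metis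
  then show ?thesis using a by simp
qed

text \<open>The nonvanishing map \<open>(x, y) \<mapsto> w (x, y) + \<i> (f y - f x)\<close> has, along every fibre
  \<open>{x} \<times> C\<close>, an argument with prescribed values in the lower half plane at \<open>a\<close> and in the upper
  half plane at \<open>c\<close>: this holds at \<open>x = a\<close>, it is an open and closed condition on \<open>x\<close>, and at
  \<open>x = b\<close> it rules out \<open>w (b, c) < 0\<close>.\<close>

lemma level_pairs_same_sign:
  fixes C :: "'a::topological_space set" and f :: "'a \<Rightarrow> real" and w :: "'a \<times> 'a \<Rightarrow> real"
  assumes C: "compact C" "connected C" and f: "continuous_on C f"
    and w: "continuous_on (C \<times> C) w"
    and nz: "\<And>x y. x \<in> C \<Longrightarrow> y \<in> C \<Longrightarrow> f x = f y \<Longrightarrow> w (x, y) \<noteq> 0"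
    and abc: "a \<in> C" "b \<in> C" "c \<in> C" "f c = f b"
    and range: "\<And>x. x \<in> C \<Longrightarrow> f a \<le> f x" "\<And>x. x \<in> C \<Longrightarrow> f x \<le> f b"
    and pos: "w (a, a) > 0"
  shows "w (b, c) > 0"
proof (rule ccontr)
  assume neg: "\<not> w (b, c) > 0"
  define \<Theta> where "\<Theta> x y = Complex (w (x, y)) (f y - f x)" for x y
  define up where "up = Arg2pi"
  define lo where "lo z = - Arg2pi (cnj z)" for z
  have \<Theta>0: "\<Theta> x y \<noteq> 0" if "x \<in> C" "y \<in> C" for x y
    using nz that by (auto simp: \<Theta>_def complex_eq_iff)
  have cf: "continuous_on (C \<times> C) (\<lambda>p. f (fst p))" "continuous_on (C \<times> C) (\<lambda>p. f (snd p))"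
    by (auto intro!: continuous_on_compose2[OF f] continuous_on_fst continuous_on_snd continuous_on_id)
  have cpair: "continuous_on (C \<times> C) (\<lambda>p. \<Theta> (fst p) (snd p))"
    unfolding \<Theta>_def Complex_eq using w cf by (intro continuous_intros) auto
  have cT: "continuous_on C (\<Theta> x)" if "x \<in> C" for x
    using continuous_on_compose2[OF cpair, of C "\<lambda>y. (x, y)"] that
    by (auto simp: continuous_on_Pair continuous_on_const continuous_on_id)
  have csgn: "continuous_on (C \<times> C) (\<lambda>p. sgn (\<Theta> (fst p) (snd p)))"
    using cpair by (rule continuous_on_sgn) (use \<Theta>0 in auto)
  have csgn1: "continuous_on C (\<lambda>y. sgn (\<Theta> x y))" if "x \<in> C" for x
    using cT[OF that] by (rule continuous_on_sgn) (use \<Theta>0 that in auto)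
  have cis_up: "cis (up z) = sgn z" if "z \<noteq> 0" for z
    using cis_Arg2pi that by (simp add: up_def)
  have cis_lo: "cis (lo z) = sgn z" if "z \<noteq> 0" for z
  proof -
    have "cis (lo z) = cnj (cis (up (cnj z)))" by (simp add: lo_def up_def cis_cnj)
    also have "\<dots> = sgn z" using that cis_up[of "cnj z"] by (simp add: sgn_eq)
    finally show ?thesis .
  qed
  have cup: "continuous_on C (\<lambda>y. up (g y))"
    if "continuous_on C g" "\<And>y. y \<in> C \<Longrightarrow> Im (g y) \<ge> 0" "\<And>y. y \<in> C \<Longrightarrow> g y \<noteq> 0" for g
    unfolding up_def
    using that by (intro continuous_on_compose2[OF continuous_on_upperhalf_Arg2pi that(1)]) auto
  define A where "A x \<longleftrightarrow> (\<exists>l. continuous_on C l \<and> (\<forall>y\<in>C. cis (l y) = sgn (\<Theta> x y)) \<and>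
      l a = lo (\<Theta> x a) \<and> l c = up (\<Theta> x c))" for x
  have up0: "up z = 0" "lo z = 0" if "Im z = 0" "Re z > 0" for z
    using that Arg2pi_eq_0[of z] Arg2pi_eq_0[of "cnj z"]
    by (auto simp: up_def lo_def complex_is_Real_iff)
  have Aa: "A a"
    unfolding A_def
  proof (intro exI[of _ "\<lambda>y. up (\<Theta> a y)"] conjI ballI)
    show "continuous_on C (\<lambda>y. up (\<Theta> a y))"
      using abc cT range \<Theta>0 by (intro cup) (auto simp: \<Theta>_def)
    show "cis (up (\<Theta> a y)) = sgn (\<Theta> a y)" if "y \<in> C" for y
      using that abc \<Theta>0 cis_up by blast
    show "up (\<Theta> a a) = lo (\<Theta> a a)"
      using pos by (simp add: up0 \<Theta>_def)
  qed simp
  \<comment> \<open>Openness and closedness at once: if the directions over \<open>x\<close> and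
    \<open>x'\<close> are less than 1 apart, adding the principal argument of their quotient to a
    lift over \<open>x\<close> gives a lift over \<open>x'\<close>. The prescribed values at
    \<open>a\<close> and \<open>c\<close> persist because \<open>\<Theta>\<close> stays in one
    closed half plane at each of these points.\<close>
  have step: "A x'" if "A x" "x \<in> C" "x' \<in> C"
    and close: "\<And>y. y \<in> C \<Longrightarrow> dist (sgn (\<Theta> x' y)) (sgn (\<Theta> x y)) < 1" for x x'
  proof -
    obtain l where l: "continuous_on C l" "\<And>y. y \<in> C \<Longrightarrow> cis (l y) = sgn (\<Theta> x y)"
      "l a = lo (\<Theta> x a)" "l c = up (\<Theta> x c)"
      using \<open>A x\<close> unfolding A_def by blast
    define \<rho> where "\<rho> y = sgn (\<Theta> x' y) / sgn (\<Theta> x y)" for y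
    have Re\<rho>: "Re (\<rho> y) > 0" if "y \<in> C" for y
      unfolding \<rho>_def using Re_sgn_divide_pos[OF \<Theta>0[OF \<open>x \<in> C\<close> that] close[OF that]] .
    have c\<rho>: "continuous_on C \<rho>"
      unfolding \<rho>_def using csgn1[OF \<open>x \<in> C\<close>] csgn1[OF \<open>x' \<in> C\<close>] \<Theta>0 \<open>x \<in> C\<close>
      by (intro continuous_on_divide) (auto simp: sgn_zero_iff)
    show ?thesis
      unfolding A_def
    proof (intro exI[of _ "\<lambda>y. l y + Arg (\<rho> y)"] conjI ballI)
      have "continuous_on C (\<lambda>y. Arg (\<rho> y))"
      proof (rule continuous_on_compose2[OF continuous_on_Arg c\<rho>])
        show "\<rho> ` C \<subseteq> - \<real>\<^sub>\<le>\<^sub>0"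
          using Re\<rho> by (force simp: complex_nonpos_Reals_iff)
      qed
      then show "continuous_on C (\<lambda>y. l y + Arg (\<rho> y))"
        using l(1) by (intro continuous_on_add)
      show "cis (l y + Arg (\<rho> y)) = sgn (\<Theta> x' y)" if "y \<in> C" for y
      proof -
        have n: "\<Theta> x y \<noteq> 0" "\<Theta> x' y \<noteq> 0" using \<Theta>0 that \<open>x \<in> C\<close> \<open>x' \<in> C\<close> by auto
        then have "\<rho> y \<noteq> 0" "norm (\<rho> y) = 1" by (auto simp: \<rho>_def norm_divide norm_sgn sgn_zero_iff)
        then have "cis (Arg (\<rho> y)) = \<rho> y" by (simp add: cis_Arg sgn_eq)
        then show ?thesis using l(2)[OF that] n by (simp add: cis_mult[symmetric] \<rho>_def sgn_zero_iff)
      qed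
      have n: "\<Theta> x a \<noteq> 0" "\<Theta> x' a \<noteq> 0" "\<Theta> x c \<noteq> 0" "\<Theta> x' c \<noteq> 0"
        using \<Theta>0 abc \<open>x \<in> C\<close> \<open>x' \<in> C\<close> by auto
      have "Arg (\<rho> c) = Arg2pi (\<Theta> x' c) - Arg2pi (\<Theta> x c)"
        unfolding \<rho>_def
        using n abc range \<open>x \<in> C\<close> \<open>x' \<in> C\<close> Re\<rho>[OF abc(3)]
        by (intro Arg2pi_diff) (auto simp: \<Theta>_def \<rho>_def)
      then show "l c + Arg (\<rho> c) = up (\<Theta> x' c)" using l(4) by (simp add: up_def)
      have c1: "cnj (\<rho> a) = sgn (cnj (\<Theta> x' a)) / sgn (cnj (\<Theta> x a))"
        by (simp add: \<rho>_def sgn_eq)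
      have "Re (sgn (cnj (\<Theta> x' a)) / sgn (cnj (\<Theta> x a))) > 0"
        unfolding c1[symmetric] using Re\<rho>[OF abc(1)] by simp
      then have "Arg (cnj (\<rho> a)) = Arg2pi (cnj (\<Theta> x' a)) - Arg2pi (cnj (\<Theta> x a))"
        unfolding c1
        using n abc range \<open>x \<in> C\<close> \<open>x' \<in> C\<close>
        by (intro Arg2pi_diff) (auto simp: \<Theta>_def)
      moreover have "Arg (cnj (\<rho> a)) = - Arg (\<rho> a)"
        using Re\<rho>[OF abc(1)] by (auto simp: Arg_cnj Arg_real)
      ultimately show "l a + Arg (\<rho> a) = lo (\<Theta> x' a)" using l(3) by (simp add: lo_def)
    qed
  qed
  have "A b"
  proof (rule connected_partition_const[of C a A])
    fix x assume x: "x \<in> C"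
    have "0 < (1/2::real)" by simp
    from continuous_on_prod_compactE[OF csgn C(1) x this]
    obtain X0 where X0: "x \<in> X0" "open X0"
      and cl: "\<forall>x'\<in>X0 \<inter> C. \<forall>t\<in>C. dist (sgn (\<Theta> (fst (x', t)) (snd (x', t)))) (sgn (\<Theta> (fst (x, t)) (snd (x, t)))) \<le> 1/2"
      by metis
    have "A y = A x" if "y \<in> X0 \<inter> C" for y
    proof -
      have d: "dist (sgn (\<Theta> y t)) (sgn (\<Theta> x t)) < 1" if "t \<in> C" for t
        using cl \<open>y \<in> X0 \<inter> C\<close> that by force
      then show ?thesis using step[of x y] step[of y x] x that by (auto simp: dist_commute)
    qed
    then show "\<exists>U. open U \<and> x \<in> U \<and> (\<forall>y\<in>U \<inter> C. A y = A x)" using X0 by blast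
  qed (use C abc Aa in auto)
  then obtain l where l: "continuous_on C l" "\<And>y. y \<in> C \<Longrightarrow> cis (l y) = sgn (\<Theta> b y)"
      "l a = lo (\<Theta> b a)" "l c = up (\<Theta> b c)"
    unfolding A_def by blast
  \<comment> \<open>As \<open>f b\<close> is maximal, the whole fibre over \<open>b\<close> lies in
    the closed lower half plane and \<open>l\<close> is the lower argument everywhere. At
    \<open>c\<close> the value is a negative real, with lower argument \<open>- pi\<close> but upper
    argument \<open>pi\<close>.\<close>
  have "l c = lo (\<Theta> b c)"
  proof (rule continuous_lift_unique[OF C(2) l(1), of "\<lambda>y. lo (\<Theta> b y)" a])
    have "continuous_on C (\<lambda>y. up (cnj (\<Theta> b y)))"
      using abc cT range \<Theta>0 by (intro cup continuous_on_cnj) (auto simp: \<Theta>_def)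
    then show "continuous_on C (\<lambda>y. lo (\<Theta> b y))"
      unfolding lo_def up_def by (intro continuous_on_minus)
  qed (use l abc cis_lo \<Theta>0 in auto)
  moreover have bc: "Im (\<Theta> b c) = 0" "Re (\<Theta> b c) < 0"
    using neg nz[of b c] abc by (auto simp: \<Theta>_def)
  then have "Arg2pi (\<Theta> b c) = pi" "Arg2pi (cnj (\<Theta> b c)) = pi"
    by (auto simp: Arg2pi_eq_pi complex_is_Real_iff)
  ultimately show False using l(4) by (simp add: up_def lo_def)
qed

lemma Hausdorff_space_top_of_set: "Hausdorff_space (top_of_set (S :: 'a::t2_space set))"
  by (rule Hausdorff_space_subtopology) (use hausdorff in \<open>fastforce simp: Hausdorff_space_def disjnt_def\<close>)

section \<open>Continua acting freely\<close>

context lift_group begin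

text \<open>The quotients of elements of \<open>C\<close> that agree at \<open>z\<close> form a compact set of maps fixing
  \<open>insert z P\<close>; if \<open>c1 \<noteq> c2\<close>, a clopen subset of it separates \<open>inv c1 \<circ> c2\<close> from the identity, and \<open>w\<close>
  is chosen to be positive or negative according to this subset.\<close>

lemma max_attained_once:
  assumes Qz: "Q (insert z P) = {id}"
    and C: "compact C" "connected C" "C \<subseteq> fixers P"
    and c: "c1 \<in> C" "c2 \<in> C" "c1 z = c2 z" "\<And>c. c \<in> C \<Longrightarrow> c z \<le> c1 z"
  shows "c1 = c2"
proof (rule ccontr)
  assume "c1 \<noteq> c2"
  have sub: "C \<subseteq> \<Gamma>" using C fixersD by blast
  have cz: "continuous_on A (\<lambda>c. c z)" for A :: "(real \<Rightarrow> real) set"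
    by (rule continuous_on_product_then_coordinatewise[OF continuous_on_id])
  define h where "h = (\<lambda>(x :: real \<Rightarrow> real, y :: real \<Rightarrow> real). inv x \<circ> y)"
  define E where "E = {p \<in> C \<times> C. fst p z = snd p z}"
  have ch: "continuous_on (C \<times> C) h"
    unfolding h_def case_prod_beta
    by (rule continuous_on_comp[OF continuous_on_inv_fun])
      (use sub in \<open>auto intro!: continuous_on_fst continuous_on_snd continuous_on_id inv_mem\<close>)
  have czf: "continuous_on (C \<times> C) (\<lambda>p. fst p z)" "continuous_on (C \<times> C) (\<lambda>p. snd p z)"
    by (rule continuous_on_product_then_coordinatewise, intro continuous_on_fst continuous_on_snd continuous_on_id)+
  have "closedin (top_of_set (C \<times> C)) {p \<in> C \<times> C. fst p z - snd p z = 0}"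
    using czf by (intro continuous_closedin_preimage_constant continuous_on_diff)
  then have clE: "closedin (top_of_set (C \<times> C)) E" by (simp add: E_def)
  have cCC: "compact (C \<times> C)" using C(1) by (simp add: compact_Times)
  have cE: "compact E" using closedin_compact[OF cCC clE] .
  define D where "D = h ` E"
  have EC: "E \<subseteq> C \<times> C" by (auto simp: E_def)
  have cD: "compact D"
    unfolding D_def using continuous_on_subset[OF ch EC] cE by (rule compact_continuous_image)
  have DF: "D \<subseteq> fixers (insert z P)"
  proof
    fix d assume "d \<in> D"
    then obtain x y where xy: "x \<in> C" "y \<in> C" "x z = y z" "d = inv x \<circ> y"
      by (auto simp: D_def h_def E_def)
    then have "d \<in> fixers P" using C(3) comp_fixers inv_fixers by blast
    moreover have "d z = z" using xy sub by (metis comp_apply inv_left subsetD)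
    ultimately show "d \<in> fixers (insert z P)" by (simp add: fixers_def)
  qed
  define \<tau> where "\<tau> = inv c1 \<circ> c2"
  have \<tau>1: "\<tau> \<noteq> id"
  proof
    assume "\<tau> = id"
    then have "c1 (inv c1 (c2 x)) = c1 x" for x by (metis \<tau>_def comp_apply id_apply)
    then show False using \<open>c1 \<noteq> c2\<close> c sub by (auto simp: fun_eq_iff)
  qed
  have \<tau>D: "\<tau> \<in> D" unfolding D_def \<tau>_def using c by (force simp: h_def E_def)
  have hid: "h (x, x) = id" if "x \<in> C" for x using that sub by (auto simp: h_def fun_eq_iff)
  have idD: "id \<in> D" unfolding D_def using c hid[OF c(1)] by (force simp: E_def image_iff)
  let ?X = "top_of_set D"
  \<comment> \<open>The closure of a connected subset of \<open>D\<close> joining \<open>id\<close>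
    to \<open>\<tau>\<close> would put \<open>\<tau>\<close> into the trivial
    \<open>Q (insert z P)\<close>. Since \<open>D\<close> is compact Hausdorff, the failure to be
    connected sharpens to a clopen separation \<open>T\<close>.\<close>
  have "\<not> connected_component_of ?X id \<tau>"
  proof
    assume "connected_component_of ?X id \<tau>"
    then obtain K where K: "connected K" "K \<subseteq> D" "id \<in> K" "\<tau> \<in> K"
      by (auto simp: connected_component_of_def connectedin_subtopology)
    have "closure K \<subseteq> D" using K(2) cD by (simp add: closure_minimal compact_imp_closed)
    moreover have "compact (closure K)"
      using cD calculation by (metis closed_closure compact_Int_closed inf.absorb_iff2)
    ultimately have "\<tau> \<in> Q (insert z P)"
      using K DF connected_imp_connected_closure[OF K(1)] closure_subset[of K]
      by (intro Q_I[of "closure K"]) auto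
    then show False using Qz \<tau>1 by simp
  qed
  moreover have "quasi_component_of ?X id = connected_component_of ?X id"
    using cD Hausdorff_space_top_of_set[of D]
    by (intro quasi_eq_connected_component_of) (simp add: compact_space_subtopology)
  ultimately have "\<not> quasi_component_of ?X id \<tau>" by simp
  then obtain T where T: "closedin ?X T" "openin ?X T" "id \<in> T" "\<tau> \<notin> T"
    using idD \<tau>D by (auto simp: quasi_component_of)
  have ohE: "continuous_on E h" using continuous_on_subset[OF ch EC] .
  have T': "closedin ?X (D - T)" using T by auto
  have cl1: "closedin (top_of_set E) (E \<inter> h -` T)"
    using continuous_closedin_preimage_gen[OF ohE _ T(1)] by (auto simp: D_def)
  have cl2: "closedin (top_of_set E) (E \<inter> h -` (D - T))"
    using continuous_closedin_preimage_gen[OF ohE _ T'] by (auto simp: D_def)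
  let ?Y = "top_of_set (C \<times> C)"
  have "normal_space ?Y"
    using cCC Hausdorff_space_top_of_set[of "C \<times> C"]
    by (intro compact_Hausdorff_or_regular_imp_normal_space) (simp_all add: compact_space_subtopology)
  \<comment> \<open>\<open>w\<close> extends the sign of the clopen partition from the level pairs
    \<open>E\<close> to the whole square; \<open>level_pairs_same_sign\<close> asks for nonvanishing
    exactly on \<open>E\<close>.\<close>
  then obtain w :: "(real \<Rightarrow> real) \<times> (real \<Rightarrow> real) \<Rightarrow> real"
    where w: "continuous_map ?Y (top_of_set {-1..1}) w"
      and w1: "w ` (E \<inter> h -` (D - T)) \<subseteq> {-1}" and w2: "w ` (E \<inter> h -` T) \<subseteq> {1}"
    by (rule Urysohn_lemma[of ?Y "E \<inter> h -` (D - T)" "E \<inter> h -` T" "-1" 1])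
      (use closedin_trans[OF cl1 clE] closedin_trans[OF cl2 clE] in \<open>auto simp: disjnt_def\<close>)
  have cw: "continuous_on (C \<times> C) w"
    using w by (simp add: continuous_map_in_subtopology)
  obtain a where a: "a \<in> C" "\<And>x. x \<in> C \<Longrightarrow> a z \<le> x z"
    using continuous_attains_inf[OF C(1) _ cz] c(1) by blast
  have "w (c1, c2) > 0"
  proof (rule level_pairs_same_sign[OF C(1,2) cz cw _ a(1) c(1,2)])
    show "w (x, y) \<noteq> 0" if "x \<in> C" "y \<in> C" "x z = y z" for x y
    proof -
      have "(x, y) \<in> E" using that by (simp add: E_def)
      moreover from this have "h (x, y) \<in> D" by (simp add: D_def)
      ultimately show ?thesis using w1 w2 by (cases "h (x, y) \<in> T") force+
    qed
    have "(a, a) \<in> E \<inter> h -` T" using a hid T(3) by (simp add: E_def)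
    then show "w (a, a) > 0" using w2 by force
  qed (use a c in auto)
  moreover have "(c1, c2) \<in> E \<inter> h -` (D - T)"
    using c \<tau>D T(4) by (simp add: E_def h_def \<tau>_def)
  ultimately show False using w1 by force
qed

text \<open>Reduction of an arbitrary level to the maximum:
  \<open>\<tau> = inv c1 \<circ> c2\<close> fixes \<open>z\<close>, and \<open>C\<close> together
  with \<open>C \<circ> \<tau>\<close> is a continuum, as both contain \<open>c2\<close>. If
  \<open>m\<close> attains the maximum at \<open>z\<close>, so does \<open>m \<circ> \<tau>\<close>,
  hence they are equal and \<open>\<tau> = id\<close>.\<close>

lemma continuum_free:
  assumes Qz: "Q (insert z P) = {id}"
    and C: "compact C" "connected C" "C \<subseteq> fixers P"
    and c: "c1 \<in> C" "c2 \<in> C" "c1 z = c2 z"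
  shows "c1 = c2"
proof -
  have sub: "C \<subseteq> \<Gamma>" using C fixersD by blast
  have cz: "continuous_on A (\<lambda>c. c z)" for A :: "(real \<Rightarrow> real) set"
    by (rule continuous_on_product_then_coordinatewise[OF continuous_on_id])
  define \<tau> where "\<tau> = inv c1 \<circ> c2"
  have \<tau>: "c1 \<circ> \<tau> = c2" "\<tau> z = z"
    using c sub by (auto simp: \<tau>_def fun_eq_iff inv_eq)
  have \<tau>F: "\<tau> \<in> fixers P" unfolding \<tau>_def using c C comp_fixers inv_fixers by blast
  let ?Y = "C \<union> (\<lambda>x. x \<circ> \<tau>) ` C"
  obtain m where m: "m \<in> C" "\<And>x. x \<in> C \<Longrightarrow> x z \<le> m z"
    using continuous_attains_sup[OF C(1) _ cz] c(1) by blast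
  have "c2 \<in> (\<lambda>x. x \<circ> \<tau>) ` C" using c \<tau> by blast
  then have "connected ?Y"
    using C c by (intro connected_Un connected_continuous_image continuous_on_right sub) auto
  moreover have "compact ?Y"
    using C by (intro compact_Un compact_continuous_image continuous_on_right sub)
  moreover have "?Y \<subseteq> fixers P" using C \<tau>F comp_fixers by blast
  moreover have "x z \<le> m z" if "x \<in> ?Y" for x using that m \<tau> by auto
  ultimately have "m = m \<circ> \<tau>"
    using m \<tau> by (intro max_attained_once[OF Qz, of ?Y]) auto
  then have "m (\<tau> x) = m x" for x by (metis comp_apply)
  then have "\<tau> = id" using m sub by (auto simp: fun_eq_iff)
  then show ?thesis using \<tau> by simp
qed

lemma Q_free:
  assumes "Q (insert z P) = {id}" "q \<in> Q P" "q z = z"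
  shows "q = id"
proof -
  obtain C where "compact C" "connected C" "id \<in> C" "C \<subseteq> fixers P" "q \<in> C"
    using Q_E[OF assms(2)] by metis
  then show ?thesis using continuum_free[OF assms(1), of C q id] assms(3) by simp
qed

lemma Q_free_eq:
  assumes "Q (insert z P) = {id}" "q \<in> Q P" "r \<in> Q P" "q z = r z"
  shows "q = r"
proof -
  have r: "r \<in> \<Gamma>" "q \<in> \<Gamma>" using assms Q_mem by auto
  have "inv r \<circ> q \<in> Q P" using assms Q_comp Q_inv by blast
  moreover have "(inv r \<circ> q) z = z" using assms r by (simp add: inv_eq)
  ultimately have "inv r \<circ> q = id" using Q_free[OF assms(1)] by blast
  then have "r (inv r (q x)) = r x" for x by (metis comp_apply id_apply)
  then show ?thesis using r by (auto simp: fun_eq_iff)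
qed

text \<open>Freeness makes evaluation at \<open>z\<close> injective on a continuum containing
  \<open>q\<close> and \<open>r\<close>, and compactness makes its inverse continuous.\<close>

lemma Q_section:
  assumes Qz: "Q (insert z P) = {id}" and q: "q \<in> Q P" "r \<in> Q P"
  obtains \<sigma> where "continuous_on {q z..r z} \<sigma>" "\<And>y. y \<in> {q z..r z} \<Longrightarrow> \<sigma> y \<in> Q P"
    "\<And>y. y \<in> {q z..r z} \<Longrightarrow> \<sigma> y z = y"
proof -
  obtain C where C: "compact C" "connected C" "id \<in> C" "C \<subseteq> fixers P" "C \<subseteq> Q P" "q \<in> C"
    using q(1) by (rule Q_E)
  obtain D where D: "compact D" "connected D" "id \<in> D" "D \<subseteq> fixers P" "D \<subseteq> Q P" "r \<in> D"
    using q(2) by (rule Q_E)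
  let ?K = "C \<union> D"
  have K: "compact ?K" "connected ?K" "?K \<subseteq> Q P" using C D by (auto intro: connected_Un compact_Un)
  have cz: "continuous_on ?K (\<lambda>c. c z)"
    by (rule continuous_on_product_then_coordinatewise[OF continuous_on_id])
  have "connected ((\<lambda>c. c z) ` ?K)" using cz K(2) by (rule connected_continuous_image)
  then have sub: "{q z..r z} \<subseteq> (\<lambda>c. c z) ` ?K"
    using connectedD_interval[of "(\<lambda>c. c z) ` ?K" "q z" "r z"] C(6) D(6) by force
  have inj: "inj_on (\<lambda>c. c z) ?K"
    using Q_free_eq[OF Qz] K(3) unfolding inj_on_def by blast
  define \<sigma> where "\<sigma> = inv_into ?K (\<lambda>c. c z)"
  have "continuous_on ((\<lambda>c. c z) ` ?K) \<sigma>"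
    using cz K(1)
    by (rule continuous_on_inv) (use inv_into_f_f[OF inj] in \<open>auto simp: \<sigma>_def\<close>)
  then have "continuous_on {q z..r z} \<sigma>" using sub by (rule continuous_on_subset)
  moreover have "\<sigma> y \<in> Q P" "\<sigma> y z = y" if "y \<in> {q z..r z}" for y
    using that sub K(3) inv_into_into[of y "\<lambda>c. c z" ?K] f_inv_into_f[of y "\<lambda>c. c z" ?K]
    unfolding \<sigma>_def by blast+
  ultimately show ?thesis using that by blast
qed

section \<open>Fixed points and transitivity\<close>


text \<open>The full preimage in the line of the points of the circle represented by
  \<open>P\<close>.\<close>

definition shifts :: "real set \<Rightarrow> real set" where
  "shifts P = {p + of_int k * L | p k. p \<in> P}"

text \<open>An open window of length \<open>L\<close> makes the points of \<open>P\<close>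
  incongruent modulo \<open>L\<close>: they represent \<open>n\<close> points of the circle, whose
  cyclic order has been cut at some place.\<close>

definition cfg :: "nat \<Rightarrow> real set \<Rightarrow> bool" where
  "cfg n P \<longleftrightarrow> finite P \<and> card P = n \<and> (\<exists>a. P \<subseteq> {a<..<a + L})"

text \<open>An increasing map with image \<open>g ` P = R\<close> matches the finite sets \<open>P\<close> and \<open>R\<close> in increasing
  order, so this is transitivity on cyclically ordered \<open>n\<close>-tuples of the circle.\<close>

definition transitive :: "nat \<Rightarrow> bool" where
  "transitive n \<longleftrightarrow> (\<forall>P R. cfg n P \<longrightarrow> cfg n R \<longrightarrow> (\<exists>g\<in>\<Gamma>. g ` P = R))"

lemma shiftsI: "p \<in> P \<Longrightarrow> p + of_int k * L \<in> shifts P"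
  unfolding shifts_def by blast

lemma shifts_superset: "P \<subseteq> shifts P"
  using shiftsI[of _ P 0] by auto

lemma fixers_shifts: "fixers (shifts P) = fixers P"
proof
  show "fixers P \<subseteq> fixers (shifts P)"
    unfolding fixers_def shifts_def by (auto simp: periodic_int)
qed (use shifts_superset in \<open>auto simp: fixers_def\<close>)

lemma Q_shifts_cong: "shifts P = shifts R \<Longrightarrow> Q P = Q R"
  unfolding Q_def by (metis fixers_shifts)

lemma Q_fix_shifts: "q \<in> Q P \<Longrightarrow> p \<in> shifts P \<Longrightarrow> q p = p"
  using Q_fixers fixers_shifts fixersD by blast

lemma shifts_closed: "x \<in> shifts P \<Longrightarrow> x + of_int k * L \<in> shifts P"
proof -
  assume "x \<in> shifts P"
  then obtain p j where p: "p \<in> P" "x = p + of_int j * L" by (auto simp: shifts_def)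
  then have "x + of_int k * L = p + of_int (j + k) * L" by (simp add: algebra_simps)
  then show ?thesis using p shiftsI by metis
qed

lemma shifts_image:
  assumes "\<And>p. p \<in> P \<Longrightarrow> \<exists>k::int. f p = p + of_int k * L"
  shows "shifts (f ` P) = shifts P"
proof
  show "shifts (f ` P) \<subseteq> shifts P"
  proof
    fix x assume "x \<in> shifts (f ` P)"
    then obtain p j where "p \<in> P" "x = f p + of_int j * L" by (auto simp: shifts_def)
    then show "x \<in> shifts P" using assms shiftsI shifts_closed by metis
  qed
  show "shifts P \<subseteq> shifts (f ` P)"
  proof
    fix x assume "x \<in> shifts P"
    then obtain p j where p: "p \<in> P" "x = p + of_int j * L" by (auto simp: shifts_def)
    obtain k :: int where "f p = p + of_int k * L" using assms p by blast
    then have "x = f p + of_int (j - k) * L" using p by (simp add: algebra_simps)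
    then show "x \<in> shifts (f ` P)" using p shiftsI by (metis image_eqI)
  qed
qed

text \<open>The circle is recut at \<open>y\<close>: with \<open>y0\<close> the translate of
  \<open>y\<close> in the window, the points above \<open>y0\<close> move down by one
  period.\<close>

lemma cfg_normalize:
  assumes P: "cfg n P" and y: "y \<notin> shifts P"
  obtains R where "cfg n R" "shifts R = shifts P" "R \<subseteq> {y - L<..<y}"
proof -
  obtain a where a: "P \<subseteq> {a<..<a + L}" using P by (auto simp: cfg_def)
  define k where "k = - \<lfloor>(y - a) / L\<rfloor>"
  define y0 where "y0 = y + of_int k * L"
  have y0: "a \<le> y0" "y0 < a + L"
  proof -
    have "of_int \<lfloor>(y - a) / L\<rfloor> \<le> (y - a) / L" "(y - a) / L < of_int \<lfloor>(y - a) / L\<rfloor> + 1"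
      by linarith+
    then have "of_int \<lfloor>(y - a) / L\<rfloor> * L \<le> y - a" "y - a < (of_int \<lfloor>(y - a) / L\<rfloor> + 1) * L"
      by (simp_all only: pos_le_divide_eq[OF L_pos] pos_divide_less_eq[OF L_pos])
    then show "a \<le> y0" "y0 < a + L" by (simp_all add: y0_def k_def algebra_simps)
  qed
  have y0P: "y0 \<notin> P"
  proof
    assume "y0 \<in> P"
    then have "y0 + of_int (- k) * L \<in> shifts P" by (rule shiftsI)
    then show False using y by (simp add: y0_def)
  qed
  define f where "f p = (if p < y0 then p else p - L) - of_int k * L" for p
  have f: "f p \<in> {y - L<..<y}" if "p \<in> P" for p
  proof -
    have "p \<noteq> y0" "a < p" "p < a + L" using that y0P a by auto
    then show ?thesis using y0 L_pos by (auto simp: f_def y0_def)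
  qed
  have "inj_on f P"
  proof (rule inj_onI)
    fix p q assume "p \<in> P" "q \<in> P" and e: "f p = f q"
    then have "a < p" "p < a + L" "a < q" "q < a + L" using a by auto
    then show "p = q" using e by (auto simp: f_def split: if_splits)
  qed
  then have "card (f ` P) = n" using P by (simp add: card_image cfg_def)
  moreover have "f ` P \<subseteq> {y - L<..<y - L + L}" using f by auto
  ultimately have "cfg n (f ` P)" using P unfolding cfg_def by blast
  moreover have "\<exists>j::int. f p = p + of_int j * L" for p
  proof (cases "p < y0")
    case True
    then have "f p = p + of_int (- k) * L" by (simp add: f_def)
    then show ?thesis ..
  next
    case False
    then have "f p = p + of_int (- 1 - k) * L" by (simp add: f_def algebra_simps)
    then show ?thesis ..
  qed
  then have "shifts (f ` P) = shifts P" by (intro shifts_image)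
  ultimately show ?thesis using that[of "f ` P"] f by blast
qed

lemma gap_not_shifts:
  assumes "finite R" "R \<noteq> {}" "Max R < t" "t < Min R + L"
  shows "t \<notin> shifts R"
proof
  assume "t \<in> shifts R"
  then obtain p k where p: "p \<in> R" "t = p + of_int k * L" by (auto simp: shifts_def)
  have b: "Min R \<le> p" "p \<le> Max R" using p assms by auto
  show False
  proof (cases "k \<le> 0")
    case True
    then have "of_int k * L \<le> 0" using L_pos by (simp add: mult_nonpos_nonneg)
    then show False using p b assms by linarith
  next
    case False
    then have "1 * L \<le> of_int k * L" using L_pos by (intro mult_right_mono) auto
    then show False using p b assms by linarith
  qed
qed

lemma Min_Max_image:
  assumes "g \<in> \<Gamma>" "finite R" "R \<noteq> {}"
  shows "Max (g ` R) = g (Max R)" "Min (g ` R) = g (Min R)"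
  using assms mono_Max_commute[of g R] mono_Min_commute[of g R] strict_mono strict_mono_mono by metis+

lemma Q_conj_inv:
  assumes "g \<in> \<Gamma>" "g ` P = R" "q \<in> Q R"
  shows "inv g \<circ> q \<circ> g \<in> Q P"
proof -
  have "inv g ` R = P" using assms by (auto simp: image_image)
  then show ?thesis using Q_conj[of "inv g" q R] assms by (simp add: inv_mem)
qed

text \<open>If the fixed points of \<open>Q R\<close> in the gap were a proper nonempty subset, the end points of one
  of its complementary intervals could be moved to the end points of the gap.\<close>

lemma fixed_point_fills_gap:
  assumes tr: "transitive n" and n: "2 \<le> n" and R: "cfg n R" "R \<subseteq> {y - L<..<y}"
    and w: "Max R < w" "w < Min R + L" "\<And>q. q \<in> Q R \<Longrightarrow> q w = w"
    and x: "Max R < x" "x < Min R + L" and q: "q \<in> Q R"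
  shows "q x = x"
proof (rule ccontr)
  assume "q x \<noteq> x"
  define l where "l = Max R" define r where "r = Min R + L"
  have fR: "finite R" "R \<noteq> {}" using R n by (auto simp: cfg_def)
  define F where "F = {t. \<forall>q\<in>Q R. q t = t}"
  have "F = (\<Inter>q\<in>Q R. {t. q t = t})" by (auto simp: F_def)
  then have clF: "closed F"
    by (auto intro!: closed_INT closed_Collect_eq continuous continuous_on_id Q_mem)
  have Fk: "t + of_int k * L \<in> F" if "t \<in> F" for t k
    using that unfolding F_def by (auto simp: periodic_int Q_mem)
  have RF: "R \<subseteq> F" using Q_fix by (auto simp: F_def)
  have "Max R \<in> R" "Min R \<in> R" using fR by auto
  then have lr: "l \<in> F" "r \<in> F" "l < x" "x < r"
    using RF Fk[of "Min R" 1] x unfolding l_def r_def by auto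
  have xF: "x \<notin> F" using q \<open>q x \<noteq> x\<close> by (auto simp: F_def)
  \<comment> \<open>\<open>u\<close> and \<open>v\<close> bound the component of \<open>x\<close> in
    the complement of \<open>F\<close>; they belong to \<open>F\<close> because it is
    closed.\<close>
  define u where "u = Sup (F \<inter> {..x})"
  define v where "v = Inf (F \<inter> {x..})"
  have bu: "bdd_above (F \<inter> {..x})" "F \<inter> {..x} \<noteq> {}" using lr by auto
  have bv: "bdd_below (F \<inter> {x..})" "F \<inter> {x..} \<noteq> {}" using lr by auto
  have "u \<in> F \<inter> {..x}" unfolding u_def using bu clF by (intro closed_contains_Sup) auto
  then have u: "u \<in> F" "u < x" using xF by (auto simp: order_le_less)
  have "v \<in> F \<inter> {x..}" unfolding v_def using bv clF by (intro closed_contains_Inf) auto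
  then have v: "v \<in> F" "x < v" using xF by (auto simp: order_le_less)
  have lu: "l \<le> u" unfolding u_def using lr bu by (intro cSup_upper) auto
  have vr: "v \<le> r" unfolding v_def using lr bv by (intro cInf_lower) auto
  have gap: "t \<notin> F" if "u < t" "t < v" for t
  proof
    assume t: "t \<in> F"
    show False
    proof (cases "t \<le> x")
      case True
      then have "t \<le> u" unfolding u_def using t bu by (intro cSup_upper) auto
      then show False using that by simp
    next
      case False
      then have "v \<le> t" unfolding v_def using t bv by (intro cInf_lower) auto
      then show False using that by simp
    qed
  qed
  define M where "M = R - {Max R, Min R}"
  define T where "T = insert u (insert (v - L) M)"
  have "Max R \<noteq> Min R"
  proof
    assume e: "Max R = Min R"
    have "R \<subseteq> {Max R}"
    proof
      fix t assume "t \<in> R"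
      then have "t \<le> Max R" "Min R \<le> t" using fR by auto
      then show "t \<in> {Max R}" using e by auto
    qed
    then have "card R \<le> 1" using card_mono[of "{Max R}" R] by simp
    then show False using n R by (simp add: cfg_def)
  qed
  moreover have "Min R \<le> Max R" using fR by simp
  ultimately have mM: "Min R < Max R" by simp
  have M: "Min R < t" "t < Max R" if "t \<in> M" for t
    using that Min_le[OF fR(1), of t] Max_ge[OF fR(1), of t] by (auto simp: M_def order_le_less)
  have vM: "v - L \<le> Min R" using vr by (simp add: r_def)
  have uM: "Max R \<le> u" using lu by (simp add: l_def)
  have cM: "card M = n - 2"
    using R mM Max_in[OF fR] Min_in[OF fR] fR by (simp add: M_def cfg_def card_Diff_subset)
  have "u \<notin> insert (v - L) M" "v - L \<notin> M" using M vM uM mM by force+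
  then have "card T = n" using cM n fR by (simp add: T_def M_def)
  moreover have "T \<subseteq> {(u + v) / 2 - L<..<(u + v) / 2 - L + L}"
  proof
    fix t assume "t \<in> T"
    then have "v - L \<le> t \<and> t \<le> u" using M[of t] vM uM mM by (auto simp: T_def)
    then show "t \<in> {(u + v) / 2 - L<..<(u + v) / 2 - L + L}" using u v by (auto simp: field_simps)
  qed
  moreover have fT: "finite T" using fR by (simp add: T_def M_def)
  ultimately have "cfg n T" unfolding cfg_def by blast
  then obtain g where g: "g \<in> \<Gamma>" "g ` R = T" using tr R unfolding transitive_def by blast
  have bT: "v - L \<le> t \<and> t \<le> u" if "t \<in> T" for t
    using that M[of t] vM uM mM by (auto simp: T_def)
  have "Max T = u" using fT bT by (intro Max_eqI) (auto simp: T_def)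
  then have gl: "g l = u" using Min_Max_image[OF g(1) fR] g(2) by (simp add: l_def)
  have "Min T = v - L" using fT bT by (intro Min_eqI) (auto simp: T_def)
  then have gr: "g r = v" using Min_Max_image[OF g(1) fR] g(2) periodic[OF g(1)] by (simp add: r_def)
  have QRT: "Q R \<subseteq> Q T"
  proof
    fix s assume "s \<in> Q R"
    then obtain C where C: "compact C" "connected C" "id \<in> C" "C \<subseteq> fixers R" "C \<subseteq> Q R" "s \<in> C"
      by (rule Q_E)
    have "v - L \<in> F" using Fk[OF v(1), of "-1"] by simp
    then have "C \<subseteq> fixers T" using C u v unfolding T_def M_def F_def fixers_def by auto
    then show "s \<in> Q T" using C by (intro Q_I)
  qed
  have "g w \<in> F"
    unfolding F_def
  proof clarify
    fix s assume "s \<in> Q R"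
    then have "inv g \<circ> s \<circ> g \<in> Q R" using Q_conj_inv[OF g] QRT by blast
    then have "(inv g \<circ> s \<circ> g) w = w" using w by blast
    then show "s (g w) = g w" using g by (simp add: inv_eq)
  qed
  moreover have "u < g w" "g w < v" using w g by (simp_all flip: gl gr add: l_def r_def)
  ultimately show False using gap by blast
qed

text \<open>The gap above the maximum can stand for any gap: \<open>R\<close> and \<open>S\<close>
  will be the same points of the circle cut at different places, and the element carrying
  \<open>R\<close> to \<open>S\<close> takes one gap to the other.\<close>

lemma fixed_gap_transfer:
  assumes tr: "transitive n" and R: "cfg n R" "cfg n S" "R \<noteq> {}"
    and fixed: "\<And>x q. Max R < x \<Longrightarrow> x < Min R + L \<Longrightarrow> q \<in> Q R \<Longrightarrow> q x = x"
    and x: "Max S < x" "x < Min S + L" "q \<in> Q S"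
  shows "q x = x"
proof -
  obtain g where g: "g \<in> \<Gamma>" "g ` R = S" using tr R unfolding transitive_def by blast
  have fR: "finite R" using R by (simp add: cfg_def)
  have "Max R < inv g x"
    using x(1) g Min_Max_image[OF g(1) fR R(3)] by (simp add: less_inv)
  moreover have "inv g x < Min R + L"
    using x(2) g Min_Max_image[OF g(1) fR R(3)] by (simp add: inv_less periodic)
  moreover have "inv g \<circ> q \<circ> g \<in> Q R" using Q_conj_inv[OF g x(3)] .
  ultimately have "(inv g \<circ> q \<circ> g) (inv g x) = inv g x" using fixed by blast
  then show ?thesis using g(1) by (simp add: inv_eq)
qed

lemma moved_off_shifts:
  assumes tr: "transitive n" and n: "2 \<le> n" and P: "cfg n P" "Q P \<noteq> {id}" and y: "y \<notin> shifts P"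
  shows "\<exists>q\<in>Q P. q y \<noteq> y"
proof (rule ccontr)
  assume "\<not> ?thesis"
  then have fy: "q y = y" if "q \<in> Q P" for q using that by blast
  obtain R where R: "cfg n R" "shifts R = shifts P" "R \<subseteq> {y - L<..<y}"
    using cfg_normalize[OF P(1) y] .
  have inner: "Max S < t \<and> t < Min S + L \<and> S \<noteq> {}" if S: "cfg n S" "S \<subseteq> {t - L<..<t}" for S t
  proof -
    have "finite S" "S \<noteq> {}" using S n by (auto simp: cfg_def)
    moreover from this have "Max S \<in> S" "Min S \<in> S" by auto
    then have "Max S \<in> {t - L<..<t}" "Min S \<in> {t - L<..<t}" using S(2) by blast+
    then have "Max S < t" "t < Min S + L" unfolding greaterThanLessThan_iff by linarith+
    ultimately show ?thesis by blast
  qed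
  have QR: "Q R = Q P" using R(2) by (rule Q_shifts_cong)
  have "q x = x" if q: "q \<in> Q P" for q x
  proof (cases "x \<in> shifts P")
    case True
    then show ?thesis using q Q_fix_shifts by blast
  next
    case False
    obtain S where S: "cfg n S" "shifts S = shifts P" "S \<subseteq> {x - L<..<x}"
      using cfg_normalize[OF P(1) False] .
    have QS: "Q S = Q P" using S(2) by (rule Q_shifts_cong)
    show ?thesis
    proof (rule fixed_gap_transfer[OF tr R(1) S(1)])
      show "s t = t" if "Max R < t" "t < Min R + L" "s \<in> Q R" for s t
        using fixed_point_fills_gap[OF tr n R(1,3), of y t s] that fy QR inner[OF R(1,3)] by blast
    qed (use inner[OF R(1,3)] inner[OF S(1,3)] q QS in auto)
  qed
  then have "q = id" if "q \<in> Q P" for q using that by (simp add: fun_eq_iff)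
  then show False using P(2) id_Q by blast
qed

definition gap_transitive :: "real set \<Rightarrow> bool" where
  "gap_transitive P \<longleftrightarrow>
     (\<forall>z z'. z \<le> z' \<longrightarrow> {z..z'} \<inter> shifts P = {} \<longrightarrow> (\<exists>q\<in>Q P. q z = z'))"

lemma gap_transitiveI:
  assumes "\<And>y. y \<notin> shifts P \<Longrightarrow> \<exists>q\<in>Q P. q y \<noteq> y"
  shows "gap_transitive P"
  unfolding gap_transitive_def using assms Q_transitive by (metis atLeastAtMost_iff disjoint_iff)

lemma gap_transitiveD:
  assumes "gap_transitive P" "{min z z'..max z z'} \<inter> shifts P = {}"
  shows "\<exists>q\<in>Q P. q z = z'"
proof (cases "z \<le> z'")
  case True
  then show ?thesis using assms by (auto simp: gap_transitive_def)
next
  case False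
  then have "z' \<le> z" "{z'..z} \<inter> shifts P = {}" using assms(2) by (simp_all add: min_def max_def)
  then obtain q where "q \<in> Q P" "q z' = z" using assms(1) unfolding gap_transitive_def by blast
  then have "inv q \<in> Q P" "inv q z = z'" using Q_inv Q_mem by auto
  then show ?thesis by blast
qed

text \<open>The largest points are set aside and the rest is matched by \<open>g\<close>. Then
  \<open>g (Max P)\<close> and \<open>Max R\<close> lie in the same gap of \<open>R0\<close>, where
  \<open>Q R0\<close> takes one to the other without disturbing \<open>R0\<close>.\<close>

lemma transitive_Suc:
  assumes tr: "transitive n" and n: "1 \<le> n" and gt: "\<And>P. cfg n P \<Longrightarrow> gap_transitive P"
  shows "transitive (Suc n)"
  unfolding transitive_def
proof (intro allI impI)
  fix P R assume P: "cfg (Suc n) P" and R: "cfg (Suc n) R"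
  have split: "cfg n (S - {Max S}) \<and> S = insert (Max S) (S - {Max S}) \<and>
      Max (S - {Max S}) < Max S \<and> Max S < Min (S - {Max S}) + L \<and> S - {Max S} \<noteq> {}"
    if S: "cfg (Suc n) S" for S
  proof -
    have fS: "finite S" "S \<noteq> {}" using S by (auto simp: cfg_def)
    obtain a where a: "S \<subseteq> {a<..<a + L}" using S by (auto simp: cfg_def)
    have mx: "Max S \<in> S" using fS by simp
    have c: "card (S - {Max S}) = n" using S mx by (simp add: cfg_def)
    then have ne: "S - {Max S} \<noteq> {}" using n by (metis card.empty not_one_le_zero)
    have i: "Max (S - {Max S}) \<in> S - {Max S}" "Min (S - {Max S}) \<in> S - {Max S}"
      using ne fS by (metis Max_in finite_Diff, metis Min_in finite_Diff)
    then have "Max (S - {Max S}) \<le> Max S" "Max (S - {Max S}) \<noteq> Max S" using fS by auto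
    moreover have "Max S \<in> {a<..<a + L}" "Min (S - {Max S}) \<in> {a<..<a + L}" using a mx i by blast+
    then have "Max S < Min (S - {Max S}) + L" unfolding greaterThanLessThan_iff by linarith
    moreover have "cfg n (S - {Max S})" using c fS a unfolding cfg_def by blast
    ultimately show ?thesis using ne mx by (simp add: insert_absorb)
  qed
  define P0 where "P0 = P - {Max P}" define R0 where "R0 = R - {Max R}"
  note p = split[OF P, folded P0_def] and r = split[OF R, folded R0_def]
  obtain g where g: "g \<in> \<Gamma>" "g ` P0 = R0" using tr p r unfolding transitive_def by blast
  have f0: "finite P0" "P0 \<noteq> {}" using p by (auto simp: cfg_def)
  have "g (Max P0) < g (Max P)" "g (Max P) < g (Min P0 + L)" using p g(1) by auto
  then have gm: "Max R0 < g (Max P)" "g (Max P) < Min R0 + L"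
    using Min_Max_image[OF g(1) f0] g by (auto simp: periodic)
  have "{min (g (Max P)) (Max R)..max (g (Max P)) (Max R)} \<inter> shifts R0 = {}"
  proof -
    have "t \<notin> shifts R0" if "min (g (Max P)) (Max R) \<le> t" "t \<le> max (g (Max P)) (Max R)" for t
      using that gm r by (intro gap_not_shifts) (auto simp: cfg_def min_def max_def split: if_splits)
    then show ?thesis by auto
  qed
  then obtain q where q: "q \<in> Q R0" "q (g (Max P)) = Max R"
    using gap_transitiveD[OF gt] r by blast
  have "q ` R0 = R0" using Q_fix[OF q(1)] by auto
  then have "(q \<circ> g) ` P = R" using p r g(2) q(2) by (metis image_comp image_insert)
  then show "\<exists>g\<in>\<Gamma>. g ` P = R" using q g Q_mem comp_mem by blast
qed

section \<open>No sharply transitive stabilizers\<close>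


lemma Q_funpow: "q \<in> Q P \<Longrightarrow> q ^^ n \<in> Q P"
  by (induction n) (auto simp: id_Q Q_comp)

text \<open>A bounded orbit would have a supremum \<open>s\<close> with \<open>inv g s < s\<close>;
  an iterate beyond \<open>inv g s\<close> is followed by one beyond \<open>s\<close>.\<close>

lemma iterates_unbounded:
  assumes g: "g \<in> \<Gamma>" and up: "\<And>y. z \<le> y \<Longrightarrow> y \<le> t \<Longrightarrow> y < g y"
  shows "\<exists>n. t < (g ^^ n) z"
proof (rule ccontr)
  assume "\<not> ?thesis"
  then have ub: "(g ^^ n) z \<le> t" for n by (simp add: not_less)
  define s where "s = (SUP n. (g ^^ n) z)"
  have bdd: "bdd_above (range (\<lambda>n. (g ^^ n) z))" using ub by (intro bdd_aboveI[of _ t]) auto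
  have le: "(g ^^ n) z \<le> s" for n unfolding s_def using bdd by (intro cSUP_upper) auto
  have "z \<le> s" using le[of 0] by simp
  moreover have "s \<le> t" unfolding s_def using ub by (intro cSUP_least) auto
  ultimately have "inv g s < s" using up g by (simp add: inv_less)
  then obtain n where "inv g s < (g ^^ n) z"
    unfolding s_def using less_cSUP_iff[OF _ bdd] by auto
  then have "s < (g ^^ Suc n) z" using g by (simp add: inv_less)
  then show False using le[of "Suc n"] by simp
qed

text \<open>A crossing of \<open>a\<close> and \<open>b\<close> would give, by the intermediate
  value theorem, a fixed point of \<open>inv a \<circ> b\<close>, and freeness at that point would
  make \<open>a\<close> and \<open>b\<close> equal.\<close>

lemma Q_no_fixed_between:
  assumes Qz: "\<And>t. min y y' \<le> t \<Longrightarrow> t \<le> max y y' \<Longrightarrow> Q (insert t P) = {id}"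
    and ab: "a \<in> Q P" "b \<in> Q P" "a y < b y"
  shows "a y' < b y'"
proof (rule ccontr)
  assume "\<not> a y' < b y'"
  define c where "c = inv a \<circ> b"
  have m: "a \<in> \<Gamma>" "b \<in> \<Gamma>" using ab Q_mem by auto
  then have c: "c \<in> Q P" "c y > y" "c y' \<le> y'"
    using ab \<open>\<not> a y' < b y'\<close> Q_comp Q_inv by (auto simp: c_def less_inv) (meson inv_less not_less less_inv)
  have "continuous_on A (\<lambda>t. c t - t)" for A
    using c Q_mem by (intro continuous_on_diff continuous continuous_on_id) auto
  then have "\<exists>t. min y y' \<le> t \<and> t \<le> max y y' \<and> c t - t = 0"
    using c IVT2'[of "\<lambda>t. c t - t" y' 0 y] IVT'[of "\<lambda>t. c t - t" y' 0 y]
    by (cases "y \<le> y'") (auto simp: min_def max_def)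
  then obtain t where "min y y' \<le> t" "t \<le> max y y'" "c t = t" by auto
  then have "c = id" using Q_free[OF Qz] c(1) by blast
  then show False using c(2) by simp
qed

end

text \<open>In the affine picture of the gap from \<open>l\<close> to \<open>r\<close>, the group
  \<open>Q (insert p S)\<close> of an inner point \<open>p\<close> consists of the dilations about
  \<open>p\<close>, while the groups of the outer points \<open>x\<close> and \<open>x'\<close> play
  the role of the translations. An affine group has only one group of translations, whereas
  \<open>sharp_outer2\<close> makes these two meet only in \<open>id\<close>; this clash leads to
  \<open>inconsistent\<close>.\<close>

locale sharp_gap = lift_group +
  fixes S :: "real set" and l r x x' :: real
  assumes lr: "l < r" and fix_l: "g \<in> fixers S \<Longrightarrow> g l = l" and fix_r: "g \<in> fixers S \<Longrightarrow> g r = r"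
    and left: "\<lbrakk>l < p; p < r; l < z; z < p; l < z'; z' < p\<rbrakk> \<Longrightarrow> \<exists>k\<in>Q (insert p S). k z = z'"
    and right: "\<lbrakk>l < p; p < r; p < z; z < r; p < z'; z' < r\<rbrakk> \<Longrightarrow> \<exists>k\<in>Q (insert p S). k z = z'"
    and sharp: "\<lbrakk>l < p; p < r; l < z; z < r; z \<noteq> p\<rbrakk> \<Longrightarrow> Q (insert z (insert p S)) = {id}"
    and outer: "\<lbrakk>u \<in> {x, x'}; l < z; z < r; l < z'; z' < r\<rbrakk> \<Longrightarrow> \<exists>k\<in>Q (insert u S). k z = z'"
    and sharp_outer: "\<lbrakk>u \<in> {x, x'}; l < z; z < r\<rbrakk> \<Longrightarrow> Q (insert z (insert u S)) = {id}"
    and sharp_outer2: "Q (insert x' (insert x S)) = {id}"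
begin

abbreviation K :: "real \<Rightarrow> (real \<Rightarrow> real) set" where
  "K p \<equiv> Q (insert p S)"

lemma K_sub: "k \<in> K p \<Longrightarrow> k \<in> Q S"
  using Q_mono[of S "insert p S"] by blast

lemma K_fix [simp]: "k \<in> K p \<Longrightarrow> k p = p"
  by (simp add: Q_fix)

lemma mem_gap:
  assumes "h \<in> Q S" "l < z" "z < r"
  shows "l < h z" "h z < r"
proof -
  have "h \<in> fixers S" using assms Q_fixers by blast
  then have "h l = l" "h r = r" "h \<in> \<Gamma>" using fix_l fix_r fixersD by auto
  then show "l < h z" "h z < r" using less_iff[of h l z] less_iff[of h z r] assms by auto
qed

text \<open>The continuum joining \<open>h\<close> to \<open>id\<close> need not fix
  \<open>p\<close>. Each of its elements \<open>c\<close> is corrected by the element of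
  \<open>K x\<close> that takes \<open>p\<close> to \<open>c p\<close>; by \<open>Q_section\<close>
  the correction is continuous, and it leaves alone the elements that fix \<open>p\<close>.\<close>

lemma stabilizer:
  assumes h: "h \<in> Q S" and p: "l < p" "p < r" "h p = p"
  shows "h \<in> K p"
proof -
  obtain C where C: "compact C" "connected C" "id \<in> C" "C \<subseteq> fixers S" "C \<subseteq> Q S" "h \<in> C"
    using h by (rule Q_E)
  have cp: "continuous_on C (\<lambda>c. c p)"
    by (rule continuous_on_product_then_coordinatewise[OF continuous_on_id])
  obtain c0 where c0: "c0 \<in> C" "\<And>c. c \<in> C \<Longrightarrow> c0 p \<le> c p"
    using continuous_attains_inf[OF C(1) _ cp] C(3) by blast
  obtain c1 where c1: "c1 \<in> C" "\<And>c. c \<in> C \<Longrightarrow> c p \<le> c1 p"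
    using continuous_attains_sup[OF C(1) _ cp] C(3) by blast
  have ex: "\<exists>q\<in>Q (insert x S). q p = c p" if "c \<in> C" for c
    using outer[of x p "c p"] mem_gap[of c p] C(5) p that by blast
  obtain q0 where q0: "q0 \<in> Q (insert x S)" "q0 p = c0 p" using ex[OF c0(1)] by blast
  obtain q1 where q1: "q1 \<in> Q (insert x S)" "q1 p = c1 p" using ex[OF c1(1)] by blast
  have Qx: "Q (insert p (insert x S)) = {id}" using sharp_outer p by simp
  obtain \<sigma> where \<sigma>: "continuous_on {c0 p..c1 p} \<sigma>"
    "\<And>y. y \<in> {c0 p..c1 p} \<Longrightarrow> \<sigma> y \<in> Q (insert x S)"
    "\<And>y. y \<in> {c0 p..c1 p} \<Longrightarrow> \<sigma> y p = y"
    using Q_section[OF Qx q0(1) q1(1)] q0(2) q1(2) by metis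
  have rng: "c p \<in> {c0 p..c1 p}" if "c \<in> C" for c using c0 c1 that by auto
  define \<phi> where "\<phi> c = inv (\<sigma> (c p)) \<circ> c" for c
  have "continuous_on C (\<lambda>c. \<sigma> (c p))"
    using continuous_on_compose2[OF \<sigma>(1) cp] rng by blast
  moreover have "(\<lambda>c. \<sigma> (c p)) ` C \<subseteq> \<Gamma>" using rng \<sigma>(2) Q_mem by blast
  ultimately have "continuous_on C \<phi>"
    unfolding \<phi>_def
    by (intro continuous_on_comp continuous_on_inv_fun continuous_on_id) (auto intro!: inv_mem)
  moreover have "\<phi> ` C \<subseteq> fixers (insert p S)"
  proof clarify
    fix c assume c: "c \<in> C"
    have s: "\<sigma> (c p) \<in> Q (insert x S)" using \<sigma>(2) rng c by blast
    then have "\<phi> c \<in> fixers S"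
      unfolding \<phi>_def using K_sub Q_fixers C(4) c by (intro comp_fixers inv_fixers) blast+
    moreover have "\<phi> c p = p" using s \<sigma>(3)[OF rng[OF c]] Q_mem by (simp add: \<phi>_def inv_eq)
    ultimately show "\<phi> c \<in> fixers (insert p S)" by (simp add: fixers_def)
  qed
  moreover have "\<phi> c = c" if "c \<in> C" "c p = p" for c
  proof -
    have "\<sigma> p \<in> Q (insert x S)" "\<sigma> p p = p" using \<sigma>(2,3) rng[OF that(1)] that(2) by auto
    then have "\<sigma> p = id" using Q_free[OF Qx] by blast
    then show ?thesis by (simp add: \<phi>_def that)
  qed
  then have "id \<in> \<phi> ` C" "h \<in> \<phi> ` C" using C p by (force simp: image_iff)+
  ultimately show ?thesis
    using C by (intro Q_I[of "\<phi> ` C"] compact_continuous_image connected_continuous_image) auto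
qed

lemma cmp_right:
  assumes "l < p" "p < r" "a \<in> K p" "b \<in> K p" "a y < b y" "p < y" "y < r" "p < y'" "y' < r"
  shows "a y' < b y'"
  using assms by (intro Q_no_fixed_between[of y y' "insert p S" a b] sharp) (auto simp: min_def max_def split: if_splits)

lemma cmp_left:
  assumes "l < p" "p < r" "a \<in> K p" "b \<in> K p" "a y < b y" "l < y" "y < p" "l < y'" "y' < p"
  shows "a y' < b y'"
  using assms by (intro Q_no_fixed_between[of y y' "insert p S" a b] sharp) (auto simp: min_def max_def split: if_splits)

lemma K_free: "\<lbrakk>k \<in> K p; l < p; p < r; l < z; z < r; z \<noteq> p; k z = z\<rbrakk> \<Longrightarrow> k = id"
  using Q_free sharp by blast

text \<open>Archimedean argument: if \<open>a \<circ> b\<close> and \<open>b \<circ> a\<close> differed, some \<open>e\<close> would be so small that \<open>e \<circ> e\<close>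
  is at most their quotient, while \<open>a\<close> and \<open>b\<close> agree with powers of \<open>e\<close> up to one factor \<open>e\<close> each.\<close>

lemma not_less_commute:
  assumes p: "l < p" "p < r" and z: "p < z" "z < r"
    and a: "a \<in> K p" "z < a z" and b: "b \<in> K p" "z < b z"
  shows "\<not> b (a z) < a (b z)"
proof
  assume less: "b (a z) < a (b z)"
  have J: "p < k y \<and> k y < r" if "k \<in> K p" "p < y" "y < r" for k y
    using that mem_gap[OF K_sub[OF that(1)], of y] p less_iff[OF Q_mem[OF that(1)], of p y] by auto
  define y0 where "y0 = b (a z)" define y1 where "y1 = a (b z)"
  define m where "m = (y0 + y1) / 2"
  have y: "p < y0" "y0 < m" "m < y1" "y1 < r" "p < m" "m < r"
  proof -
    have "p < b (a z)" "a (b z) < r" using J[OF b(1)] J[OF a(1)] z by blast+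
    then show "p < y0" "y0 < m" "m < y1" "y1 < r" "p < m" "m < r"
      using less by (auto simp: y0_def y1_def m_def)
  qed
  have y0r: "y0 < r" and y1p: "p < y1" using y by auto
  obtain e1 where e1: "e1 \<in> K p" "e1 y0 = m" using right[of p y0 m] p y y0r by blast
  obtain e2 where e2: "e2 \<in> K p" "e2 m = y1" using right[of p m y1] p y y1p by blast
  \<comment> \<open>\<open>e\<close> is the smaller of the maps taking \<open>y0\<close> to the
    midpoint \<open>m\<close> and \<open>m\<close> to \<open>y1\<close>, so that
    \<open>e (e y0) \<le> y1\<close>.\<close>
  obtain e where e: "e \<in> K p" "e y0 \<le> e1 y0" "e y0 \<le> e2 y0" "e \<in> {e1, e2}"
    using e1 e2 by (metis insertCI linear)
  have le: "c t \<le> d t" if "c \<in> K p" "d \<in> K p" "c s \<le> d s" "p < s" "s < r" "p < t" "t < r" for c d s t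
    using cmp_right[OF p that(2,1), of t s] that by force
  have e_up: "t < e t" if "p < t" "t < r" for t
  proof -
    have "y0 < e1 y0" "m < e2 m" using e1 e2 y by auto
    then have "t < e1 t" "t < e2 t"
      using cmp_right[OF p id_Q e1(1), of y0 t] cmp_right[OF p id_Q e2(1), of m t] y y0r that by auto
    then show ?thesis using e(4) by auto
  qed
  have ee: "e (e y0) \<le> y1"
  proof -
    have em: "e \<in> \<Gamma>" using e(1) Q_mem by blast
    have "e (e y0) \<le> e m" using e(2) e1(2) em by simp
    also have "\<dots> \<le> e2 m" using le[OF e(1) e2(1) e(3)] y y0r by blast
    finally show ?thesis using e2(2) by simp
  qed
  have pow: "\<exists>n. (\<forall>t. p < t \<longrightarrow> t < r \<longrightarrow> (e ^^ n) t \<le> c t \<and> c t < (e ^^ Suc n) t)"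
    if c: "c \<in> K p" "z < c z" for c
  proof -
    have cz: "p < c z" "c z < r" using J[OF c(1) z] by auto
    have "\<exists>n. c z < (e ^^ n) z"
      using z cz e_up Q_mem[OF e(1)] by (intro iterates_unbounded) auto
    then have N: "c z < (e ^^ (LEAST n. c z < (e ^^ n) z)) z" (is "_ < (e ^^ ?N) z") by (rule LeastI_ex)
    have "?N \<noteq> 0" using N c by (metis funpow_0 less_asym')
    then obtain n where n: "?N = Suc n" using not0_implies_Suc by blast
    then have "\<not> c z < (e ^^ n) z" using not_less_Least[of n "\<lambda>n. c z < (e ^^ n) z"] by simp
    then have "(e ^^ n) z \<le> c z" by simp
    moreover have "c z < (e ^^ Suc n) z" using N n by simp
    ultimately have "(e ^^ n) t \<le> c t \<and> c t < (e ^^ Suc n) t" if "p < t" "t < r" for t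
      using le[OF Q_funpow[OF e(1)] c(1) _ z that] cmp_right[OF p c(1) Q_funpow[OF e(1)] _ z that] by blast
    then show ?thesis by blast
  qed
  obtain i where i: "\<And>t. p < t \<Longrightarrow> t < r \<Longrightarrow> (e ^^ i) t \<le> a t \<and> a t < (e ^^ Suc i) t"
    using pow[OF a] by blast
  obtain k where k: "\<And>t. p < t \<Longrightarrow> t < r \<Longrightarrow> (e ^^ k) t \<le> b t \<and> b t < (e ^^ Suc k) t"
    using pow[OF b] by blast
  have em: "e ^^ n \<in> \<Gamma>" for n using Q_funpow[OF e(1)] Q_mem by blast
  \<comment> \<open>The two lower bounds give \<open>(e ^^ (k + i)) z \<le> y0\<close>, the two
    strict upper bounds \<open>y1 < (e ^^ (k + i + 2)) z\<close>; together
    \<open>y1 < e (e y0)\<close>.\<close>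
  have "(e ^^ k) ((e ^^ i) z) \<le> (e ^^ k) (a z)" using i z em by simp
  also have "\<dots> \<le> y0" unfolding y0_def using k J[OF a(1) z] by blast
  finally have "(e ^^ (k + i)) z \<le> y0" by (simp add: funpow_add)
  then have low: "e (e ((e ^^ (k + i)) z)) \<le> e (e y0)" using em[of 1] by simp
  have "y1 < (e ^^ Suc i) (b z)" unfolding y1_def using i J[OF b(1) z] by blast
  also have "\<dots> < (e ^^ Suc i) ((e ^^ Suc k) z)" using k[OF z] less_iff[OF em] by blast
  also have "\<dots> = (e ^^ (Suc i + Suc k)) z" by (simp only: funpow_add comp_apply)
  also have "Suc i + Suc k = Suc (Suc (k + i))" by simp
  also have "(e ^^ Suc (Suc (k + i))) z = e (e ((e ^^ (k + i)) z))" by simp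
  finally show False using low ee by linarith
qed

text \<open>Hoelder's theorem for the Archimedean ordered group \<open>K p\<close>. Comparing
  \<open>a \<circ> b\<close> and \<open>b \<circ> a\<close> at the single point \<open>z\<close> is
  enough by freeness, and inverses reduce to elements pushing \<open>z\<close> to the right.\<close>

lemma K_commute:
  assumes p: "l < p" "p < r" and a: "a \<in> K p" and b: "b \<in> K p"
  shows "a \<circ> b = b \<circ> a"
proof -
  define z where "z = (p + r) / 2"
  have z: "p < z" "z < r" using p by (auto simp: z_def)
  have z': "l < z" "z \<noteq> p" using z p by auto
  have eq: "a \<circ> b = b \<circ> a" if "a \<in> K p" "b \<in> K p" "a (b z) = b (a z)" for a b
    using Q_free_eq[OF sharp[OF p z'(1) z(2) z'(2)] Q_comp[OF that(1,2)] Q_comp[OF that(2,1)]] that(3) by simp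
  have pos: "a \<circ> b = b \<circ> a" if "a \<in> K p" "z < a z" "b \<in> K p" "z < b z" for a b
    using not_less_commute[OF p z that] not_less_commute[OF p z that(3,4,1,2)] eq[OF that(1,3)]
    by (meson linorder_neqE_linordered_idom)
  have half: "a \<circ> b = b \<circ> a"
    if a: "a \<in> K p" and c: "\<And>c. c \<in> K p \<Longrightarrow> z < c z \<Longrightarrow> c \<circ> b = b \<circ> c" for a b
  proof -
    have am: "a \<in> \<Gamma>" using a Q_mem by blast
    consider "z < a z" | "a z = z" | "z < inv a z" using less_inv[OF am, of z z] by linarith
    then show ?thesis
    proof cases
      case 2
      then have "a = id" using K_free[OF a p z'(1) z(2) z'(2)] by blast
      then show ?thesis by simp
    next
      case 3
      then have e: "inv a \<circ> b = b \<circ> inv a" using c Q_inv[OF a] by blast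
      show ?thesis
      proof
        fix t
        have "b t = inv a (b (a t))" using fun_cong[OF e, of "a t"] am by simp
        then show "(a \<circ> b) t = (b \<circ> a) t" using am by simp
      qed
    qed (use c a in blast)
  qed
  have "c \<circ> b = b \<circ> c" if c: "c \<in> K p" "z < c z" for c
    using half[OF b, of c] pos c by metis
  then show ?thesis using half[OF a] by blast
qed

text \<open>\<open>Q_section\<close> joins the two elements by an arc in \<open>K p\<close> whose
  values at \<open>y\<close> stay above \<open>y\<close>. No element of the arc is
  \<open>id\<close>, so by freeness none fixes \<open>w\<close>, and the displacement of
  \<open>w\<close> cannot change sign.\<close>

lemma same_sign:
  assumes p: "l < p" "p < r" and a: "a \<in> K p" and b: "b \<in> K p"
    and y: "p < y" "y < r" "y < a y" "y < b y" and w: "l < w" "w < p" "w < a w"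
  shows "w < b w"
proof (rule ccontr)
  assume "\<not> w < b w"
  have Qy: "Q (insert y (insert p S)) = {id}" using sharp p y by auto
  have main: False if q: "q \<in> K p" "s \<in> K p" "y < q y" "q y \<le> s y" "q w \<le> w \<and> w \<le> s w \<or> s w \<le> w \<and> w \<le> q w" for q s
  proof -
    obtain \<sigma> where \<sigma>: "continuous_on {q y..s y} \<sigma>" "\<And>t. t \<in> {q y..s y} \<Longrightarrow> \<sigma> t \<in> K p"
      "\<And>t. t \<in> {q y..s y} \<Longrightarrow> \<sigma> t y = t"
      using Q_section[OF Qy q(1,2)] by metis
    have "\<sigma> (q y) = q" "\<sigma> (s y) = s"
      using Q_free_eq[OF Qy _ q(1)] Q_free_eq[OF Qy _ q(2)] \<sigma> q(4) by auto
    moreover have "continuous_on {q y..s y} (\<lambda>t. \<sigma> t w)"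
      using continuous_on_product_then_coordinatewise[OF \<sigma>(1)] .
    ultimately obtain t where t: "q y \<le> t" "t \<le> s y" "\<sigma> t w = w"
      using q(4,5) IVT'[of "\<lambda>t. \<sigma> t w" "q y" w "s y"] IVT2'[of "\<lambda>t. \<sigma> t w" "s y" w "q y"] by auto
    then have "\<sigma> t = id" using K_free[of "\<sigma> t" p w] \<sigma>(2) p w by auto
    then show False using \<sigma>(3)[of t] t q(3) by auto
  qed
  show False
    using main[OF a b] main[OF b a] y w \<open>\<not> w < b w\<close> by (cases "a y \<le> b y") auto
qed

text \<open>Elements of \<open>K p\<close> expand or contract at \<open>p\<close>. Otherwise two elements pushing to the right, with
  fixed points \<open>p < p'\<close> and equal at some \<open>y > p'\<close>, would cross a second time between \<open>p\<close> and \<open>p'\<close>.\<close>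

lemma not_push_right:
  assumes p: "l < p" "p < r" and k: "k \<in> K p" and z: "l < z" "z < p" "z < k z"
    and y: "p < y" "y < r" "y < k y"
  shows False
proof -
  define p' where "p' = (p + r) / 2"
  define y' where "y' = (p' + r) / 2"
  have p': "l < p'" "p < p'" "p' < r" "p' < y'" "y' < r" using p by (auto simp: p'_def y'_def field_simps)
  obtain t where t: "t \<in> Q (insert x S)" "t p = p'" using outer[of x p p'] p p' by auto
  have tm: "t \<in> \<Gamma>" and tS: "t \<in> Q S" using t Q_mem K_sub by auto
  have "t ` insert p S = insert p' S"
    using t Q_fix[OF tS] by auto
  then have k': "t \<circ> k \<circ> inv t \<in> K p'" using Q_conj[OF tm k] by simp
  define k' where "k' = t \<circ> k \<circ> inv t"
  have k'm: "k' \<in> K p'" using k' by (simp add: k'_def)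
  have kt: "k' (t u) = t (k u)" for u using tm by (simp add: k'_def)
  have ky': "y' < k y'" using cmp_right[OF p id_Q k, of y y'] y p' by auto
  have kp': "p' < k p'" using cmp_right[OF p id_Q k, of y p'] y p' by auto
  have "p' < t y" "t y < r" using less_iff[OF tm, of p y] t mem_gap[OF tS, of y] p y by auto
  then have k'y: "y' < k' y'"
    using cmp_right[OF p'(1,3) id_Q k'm, of "t y" y'] kt[of y] y tm p' by auto
  have "l < t z" "t z < p'" using less_iff[OF tm, of z p] t mem_gap[OF tS, of z] p z by auto
  then have k'p: "p < k' p"
    using cmp_left[OF p'(1,3) id_Q k'm, of "t z" p] kt[of z] z tm p p' by auto
  \<comment> \<open>\<open>k'\<close> only shows how elements of \<open>K p'\<close> behave: by
    \<open>same_sign\<close> the element \<open>h\<close> that agrees with \<open>k\<close> at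
    \<open>y'\<close> pushes \<open>p\<close> to the right as well. Then
    \<open>inv k \<circ> h\<close> fixes \<open>y'\<close> but moves \<open>p\<close> to the right
    and \<open>p'\<close> to the left, although both lie on the same side of
    \<open>y'\<close>.\<close>
  have "k y' < r" using mem_gap[OF K_sub[OF k], of y'] p' by auto
  then obtain h where h: "h \<in> K p'" "h y' = k y'" using right[of p' y' "k y'"] p' ky' by auto
  have hp: "p < h p"
    using same_sign[OF p'(1,3) k'm h(1) p'(4,5) k'y _ p(1) p'(2) k'p] h(2) ky' by simp
  define s where "s = inv k \<circ> h"
  have km: "k \<in> \<Gamma>" using k Q_mem by auto
  have sS: "s \<in> Q S" unfolding s_def using k h K_sub Q_comp Q_inv by blast
  have "s y' = y'" using h(2) km by (simp add: s_def)
  moreover have "l < y'" using p' by simp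
  ultimately have s: "s \<in> K y'" using stabilizer[OF sS] p'(5) by blast
  have "p < s p" using hp k km by (simp add: s_def less_inv)
  moreover have "s p' < p'" using h(1) kp' km by (simp add: s_def inv_less)
  moreover have "l < y'" "p < y'" using p' by auto
  ultimately show False using cmp_left[OF _ p'(5) id_Q s, of p p'] p p' by auto
qed

lemma alternate:
  assumes p: "l < p" "p < r" and k: "k \<in> K p" and z: "l < z" "z < p" and y: "p < y" "y < r"
  shows "k z < z \<longleftrightarrow> y < k y"
proof
  assume kz: "k z < z"
  show "y < k y"
  proof (rule ccontr)
    assume "\<not> y < k y"
    moreover have "k y \<noteq> y" using K_free[OF k p, of y] p y kz by auto
    ultimately have "k y < y" by simp
    then show False
      using not_push_right[OF p Q_inv[OF k] z _ y] kz Q_mem[OF k] by (simp add: less_inv)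
  qed
next
  assume ky: "y < k y"
  have "k z \<noteq> z" using K_free[OF k p, of z] p z ky by auto
  moreover have "\<not> z < k z" using not_push_right[OF p k z _ y ky] by blast
  ultimately show "k z < z" by simp
qed

text \<open>The conjugates of \<open>h = inv f \<circ> g\<close> by powers of \<open>f\<close> have fixed points tending to \<open>r\<close>, while
  their composites with \<open>f\<close> still push to the right. By commutativity they are also conjugates of
  \<open>h\<close> by elements of \<open>K z\<close>, and those push \<open>h z\<close> too far to the left.\<close>

lemma no_crossing:
  assumes f: "f \<in> Q S" and g: "g \<in> Q S" and j: "l < j" "j < r" "f j = g j"
    and up: "\<And>y. l < y \<Longrightarrow> y < r \<Longrightarrow> y < f y" "\<And>y. l < y \<Longrightarrow> y < r \<Longrightarrow> y < g y"
    and z: "l < z" "z < j" "inv f (g z) < z"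
  shows False
proof -
  have fm: "f \<in> \<Gamma>" "g \<in> \<Gamma>" using f g Q_mem by auto
  define h where "h = inv f \<circ> g"
  have hS: "h \<in> Q S" unfolding h_def using f g Q_comp Q_inv by blast
  have "h j = j" using j fm by (simp add: h_def flip: j(3))
  then have h: "h \<in> K j" using stabilizer hS j by blast
  have hz: "l < h z" "h z < z" using mem_gap[OF hS, of z] z j by (auto simp: h_def)
  define z1 where "z1 = inv f z"
  have z1: "l < z1" "z1 < z" "z1 < h z"
    using mem_gap[OF Q_inv[OF f], of z] z j up fm by (auto simp: z1_def h_def inv_less)
  have zr: "z < r" using z j by simp
  \<comment> \<open>\<open>w\<close> is a yardstick: it fixes \<open>z\<close> and pushes
    \<open>h z\<close> down exactly to \<open>z1 = inv f z\<close>. An element of \<open>K z\<close>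
    that moves \<open>j\<close> further than \<open>w\<close> does must push \<open>h z\<close>
    below \<open>z1\<close>.\<close>
  obtain w where w: "w \<in> K z" "w (h z) = z1" using left[OF z(1) zr hz z1(1,2)] by blast
  have "j < w j" using alternate[OF z(1) zr w(1) hz z(2) j(2)] w z1 by simp
  have wj: "l < w j" "w j < r" using mem_gap[OF K_sub[OF w(1)]] j by auto
  obtain m where m: "w j < (f ^^ m) j"
    using iterates_unbounded[OF fm(1), of j "w j"] up j wj by auto
  define F where "F = f ^^ m"
  have F: "F \<in> Q S" unfolding F_def using f by (rule Q_funpow)
  have Fm: "F \<in> \<Gamma>" using F Q_mem by blast
  have Fj: "z < F j" "F j < r" using m \<open>j < w j\<close> z mem_gap[OF F] j by (auto simp: F_def)
  obtain v where v: "v \<in> K z" "v j = F j" using right[OF z(1) zr z(2) j(2) Fj] by blast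
  have vm: "v \<in> \<Gamma>" using v Q_mem by blast
  define c where "c = inv v \<circ> F"
  have cS: "c \<in> Q S" unfolding c_def using v F K_sub Q_comp Q_inv by blast
  have "c j = j" using v vm by (simp add: c_def inv_eq)
  then have c: "c \<in> K j" using stabilizer cS j by blast
  have cm: "c \<in> \<Gamma>" using c Q_mem by blast
  have Fvc: "F t = v (c t)" for t using vm by (simp add: c_def)
  have iz: "c (inv F z) = z" using Fvc[of "inv F z"] Fm vm v(1) by (metis K_fix eq_iff inv_right)
  have "F (h (inv F z)) = v (c (h (inv F z)))" by (rule Fvc)
  \<comment> \<open>Since \<open>F = v \<circ> c\<close> and \<open>c\<close> commutes with
    \<open>h\<close>, conjugating \<open>h\<close> by \<open>F\<close> or by \<open>v\<close> gives
    the same value at \<open>z\<close>, namely \<open>v (h z)\<close>.\<close>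
  also have "c (h (inv F z)) = h (c (inv F z))"
    using fun_cong[OF K_commute[OF j(1,2) c h], of "inv F z"] by simp
  finally have e: "F (h (inv F z)) = v (h z)" using iz by simp
  \<comment> \<open>\<open>F\<close> is a power of \<open>f\<close>, so \<open>f\<close> times the
    conjugate of \<open>h\<close> by \<open>F\<close> is the conjugate of \<open>g\<close>, which
    still pushes \<open>z\<close> to the right.\<close>
  have "f (F t) = F (f t)" for t by (simp add: F_def funpow_swap1)
  then have "f (F (h (inv F z))) = F (g (inv F z))" using fm by (simp add: h_def)
  moreover have "inv F z < g (inv F z)"
    using mem_gap[OF Q_inv[OF F] z(1) zr] up(2) by blast
  ultimately have "z < f (v (h z))" using Fm e by (simp add: inv_less)
  then have "z1 < v (h z)" using fm by (simp add: z1_def inv_less)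
  \<comment> \<open>\<open>v j = F j\<close> lies beyond \<open>w j\<close>, so \<open>v\<close>
    moves \<open>j\<close> further than the yardstick and \<open>v (h z)\<close> falls below
    \<open>z1\<close>.\<close>
  define d where "d = inv w \<circ> v"
  have wm: "w \<in> \<Gamma>" using w Q_mem by blast
  have d: "d \<in> K z" unfolding d_def using w v Q_comp Q_inv by blast
  have "j < d j" using m v wm by (simp add: d_def less_inv F_def)
  then have "d (h z) < h z" using alternate[OF z(1) zr d hz z(2) j(2)] by simp
  then have "v (h z) < z1" using w wm by (simp add: d_def inv_less)
  then show False using \<open>z1 < v (h z)\<close> by simp
qed

text \<open>Elements of \<open>K x\<close> and \<open>K x'\<close> taking \<open>j\<close> to
  \<open>k\<close> push the whole gap to the right and agree at \<open>j\<close>. If they were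
  equal, they would fix both \<open>x\<close> and \<open>x'\<close> and be \<open>id\<close>; so
  they differ at \<open>z\<close>, and \<open>no_crossing\<close> excludes both orders.\<close>

lemma inconsistent: False
proof -
  define j where "j = (l + r) / 2" define k where "k = (j + r) / 2" define z where "z = (l + j) / 2"
  have jk: "l < j" "j < r" "j < k" "k < r" "l < k" "l < z" "z < j" "z < r"
    using lr by (auto simp: j_def k_def z_def field_simps)
  obtain f where f: "f \<in> K x" "f j = k" using outer[of x j k] jk by auto
  obtain g where g: "g \<in> K x'" "g j = k" using outer[of x' j k] jk by auto
  have up: "y < q y" if q: "q \<in> K u" "u \<in> {x, x'}" "q j = k" and y: "l < y" "y < r" for q u y
  proof -
    have "id y < q y"
      using q jk y
      by (intro Q_no_fixed_between[of j y "insert u S" id q] sharp_outer id_Q)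
        (auto simp: min_def max_def split: if_splits)
    then show ?thesis by simp
  qed
  have fup: "y < f y" if "l < y" "y < r" for y using up[OF f(1) _ f(2) that] by simp
  have gup: "y < g y" if "l < y" "y < r" for y using up[OF g(1) _ g(2) that] by simp
  have fm: "f \<in> \<Gamma>" "g \<in> \<Gamma>" using f g Q_mem by auto
  have S: "f \<in> Q S" "g \<in> Q S" using f g K_sub by auto
  define h where "h = inv f \<circ> g"
  have hS: "h \<in> Q S" unfolding h_def using S Q_comp Q_inv by blast
  have "h j = j" using f g fm by (simp add: h_def inv_eq)
  then have h: "h \<in> K j" using stabilizer hS jk by blast
  have "h \<noteq> id"
  proof
    assume "h = id"
    then have "f (inv f (g t)) = f t" for t by (metis h_def comp_apply id_apply)
    then have "f = g" using fm by (auto simp: fun_eq_iff)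
    then have "f x' = x'" using g by simp
    then have "f = id" using Q_free[OF sharp_outer2 f(1)] by simp
    then show False using f jk by simp
  qed
  then have "h z \<noteq> z" using K_free[OF h, of z] jk by auto
  then consider "h z < z" | "z < h z" by linarith
  then show False
  proof cases
    case 1
    then show ?thesis using no_crossing[OF S jk(1,2) _ fup gup jk(6,7)] f g by (simp add: h_def)
  next
    case 2
    then have "inv g (f z) < z" using fm by (simp add: h_def less_inv inv_less)
    then show ?thesis using no_crossing[OF S(2,1) jk(1,2) _ gup fup jk(6,7)] f g by simp
  qed
qed

end

section \<open>Propagating transitivity to one more point\<close>

context lift_group begin

text \<open>Unlike \<open>cfg\<close> this is insensitive to shifting single points by multiples of
  \<open>L\<close>, so that a further point can be inserted at any representative.\<close>

definition config :: "nat \<Rightarrow> real set \<Rightarrow> bool" where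
  "config n P \<longleftrightarrow> (\<exists>R. cfg n R \<and> shifts R = shifts P)"

lemma shifts_insert: "shifts (insert p P) = shifts {p} \<union> shifts P"
  unfolding shifts_def by blast

lemma cfg_insert:
  assumes R: "cfg n R" "R \<subseteq> {z - L<..<z}" and n: "1 \<le> n"
  shows "cfg (Suc n) (insert z R)"
proof -
  have f: "finite R" "R \<noteq> {}" using R n by (auto simp: cfg_def)
  define a where "a = (z - L + Min R) / 2"
  have "Min R \<in> {z - L<..<z}" using f R(2) Min_in[of R] by blast
  then have m: "z - L < Min R" "Min R < z" by auto
  have "insert z R \<subseteq> {a<..<a + L}"
  proof
    fix t assume "t \<in> insert z R"
    then have "Min R \<le> t" "t \<le> z" using f R(2) m by auto
    then show "t \<in> {a<..<a + L}" using m by (auto simp: a_def field_simps)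
  qed
  moreover have "z \<notin> R" using R by auto
  ultimately show ?thesis using R f unfolding cfg_def by auto
qed

lemma config_insert:
  assumes "config n P" "z \<notin> shifts P" "1 \<le> n"
  shows "config (Suc n) (insert z P)"
proof -
  obtain R0 where R0: "cfg n R0" "shifts R0 = shifts P" using assms by (auto simp: config_def)
  obtain R where R: "cfg n R" "shifts R = shifts P" "R \<subseteq> {z - L<..<z}"
    using cfg_normalize[OF R0(1)] R0(2) assms(2) by metis
  have "shifts (insert z R) = shifts (insert z P)" using R by (metis shifts_insert)
  then show ?thesis using cfg_insert[OF R(1,3) assms(3)] unfolding config_def by blast
qed

lemma config_Q: "config n P \<Longrightarrow> (\<And>R. cfg n R \<Longrightarrow> Q R = X) \<Longrightarrow> Q P = X"
  unfolding config_def using Q_shifts_cong by metis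

lemma config_gap_transitive:
  assumes "config n P" "\<And>R. cfg n R \<Longrightarrow> gap_transitive R"
  shows "gap_transitive P"
proof -
  obtain R where "cfg n R" "shifts R = shifts P" using assms by (auto simp: config_def)
  then show ?thesis using assms(2)[of R] Q_shifts_cong[of R P] by (simp add: gap_transitive_def)
qed

lemma shifts_window:
  assumes "T \<subseteq> {a..<a + L}" "t \<in> {a..<a + L}" "t \<in> shifts T"
  shows "t \<in> T"
proof -
  obtain p k where p: "p \<in> T" "t = p + of_int k * L" using assms(3) by (auto simp: shifts_def)
  have "p \<in> {a..<a + L}" using p assms(1) by blast
  then have "a \<le> p" "p < a + L" "a \<le> p + of_int k * L" "p + of_int k * L < a + L"
    using p assms(2) by auto
  then have "\<bar>of_int k * L\<bar> < L" by linarith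
  then have "\<bar>of_int k :: real\<bar> < 1" using L_pos by (simp add: abs_mult)
  then have "k = 0" by linarith
  then show ?thesis using p by simp
qed

lemma transitive_transfer_trivial:
  assumes "transitive n" "cfg n P" "Q P = {id}" "cfg n R"
  shows "Q R = {id}"
proof -
  obtain g where g: "g \<in> \<Gamma>" "g ` P = R" using assms unfolding transitive_def by blast
  have "q = id" if "q \<in> Q R" for q
  proof
    fix t
    have "inv g \<circ> q \<circ> g = id" using Q_conj_inv[OF g that] assms(3) by simp
    then have "g (inv g (q (g (inv g t)))) = g (inv g t)" by (metis comp_apply id_apply)
    then show "q t = id t" using g by simp
  qed
  then show ?thesis using id_Q by blast
qed

lemma transitive_step:
  assumes tr: "transitive n" and n: "3 \<le> n" and Qn: "\<And>P. cfg n P \<Longrightarrow> Q P \<noteq> {id}"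
  shows "transitive (Suc n)" "\<And>P. cfg (Suc n) P \<Longrightarrow> Q P \<noteq> {id}"
proof -
  have gt: "gap_transitive P" if "cfg n P" for P
    using moved_off_shifts[OF tr _ that Qn[OF that]] n by (intro gap_transitiveI) auto
  show tr': "transitive (Suc n)" using transitive_Suc[OF tr _ gt] n by simp
  fix P assume P: "cfg (Suc n) P"
  show "Q P \<noteq> {id}"
  proof
    assume "Q P = {id}"
    then have triv: "Q R = {id}" if "config (Suc n) R" for R
      using config_Q[OF that] transitive_transfer_trivial[OF tr' P] by blast
    define m where "m = n - 1"
    \<comment> \<open>\<open>S\<close> consists of \<open>d, 2 d, ..., n d\<close> without the last
      point \<open>n d = L\<close>, which leaves a double gap from \<open>l\<close> to
      \<open>r\<close> around it. As \<open>m \<ge> 2\<close>, the gap from \<open>d\<close> to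
      \<open>2 d\<close> is a different one; it contains \<open>x\<close> and
      \<open>x'\<close>.\<close>
    define s where "s i = real i * (L / real n)" for i :: nat
    define S where "S = s ` {1..m}"
    have nm: "n = Suc m" "2 \<le> m" using n by (auto simp: m_def)
    define d where "d = L / real n"
    have d: "0 < d" "d * real n = L" using L_pos n by (auto simp: d_def)
    have sd: "s i = real i * d" for i by (simp add: s_def d_def)
    have "inj_on s {1..m}" using d by (auto simp: inj_on_def sd)
    then have "card S = m" by (simp add: S_def card_image)
    have L: "L = real m * d + d" using d nm by (simp add: algebra_simps)
    have bS: "d \<le> t \<and> t \<le> real m * d" if "t \<in> S" for t
      using that d by (auto simp: S_def sd intro: mult_right_mono)
    have "S \<subseteq> {0<..<0 + L}"
      using bS d L by fastforce
    then have "cfg m S" using \<open>card S = m\<close> unfolding cfg_def by (metis S_def finite_atLeastAtMost finite_imageI)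
    then have cS: "config m S" unfolding config_def by blast
    define l where "l = real m * d"
    define r where "r = d + L"
    have m2: "2 * d \<le> real m * d" using nm d by (intro mult_right_mono) auto
    have lS: "l \<in> S" "d \<in> S" using nm by (auto simp: S_def l_def sd image_iff intro: bexI[of _ m] bexI[of _ 1])
    have SJ: "S \<subseteq> {d..l}" using bS by (auto simp: l_def)
    have rl: "r = l + 2 * d" using L by (simp add: r_def l_def)
    define x where "x = 4 / 3 * d" define x' where "x' = 5 / 3 * d"
    have notS: "t * d \<notin> S" if "t \<notin> \<nat>" for t
    proof
      assume "t * d \<in> S"
      then obtain i :: nat where "t * d = real i * d" by (auto simp: S_def sd)
      then have "t = real i" using d by simp
      then show False using that by simp
    qed
    have nNat: "t \<notin> \<nat>" if "1 < t" "t < 2" for t :: real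
      using that by (auto elim!: Nats_cases)
    have xS: "x \<notin> S" "x' \<notin> S" unfolding x_def x'_def by (intro notS nNat; simp)+
    have xb: "d < x" "x < x'" "x' < 2 * d" using d by (auto simp: x_def x'_def)
    have win: "t \<notin> shifts T" if "T \<subseteq> {d..<r}" "d \<le> t" "t < r" "t \<notin> T" for t T
      using shifts_window[of T d t] that by (auto simp: r_def)
    have c1: "config n (insert p S)" if "d \<le> p" "p < r" "p \<notin> S" for p
      using config_insert[OF cS win] nm SJ that rl d by (force simp: nm)
    have c2: "config (Suc n) (insert z (insert p S))"
      if "d \<le> p" "p < r" "p \<notin> S" "d \<le> z" "z < r" "z \<notin> insert p S" for p z
      using config_insert[OF c1 win] nm SJ that rl d by force
    have ld: "d < l" using m2 d by (simp add: l_def)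
    have move: "\<exists>k\<in>Q (insert p S). k z = z'"
      if p: "d \<le> p" "p < r" "p \<notin> S"
        and z: "\<And>t. min z z' \<le> t \<Longrightarrow> t \<le> max z z' \<Longrightarrow> d \<le> t \<and> t < r \<and> t \<notin> insert p S" for p z z'
    proof (rule gap_transitiveD)
      show "gap_transitive (insert p S)" using config_gap_transitive[OF c1[OF p]] gt by blast
      have "insert p S \<subseteq> {d..<r}" using SJ p rl d by auto
      then show "{min z z'..max z z'} \<inter> shifts (insert p S) = {}" using win z by auto
    qed
    interpret sharp_gap \<Gamma> L S l r x x'
    proof
      show "l < r" using rl d by simp
      show "g l = l" if "g \<in> fixers S" for g using that lS fixersD by blast
      show "g r = r" if "g \<in> fixers S" for g
        using that lS periodic[of g d] fixersD[of g S] by (auto simp: r_def)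
      show "\<exists>k\<in>Q (insert p S). k z = z'" if "l < p" "p < r" "l < z" "z < p" "l < z'" "z' < p" for p z z'
        using that SJ ld by (intro move) (auto simp: min_def max_def split: if_splits)
      show "\<exists>k\<in>Q (insert p S). k z = z'" if "l < p" "p < r" "p < z" "z < r" "p < z'" "z' < r" for p z z'
        using that SJ ld by (intro move) (auto simp: min_def max_def split: if_splits)
      show "Q (insert z (insert p S)) = {id}" if "l < p" "p < r" "l < z" "z < r" "z \<noteq> p" for p z
        using that SJ ld by (intro triv c2) auto
      have xl: "x' < l" unfolding l_def using xb m2 by linarith
      show "\<exists>k\<in>Q (insert u S). k z = z'" if "u \<in> {x, x'}" "l < z" "z < r" "l < z'" "z' < r" for u z z'
        using that SJ ld xS xb xl rl d by (intro move) (auto simp: min_def max_def split: if_splits)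
      show "Q (insert z (insert u S)) = {id}" if "u \<in> {x, x'}" "l < z" "z < r" for u z
        using that SJ ld xS xb xl rl d by (intro triv c2) auto
      show "Q (insert x' (insert x S)) = {id}"
        using SJ ld xS xb xl rl d by (intro triv c2) auto
    qed
    show False by (rule inconsistent)
  qed
qed

theorem highly_transitive:
  assumes "transitive 3" "\<And>P. cfg 3 P \<Longrightarrow> Q P \<noteq> {id}" "3 \<le> n"
  shows "transitive n"
proof -
  have "transitive n \<and> (\<forall>P. cfg n P \<longrightarrow> Q P \<noteq> {id})"
    using assms(3)
  proof (induction n rule: dec_induct)
    case (step k)
    then show ?case using transitive_step[of k] by blast
  qed (use assms in blast)
  then show ?thesis ..
qed

end

section \<open>Moebius transformations of the disc\<close>

text \<open>For \<open>norm u = 1\<close> and \<open>norm a < 1\<close> the normal form of a disc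
  automorphism: \<open>- a\<close> goes to \<open>0\<close>, and \<open>u\<close> is a rotation
  applied afterwards.\<close>

definition dm :: "complex \<Rightarrow> complex \<Rightarrow> complex \<Rightarrow> complex" where
  "dm u a z = u * (z + a) / (1 + cnj a * z)"

lemma dm_denominator:
  assumes "norm a < 1" "norm z \<le> 1"
  shows "1 + cnj a * z \<noteq> 0"
proof
  assume "1 + cnj a * z = 0"
  then have "norm (cnj a * z) = 1" by (metis add_eq_0_iff norm_minus_cancel norm_one)
  moreover have "norm (cnj a * z) < 1"
    using assms mult_left_le[of "norm z" "norm a"] by (simp add: norm_mult)
  ultimately show False by simp
qed

lemma dm_norm_identity:
  "(norm (1 + cnj a * z))\<^sup>2 - (norm (z + a))\<^sup>2 = (1 - (norm a)\<^sup>2) * (1 - (norm z)\<^sup>2)"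
  unfolding cmod_power2 by (simp add: power2_eq_square algebra_simps)

lemma dm_norm_less:
  assumes "norm u = 1" "norm a < 1" "norm z < 1"
  shows "norm (dm u a z) < 1"
proof -
  have "(1 - (norm a)\<^sup>2) * (1 - (norm z)\<^sup>2) > 0"
    using assms by (intro mult_pos_pos) (auto simp: power_less_one_iff abs_square_less_1)
  then have "(norm (z + a))\<^sup>2 < (norm (1 + cnj a * z))\<^sup>2"
    using dm_norm_identity[of a z] by simp
  then have "norm (z + a) < norm (1 + cnj a * z)" by (simp add: power2_less_imp_less)
  then show ?thesis using assms by (simp add: dm_def norm_divide norm_mult divide_less_eq)
qed

lemma dm_norm_one:
  assumes "norm u = 1" "norm a < 1" "norm z = 1"
  shows "norm (dm u a z) = 1"
proof -
  have "(norm (z + a))\<^sup>2 = (norm (1 + cnj a * z))\<^sup>2"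
    using dm_norm_identity[of a z] assms by simp
  then have "norm (z + a) = norm (1 + cnj a * z)" by (rule power2_eq_imp_eq) simp_all
  then show ?thesis
    using assms dm_denominator[of a z] by (simp add: dm_def norm_divide norm_mult)
qed

lemma dm_norm_le:
  "norm u = 1 \<Longrightarrow> norm a < 1 \<Longrightarrow> norm z \<le> 1 \<Longrightarrow> norm (dm u a z) \<le> 1"
  using dm_norm_less[of u a z] dm_norm_one[of u a z] by (cases "norm z = 1") auto

lemma unit_cnj: "norm u = 1 \<Longrightarrow> cnj u * u = 1"
  by (metis complex_norm_square mult.commute of_real_1 one_power2)

text \<open>The formula for \<open>w\<close> is exported because it gives the angle of the rotation
  hidden in a product of two transvections.\<close>

lemma dm_compose:
  assumes u: "norm u = 1" and a: "norm a < 1" and v: "norm v = 1" and b: "norm b < 1"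
  obtains w c where "norm w = 1" "norm c < 1" "\<And>z. norm z \<le> 1 \<Longrightarrow> dm u a (dm v b z) = dm w c z"
    "w = u * v * cnj (1 + cnj a * v * b) / (1 + cnj a * v * b)"
proof -
  define D where "D = 1 + cnj a * (v * b)"
  have vb: "norm (v * b) < 1" using v b by (simp add: norm_mult)
  have D: "D \<noteq> 0" unfolding D_def using a vb by (intro dm_denominator) auto
  have v1: "cnj v * v = 1" using v by (rule unit_cnj)
  have v0: "v \<noteq> 0" using v by auto
  define w where "w = u * v * cnj D / D"
  define c where "c = (v * b + a) / (v * cnj D)"
  have w: "norm w = 1" using u v D by (simp add: w_def norm_mult norm_divide)
  have "w * c = u * (v * b + a) / D"
    using D v0 by (simp add: w_def c_def)
  then have "w * c = dm u a (v * b)" by (simp add: dm_def D_def)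
  then have "norm c = norm (dm u a (v * b))" using w by (metis mult_1 norm_mult)
  then have c: "norm c < 1" using dm_norm_less[OF u a vb] by simp
  have cc: "cnj c = (cnj b + cnj a * v) / D"
  proof -
    have "cnj c = (cnj v * cnj b + cnj a) / (cnj v * D)" by (simp add: c_def)
    also have "\<dots> = (v * (cnj v * cnj b + cnj a)) / (v * (cnj v * D))"
      using v0 by simp
    also have "\<dots> = ((cnj v * v) * cnj b + cnj a * v) / ((cnj v * v) * D)"
      by (simp only: algebra_simps)
    finally show ?thesis by (simp add: v1)
  qed
  have vc: "v * cnj D = v + a * cnj b"
  proof -
    have "v * cnj D = v + (cnj v * v) * (a * cnj b)" by (simp add: D_def algebra_simps)
    then show ?thesis by (simp add: v1)
  qed
  have "dm u a (dm v b z) = dm w c z" if z: "norm z \<le> 1" for z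
  proof -
    have n1: "1 + cnj b * z \<noteq> 0" using b z by (rule dm_denominator)
    have n2: "1 + cnj a * dm v b z \<noteq> 0" using a dm_norm_le[OF v b z] by (rule dm_denominator)
    have n3: "1 + cnj c * z \<noteq> 0" using c z by (rule dm_denominator)
    have n4: "v * cnj D \<noteq> 0" using v0 D by simp
    have "dm v b z + a = (v * (z + b) + a * (1 + cnj b * z)) / (1 + cnj b * z)"
      using n1 by (simp add: dm_def field_simps)
    also have "v * (z + b) + a * (1 + cnj b * z) = v * cnj D * (z + c)"
      using n4 unfolding vc by (simp add: c_def vc field_simps)
    finally have p: "dm v b z + a = v * cnj D * (z + c) / (1 + cnj b * z)" .
    have "1 + cnj a * dm v b z = ((1 + cnj b * z) + cnj a * v * (z + b)) / (1 + cnj b * z)"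
      using n1 by (simp add: dm_def field_simps)
    also have "(1 + cnj b * z) + cnj a * v * (z + b) = D * (1 + cnj c * z)"
      using D by (simp add: cc D_def field_simps)
    finally have q: "1 + cnj a * dm v b z = D * (1 + cnj c * z) / (1 + cnj b * z)" .
    have "dm u a (dm v b z) = u * (v * cnj D * (z + c) / (1 + cnj b * z)) / (D * (1 + cnj c * z) / (1 + cnj b * z))"
      unfolding dm_def[of u a] p q ..
    also have "\<dots> = dm w c z"
      using n1 n3 D by (simp add: dm_def w_def)
    finally show ?thesis .
  qed
  then show ?thesis using that[OF w c] by (simp add: w_def D_def mult.assoc)
qed

lemma dm_1_0 [simp]: "dm 1 0 z = z"
  by (simp add: dm_def)

lemma dm_inverse:
  assumes u: "norm u = 1" and a: "norm a < 1" and z: "norm z \<le> 1"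
  shows "dm (cnj u) (- (u * a)) (dm u a z) = z"
proof -
  have u1: "cnj u * u = 1" using u by (rule unit_cnj)
  have n: "1 + cnj a * z \<noteq> 0" using a z by (rule dm_denominator)
  have k: "1 - cnj a * a \<noteq> 0"
    using a dm_denominator[of a "- a"] by simp
  have "dm u a z - u * a = u * z * (1 - cnj a * a) / (1 + cnj a * z)"
    using n by (simp add: dm_def field_simps)
  moreover have "1 - cnj u * cnj a * dm u a z = (1 - cnj a * a) / (1 + cnj a * z)"
  proof -
    have "1 - cnj u * cnj a * dm u a z = 1 - (cnj u * u) * cnj a * (z + a) / (1 + cnj a * z)"
      by (simp add: dm_def)
    also have "\<dots> = (1 - cnj a * a) / (1 + cnj a * z)"
      unfolding u1 using n by (simp add: field_simps)
    finally show ?thesis .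
  qed
  ultimately have "dm (cnj u) (- (u * a)) (dm u a z) =
      cnj u * (u * z * (1 - cnj a * a) / (1 + cnj a * z)) / ((1 - cnj a * a) / (1 + cnj a * z))"
    unfolding dm_def[of "cnj u"] by simp
  also have "\<dots> = (cnj u * u) * z" using n k by simp
  finally show ?thesis by (simp add: u1)
qed

lemma dm_inverse_params:
  assumes "norm u = 1" "norm a < 1"
  shows "norm (cnj u) = 1" "norm (- (u * a)) < 1" "cnj (cnj u) = u" "- (cnj u * - (u * a)) = a"
  using assms unit_cnj[of u] by (auto simp: norm_mult simp flip: mult.assoc)

lemma dm_inverse':
  assumes "norm u = 1" "norm a < 1" "norm z \<le> 1"
  shows "dm u a (dm (cnj u) (- (u * a)) z) = z"
  using dm_inverse[OF dm_inverse_params(1,2)[OF assms(1,2)] assms(3)]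
  unfolding dm_inverse_params(3,4)[OF assms(1,2)] .

text \<open>Serves to compare coefficients; the scale \<open>s\<close> places the three test points
  on the circle or inside the disc.\<close>

lemma quadratic_vanish:
  fixes \<alpha> \<beta> \<gamma> s :: complex
  assumes s: "s \<noteq> 0" and z: "\<And>z. z \<in> {s, - s, \<i> * s} \<Longrightarrow> \<alpha> * z\<^sup>2 + \<beta> * z + \<gamma> = 0"
  shows "\<alpha> = 0" "\<beta> = 0" "\<gamma> = 0"
proof -
  have 1: "\<alpha> * s\<^sup>2 + \<beta> * s + \<gamma> = 0" using z[of s] by simp
  have 2: "\<alpha> * s\<^sup>2 - \<beta> * s + \<gamma> = 0" using z[of "- s"] by simp
  have 3: "- \<alpha> * s\<^sup>2 + \<beta> * (\<i> * s) + \<gamma> = 0" using z[of "\<i> * s"] by (simp add: power_mult_distrib)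
  have "2 * (\<beta> * s) = 0" using 1 2 by algebra
  then show b: "\<beta> = 0" using s by simp
  have "2 * \<gamma> = 0" using 1 3 b by algebra
  then show c: "\<gamma> = 0" by simp
  show "\<alpha> = 0" using 1 b c s by simp
qed

lemma dm_unique:
  assumes u: "norm u = 1" and a: "norm a < 1" and v: "norm v = 1" and b: "norm b < 1"
    and eq: "\<And>z. norm z = 1 \<Longrightarrow> dm u a z = dm v b z"
  shows "u = v" "a = b"
proof -
  have e: "(u * cnj b - v * cnj a) * z\<^sup>2 + (u * (1 + a * cnj b) - v * (1 + b * cnj a)) * z + (u * a - v * b) = 0"
    if "z \<in> {1, - 1, \<i> * 1}" for z
  proof -
    have z: "norm z = 1" using that by auto
    have n: "1 + cnj a * z \<noteq> 0" "1 + cnj b * z \<noteq> 0" using dm_denominator[OF a, of z] dm_denominator[OF b, of z] z by simp_all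
    then have "u * (z + a) * (1 + cnj b * z) = v * (z + b) * (1 + cnj a * z)"
      using eq[OF z] by (simp add: dm_def frac_eq_eq)
    then show ?thesis by (simp add: power2_eq_square algebra_simps)
  qed
  have q: "u * cnj b = v * cnj a" "u * (1 + a * cnj b) = v * (1 + b * cnj a)" "u * a = v * b"
    using quadratic_vanish[OF one_neq_zero e] by auto
  have "u * (1 - a * cnj a) = v * (1 - a * cnj a)"
  proof -
    have "norm a = norm b" using q(3) u v by (metis mult_1 norm_mult)
    then have ab: "a * cnj a = b * cnj b" by (metis complex_norm_square)
    have "u + v * (b * cnj b) = v + u * (a * cnj a)"
      using q by algebra
    then show ?thesis using ab by (simp add: algebra_simps)
  qed
  moreover have "1 - a * cnj a \<noteq> 0"
    using a dm_denominator[of a "- a"] by (simp add: mult.commute)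
  ultimately show uv: "u = v" by simp
  then show "a = b" using q(3) u by auto
qed

lemma dm_image:
  assumes u: "norm u = 1" "norm a < 1"
  shows "dm u a ` ball 0 1 = ball 0 1" "dm u a ` circle = circle"
proof -
  have "dm u a ` S = S" if "dm u a ` S \<subseteq> S" "dm (cnj u) (- (u * a)) ` S \<subseteq> S" "S \<subseteq> cball 0 1" for S
  proof
    show "S \<subseteq> dm u a ` S"
    proof
      fix z assume "z \<in> S"
      then have "dm (cnj u) (- (u * a)) z \<in> S" "dm u a (dm (cnj u) (- (u * a)) z) = z"
        using that(2,3) by (auto intro!: dm_inverse'[OF u])
      then show "z \<in> dm u a ` S" by (metis imageI)
    qed
  qed fact
  from this[of "ball 0 1"] this[of circle]
  show "dm u a ` ball 0 1 = ball 0 1" "dm u a ` circle = circle"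
    using dm_norm_less dm_norm_one dm_inverse_params(1,2)[OF u] u by (auto simp: image_subset_iff)
qed

lemma moebius_eq_dm: "moebius u (u * a) (cnj a) 1 = dm u a"
  by (auto simp: moebius_def dm_def algebra_simps)

text \<open>An elementary Schwarz lemma. Along the direction \<open>s\<close> in which
  \<open>\<gamma> * s \<ge> 0\<close>, the points \<open>- t * s\<close> with the smallest
  denominator give \<open>norm \<alpha> + norm \<gamma> \<le> 1\<close>, and the preimages of
  \<open>t * sgn \<alpha> * s\<close> give
  \<open>1 + norm \<gamma> \<le> norm \<alpha>\<close>.\<close>

lemma linear_fractional_disc:
  fixes \<alpha> \<gamma> :: complex
  assumes \<alpha>: "\<alpha> \<noteq> 0" and into: "\<And>z. norm z < 1 \<Longrightarrow> 1 + \<gamma> * z \<noteq> 0 \<and> norm (\<alpha> * z / (1 + \<gamma> * z)) < 1"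
    and onto: "\<And>w. norm w < 1 \<Longrightarrow> \<exists>z. norm z < 1 \<and> \<alpha> * z / (1 + \<gamma> * z) = w"
  shows "\<gamma> = 0" "norm \<alpha> = 1"
proof -
  define s where "s = (if \<gamma> = 0 then 1 else cnj (sgn \<gamma>))"
  have s: "norm s = 1" "\<gamma> * s = of_real (norm \<gamma>)"
    by (auto simp: s_def norm_divide sgn_eq complex_norm_square[symmetric] power2_eq_square)
  have \<gamma>1: "norm \<gamma> \<le> 1"
  proof (rule ccontr)
    assume "\<not> norm \<gamma> \<le> 1"
    then show False using into[of "- 1 / \<gamma>"] by (cases "\<gamma> = 0") (auto simp: norm_divide)
  qed
  have "t * (norm \<alpha> + norm \<gamma>) \<le> 1" if t: "0 < t" "t < 1" for t
  proof -
    have e: "1 + \<gamma> * (- of_real t * s) = of_real (1 - t * norm \<gamma>)"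
      by (simp add: mult.left_commute[of \<gamma>] s(2))
    have "t * norm \<gamma> \<le> t" using t \<gamma>1 by (simp add: mult_left_le)
    then have p: "0 < 1 - t * norm \<gamma>" using t by linarith
    have "norm (\<alpha> * (- of_real t * s)) / norm (1 + \<gamma> * (- of_real t * s)) < 1"
      using into[of "- of_real t * s"] t s(1) by (simp add: norm_mult norm_divide)
    then have "t * norm \<alpha> / (1 - t * norm \<gamma>) < 1"
      unfolding e norm_of_real using p t s(1) by (simp add: norm_mult mult.commute)
    then show ?thesis using p by (simp add: pos_divide_less_eq distrib_left)
  qed
  then have i: "norm \<alpha> + norm \<gamma> \<le> 1" by (rule field_le_mult_one_interval)
  have "t * (1 + norm \<gamma>) \<le> norm \<alpha>" if t: "0 < t" "t < 1" for t
  proof -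
    define w where "w = of_real t * sgn \<alpha> * s"
    have w: "norm w = t" using t \<alpha> s by (simp add: w_def norm_mult norm_sgn)
    then obtain z where z: "norm z < 1" "\<alpha> * z / (1 + \<gamma> * z) = w" using onto t by metis
    then have "z * (\<alpha> - \<gamma> * w) = w" using into[of z] by (simp add: divide_eq_eq algebra_simps)
    then have "norm z * norm (\<alpha> - \<gamma> * w) = t" using w by (metis norm_mult)
    moreover have "norm z * norm (\<alpha> - \<gamma> * w) \<le> 1 * norm (\<alpha> - \<gamma> * w)"
      using z by (intro mult_right_mono) auto
    moreover have "\<alpha> - \<gamma> * w = of_real (norm \<alpha> - t * norm \<gamma>) * sgn \<alpha>"
    proof -
      have "\<gamma> * w = of_real (t * norm \<gamma>) * sgn \<alpha>"
        using arg_cong[OF s(2), of "\<lambda>x. of_real t * sgn \<alpha> * x"] by (simp add: w_def mult_ac)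
      moreover have "\<alpha> = of_real (norm \<alpha>) * sgn \<alpha>" using \<alpha> by (simp add: sgn_eq)
      ultimately show ?thesis by (metis left_diff_distrib of_real_diff)
    qed
    then have "norm (\<alpha> - \<gamma> * w) = \<bar>norm \<alpha> - t * norm \<gamma>\<bar>"
      using \<alpha> by (simp add: norm_mult norm_sgn del: of_real_diff of_real_mult)
    moreover have "t * norm \<gamma> \<le> t" using t \<gamma>1 by (simp add: mult_left_le)
    moreover have "0 < norm \<alpha>" using \<alpha> by simp
    ultimately show ?thesis unfolding distrib_left by linarith
  qed
  then have "1 + norm \<gamma> \<le> norm \<alpha>" by (rule field_le_mult_one_interval)
  then have "norm \<gamma> = 0 \<and> norm \<alpha> = 1" using i norm_ge_zero[of \<gamma>] by linarith
  then show "\<gamma> = 0" "norm \<alpha> = 1" by auto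
qed

text \<open>By \<open>x / 0 = 0\<close> the pole itself is mapped into the disc, so the
  contradiction comes from nearby points: there the numerator is bounded by
  \<open>norm (c * h)\<close>, hence it vanishes at the pole, against the determinant.\<close>

lemma moebius_no_pole:
  assumes det: "a * d - b * c \<noteq> 0" and sub: "moebius a b c d ` ball 0 1 \<subseteq> ball 0 1"
    and z: "norm z < 1"
  shows "c * z + d \<noteq> 0"
proof
  assume p: "c * z + d = 0"
  have num: "a * z + b \<noteq> 0"
  proof
    assume "a * z + b = 0"
    then have "d = - (c * z)" "b = - (a * z)" using p by (simp_all add: add_eq_0_iff)
    then show False using det by simp
  qed
  have c: "c \<noteq> 0" using p det by (auto simp: add_eq_0_iff)
  have "((\<lambda>h. norm (a * (z + h) + b)) \<longlongrightarrow> norm (a * (z + 0) + b)) (at 0)"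
    by (intro tendsto_intros)
  moreover have "((\<lambda>h. norm (c * h)) \<longlongrightarrow> norm (c * 0)) (at 0)" by (intro tendsto_intros)
  moreover have "((\<lambda>h. norm (z + h)) \<longlongrightarrow> norm (z + 0)) (at 0)" by (intro tendsto_intros)
  then have e: "\<forall>\<^sub>F h in at 0. norm (z + h) < 1" using z by (intro order_tendstoD) auto
  have "\<forall>\<^sub>F h in at 0. norm (a * (z + h) + b) \<le> norm (c * h)"
    using e eventually_neq_at_within[of 0 0 UNIV]
  proof eventually_elim
    case (elim h)
    then have "moebius a b c d (z + h) \<in> ball 0 1" using sub by (simp add: image_subset_iff)
    moreover have "c * (z + h) + d = c * h" using p by (simp add: algebra_simps add_eq_0_iff)
    ultimately have "norm (a * (z + h) + b) / norm (c * h) < 1" by (simp add: moebius_def norm_divide)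
    then show ?case using elim c by (simp add: divide_less_eq norm_mult)
  qed
  ultimately have "norm (a * (z + 0) + b) \<le> norm (c * 0)"
    by (intro tendsto_le[of "at (0::complex)"]) auto
  then show False using num by simp
qed

text \<open>Moving the image \<open>p\<close> of \<open>0\<close> back to \<open>0\<close> leaves a
  map \<open>z \<mapsto> \<alpha> * z / (1 + \<gamma> * z)\<close> of the disc onto itself, which
  must be a rotation.\<close>

lemma moebius_disc:
  assumes det: "a * d - b * c \<noteq> 0" and ball: "moebius a b c d ` ball 0 1 = ball 0 1"
  obtains u p where "norm u = 1" "norm p < 1" "\<And>z. norm z = 1 \<Longrightarrow> moebius a b c d z = dm u p z"
proof -
  let ?M = "moebius a b c d"
  have pole: "c * z + d \<noteq> 0" if "norm z < 1" for z using moebius_no_pole[OF det _ that] ball by simp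
  have Mn: "norm (?M z) < 1" if "norm z < 1" for z using ball that by (metis image_eqI mem_ball_0)
  have d: "d \<noteq> 0" using pole[of 0] by simp
  define p where "p = b / d"
  have p: "norm p < 1" using Mn[of 0] by (simp add: p_def moebius_def)
  have p1: "1 - cnj p * p \<noteq> 0" using p dm_denominator[of p "- p"] by simp
  have b: "b = p * d" using d by (simp add: p_def)
  define \<alpha> where "\<alpha> = (a * d - b * c) / (d * d * (1 - cnj p * p))"
  define \<gamma> where "\<gamma> = (c - cnj p * a) / (d * (1 - cnj p * p))"
  have N: "1 + \<gamma> * z \<noteq> 0 \<and> dm 1 (- p) (?M z) = \<alpha> * z / (1 + \<gamma> * z)" if z: "norm z < 1" for z
  proof -
    have n1: "c * z + d \<noteq> 0" using pole z by blast
    have n2: "1 - cnj p * ?M z \<noteq> 0"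
      using p Mn[OF z] dm_denominator[of "- p" "?M z"] by simp
    have A: "?M z - p = (\<alpha> * z) * (d * (1 - cnj p * p)) / (c * z + d)"
    proof -
      have "?M z - p = ((a * z + b) - p * (c * z + d)) / (c * z + d)"
        using n1 by (simp add: moebius_def diff_divide_distrib)
      also have "(a * z + b) - p * (c * z + d) = (\<alpha> * z) * (d * (1 - cnj p * p))"
      proof -
        have "(\<alpha> * z) * (d * (1 - cnj p * p)) = (a * d - b * c) / d * z"
          using d p1 by (simp add: \<alpha>_def)
        also have "\<dots> = (a - p * c) * z" using d by (simp add: b field_simps)
        finally show ?thesis by (simp add: b algebra_simps)
      qed
      finally show ?thesis .
    qed
    have B: "1 - cnj p * ?M z = (1 + \<gamma> * z) * (d * (1 - cnj p * p)) / (c * z + d)"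
    proof -
      have "1 - cnj p * ?M z = ((c * z + d) - cnj p * (a * z + b)) / (c * z + d)"
        using n1 by (simp add: moebius_def diff_divide_distrib)
      also have "(c * z + d) - cnj p * (a * z + b) = (1 + \<gamma> * z) * (d * (1 - cnj p * p))"
      proof -
        have "(1 + \<gamma> * z) * (d * (1 - cnj p * p)) = d * (1 - cnj p * p) + (c - cnj p * a) * z"
          using d p1 by (simp add: \<gamma>_def distrib_right)
        then show ?thesis by (simp add: b algebra_simps)
      qed
      finally show ?thesis .
    qed
    have n3: "1 + \<gamma> * z \<noteq> 0" using n2 B by auto
    have "dm 1 (- p) (?M z) = (?M z - p) / (1 - cnj p * ?M z)" by (simp add: dm_def)
    also have "\<dots> = \<alpha> * z / (1 + \<gamma> * z)" unfolding A B using n1 d p1 by simp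
    finally show ?thesis using n3 by simp
  qed
  have "\<gamma> = 0 \<and> norm \<alpha> = 1"
  proof -
    have "\<alpha> \<noteq> 0" using det d p1 by (simp add: \<alpha>_def)
    moreover have "1 + \<gamma> * z \<noteq> 0 \<and> norm (\<alpha> * z / (1 + \<gamma> * z)) < 1" if "norm z < 1" for z
      using N[OF that] dm_norm_less[of 1 "- p" "?M z"] p Mn[OF that] by simp
    moreover have "\<exists>z. norm z < 1 \<and> \<alpha> * z / (1 + \<gamma> * z) = w" if w: "norm w < 1" for w
    proof -
      have "dm 1 p w \<in> ?M ` ball 0 1" using dm_norm_less[of 1 p w] p w ball by simp
      then obtain z where z: "norm z < 1" "?M z = dm 1 p w" by auto
      then have "dm 1 (- p) (?M z) = w" using dm_inverse[of 1 p w] p w by simp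
      then show ?thesis using N[OF z(1)] z by metis
    qed
    ultimately show ?thesis using linear_fractional_disc by blast
  qed
  then have \<gamma>: "\<gamma> = 0" and \<alpha>: "norm \<alpha> = 1" by auto
  obtain w q where wq: "norm w = 1" "norm q < 1"
      "\<And>z. norm z \<le> 1 \<Longrightarrow> dm 1 p (dm \<alpha> 0 z) = dm w q z"
    using dm_compose[OF norm_one p \<alpha>, of 0] by (metis norm_zero zero_less_one)
  have Meq: "?M z = dm w q z" if z: "norm z < 1" for z
  proof -
    have "dm 1 p (dm 1 (- p) (?M z)) = ?M z"
      using dm_inverse'[of 1 p "?M z"] p Mn[OF z] by simp
    moreover have "dm 1 (- p) (?M z) = dm \<alpha> 0 z" using N[OF z] \<gamma> by (simp add: dm_def)
    ultimately show ?thesis using wq(3)[of z] z by simp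
  qed
  \<comment> \<open>The two maps are known to agree inside the disc; comparing coefficients at three
    inner points carries this over to the circle.\<close>
  have e: "(a * cnj q - w * c) * z\<^sup>2 + (a + b * cnj q - w * (d + q * c)) * z + (b - w * q * d) = 0"
    if "z \<in> {1 / 2, - (1 / 2), \<i> * (1 / 2)}" for z
  proof -
    have z: "norm z < 1"
      using that by (elim insertE emptyE; hypsubst; simp add: norm_mult norm_divide)
    have "1 + cnj q * z \<noteq> 0" using wq(2) z by (intro dm_denominator) auto
    then have "(a * z + b) * (1 + cnj q * z) = w * (z + q) * (c * z + d)"
      using Meq[OF z] pole[OF z] by (simp add: dm_def moebius_def frac_eq_eq)
    then show ?thesis by (simp add: power2_eq_square algebra_simps)
  qed
  have h0: "(1 / 2 :: complex) \<noteq> 0" by simp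
  have coeffs: "a * cnj q = w * c" "a + b * cnj q = w * (d + q * c)" "b = w * q * d"
    using quadratic_vanish[OF h0 e] by auto
  show ?thesis
  proof (rule that[OF wq(1,2)])
    fix z :: complex assume z: "norm z = 1"
    have n: "1 + cnj q * z \<noteq> 0" using wq(2) z by (intro dm_denominator) auto
    have e: "(a * z + b) * (1 + cnj q * z) = w * (z + q) * (c * z + d)"
      using coeffs by algebra
    have "c * z + d \<noteq> 0"
    proof
      assume 0: "c * z + d = 0"
      then have "a * z + b = 0" using e n by simp
      then have "d = - (c * z)" "b = - (a * z)" using 0 by (simp_all add: add_eq_0_iff)
      then show False using det by simp
    qed
    then show "?M z = dm w q z" using e n by (simp add: dm_def moebius_def frac_eq_eq)
  qed
qed

lemma PSL2R_eq: "PSL2R = {restrict (dm u a) circle | u a. norm u = 1 \<and> norm a < 1}"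
proof
  show "PSL2R \<subseteq> {restrict (dm u a) circle | u a. norm u = 1 \<and> norm a < 1}"
  proof
    fix f assume "f \<in> PSL2R"
    then obtain a b c d where f: "f = restrict (moebius a b c d) circle" "a * d - b * c \<noteq> 0"
      "moebius a b c d ` ball 0 1 = ball 0 1" by (auto simp: PSL2R_def)
    obtain u p where "norm u = 1" "norm p < 1" "\<And>z. norm z = 1 \<Longrightarrow> moebius a b c d z = dm u p z"
      using moebius_disc[OF f(2,3)] by blast
    moreover from this have "f = restrict (dm u p) circle" using f(1) by (auto simp: restrict_def)
    ultimately show "f \<in> {restrict (dm u a) circle | u a. norm u = 1 \<and> norm a < 1}" by blast
  qed
  show "{restrict (dm u a) circle | u a. norm u = 1 \<and> norm a < 1} \<subseteq> PSL2R"
  proof clarify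
    fix u a :: complex assume u: "norm u = 1" "norm a < 1"
    have "u * 1 - u * a * cnj a \<noteq> 0"
    proof -
      have "1 - a * cnj a \<noteq> 0" using u dm_denominator[of a "- a"] by (simp add: mult.commute)
      moreover have "u \<noteq> 0" using u by auto
      ultimately have "u * (1 - a * cnj a) \<noteq> 0" by simp
      then show ?thesis by (simp add: algebra_simps)
    qed
    then show "restrict (dm u a) circle \<in> PSL2R"
      using dm_image(1)[OF u] unfolding PSL2R_def moebius_eq_dm[symmetric] by blast
  qed
qed

section \<open>Lifts of circle homeomorphisms\<close>

lemma circle_iff_cis: "z \<in> circle \<longleftrightarrow> (\<exists>t. z = cis t)"
proof
  assume "z \<in> circle"
  then have "norm z = 1" by simp
  then have "cis (Arg z) = z" by (subst cis_Arg) (auto simp: sgn_eq)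
  then show "\<exists>t. z = cis t" by metis
qed auto

lemma cis_in_circle [simp]: "cis t \<in> circle"
  by simp

lemma cis_eq_iff: "cis s = cis t \<longleftrightarrow> (\<exists>k::int. s = t + of_int k * (2 * pi))"
proof
  assume "cis s = cis t"
  then have "sin s = sin t \<and> cos s = cos t" by (simp add: complex_eq_iff)
  then show "\<exists>k::int. s = t + of_int k * (2 * pi)"
    using sin_cos_eq_iff[of s t] by (metis mult.commute mult.assoc)
next
  assume "\<exists>k::int. s = t + of_int k * (2 * pi)"
  then obtain k :: int where k: "s = t + of_int k * (2 * pi)" by blast
  have "cis (of_int k * (2 * pi)) = 1" using cis_multiple_2pi[of "of_int k"] by (simp add: mult.commute)
  then show "cis s = cis t" unfolding k by (simp flip: cis_mult)
qed

lemma homeo_inj: "f \<in> Homeo_set \<Longrightarrow> inj_on f circle"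
  using Homeo_set_subset_Bij by (auto simp: Bij_def bij_betw_def)

text \<open>Over one period \<open>F\<close> climbs by a positive multiple of \<open>2 * pi\<close>.
  It passes the height \<open>F t + 2 * pi\<close> on the way, and injectivity of \<open>f\<close>
  allows this only at the end of the period.\<close>

lemma lift_periodic:
  assumes inj: "inj_on f circle" and F: "continuous_on UNIV F" "strict_mono F" "\<And>t. f (cis t) = cis (F t)"
  shows "F (t + 2 * pi) = F t + 2 * pi"
proof -
  have "cis (F (t + 2 * pi)) = cis (F t)"
    using F(3)[of t] F(3)[of "t + 2 * pi"] by (simp flip: cis_mult)
  then obtain n :: int where n: "F (t + 2 * pi) = F t + of_int n * (2 * pi)"
    using cis_eq_iff by blast
  have "F t < F (t + 2 * pi)" using F(2) by (simp add: strict_mono_less)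
  then have "0 < n" using n by (simp add: zero_less_mult_iff)
  then have ge: "1 * (2 * pi) \<le> of_int n * (2 * pi)" by (intro mult_right_mono) auto
  then obtain s where s: "t \<le> s" "s \<le> t + 2 * pi" "F s = F t + 2 * pi"
    using IVT'[of F t "F t + 2 * pi" "t + 2 * pi"] n continuous_on_subset[OF F(1)] by fastforce
  have "cis (F s) = cis (F t)" using s cis_eq_iff[of "F s" "F t"] by (metis mult_1 of_int_1)
  then have "f (cis s) = f (cis t)" using F(3) by simp
  then have "cis s = cis t" using inj by (auto simp: inj_on_def)
  then obtain k :: int where k: "s = t + of_int k * (2 * pi)" using cis_eq_iff by blast
  have "t < s" using s F(2) by (metis add_cancel_right_right less_eq_real_def mult_eq_0_iff pi_neq_zero zero_neq_numeral)
  then have "0 < k" using k by (simp add: zero_less_mult_iff)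
  then have "1 * (2 * pi) \<le> of_int k * (2 * pi)" by (intro mult_right_mono) auto
  then have "s = t + 2 * pi" using s k by simp
  then show ?thesis using s by simp
qed

lemma lift_surj:
  assumes F: "continuous_on UNIV F" "\<And>t. F (t + 2 * pi) = F t + 2 * pi"
  shows "surj F"
proof -
  have "\<exists>t. y = F t" for y
  proof -
    obtain n where "\<bar>y - F 0\<bar> / (2 * pi) \<le> real n" using real_arch_simple by blast
    then have "\<bar>y - F 0\<bar> \<le> real n * (2 * pi)" by (simp add: divide_le_eq)
    then have "F (0 + of_int (- int n) * (2 * pi)) \<le> y" "y \<le> F (0 + of_int (int n) * (2 * pi))"
      unfolding shift_of_int[where F = F, OF F(2)] by simp_all
    moreover have "0 + of_int (- int n) * (2 * pi) \<le> 0 + of_int (int n) * (2 * pi)" by simp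
    ultimately show ?thesis using IVT' continuous_on_subset[OF F(1) subset_UNIV] by metis
  qed
  then show ?thesis by (auto simp: surj_def)
qed

text \<open>\<open>F\<close> is continuous and injective, hence monotone; the direction is read off
  at a point \<open>r\<close> beyond \<open>t\<close> that is a whole number of periods after
  \<open>s\<close>.\<close>

lemma lift_strict_mono:
  assumes inj: "inj_on f circle" and F: "continuous_on UNIV F" "\<And>t. F (t + 2 * pi) = F t + 2 * pi"
    "\<And>t. f (cis t) = cis (F t)"
  shows "strict_mono F"
proof (rule strict_monoI)
  have injF: "inj_on F A" for A
  proof (rule inj_onI)
    fix s t assume e: "F s = F t"
    then have "f (cis s) = f (cis t)" using F(3) by simp
    then have "cis s = cis t" using inj by (auto simp: inj_on_def)
    then obtain k :: int where k: "s = t + of_int k * (2 * pi)" using cis_eq_iff by blast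
    then show "s = t" using e shift_of_int[where F = F, OF F(2), of t k] by simp
  qed
  fix s t :: real assume st: "s < t"
  obtain n where "(t - s) / (2 * pi) < real n" using reals_Archimedean2 by blast
  then have n: "t - s < real n * (2 * pi)" by (simp add: divide_less_eq)
  define r where "r = s + real n * (2 * pi)"
  have "0 < real n * (2 * pi)" using n st by linarith
  then have "t < r" "F s < F r" using n st shift_of_int[where F = F, OF F(2), of s "int n"] by (auto simp: r_def)
  moreover have "continuous_on {s..r} F" using F(1) continuous_on_subset by blast
  ultimately show "F s < F t"
    using continuous_inj_imp_mono[OF st \<open>t < r\<close> _ injF] by fastforce
qed

lemma Homeo_setI:
  assumes f: "f \<in> extensional circle" "continuous_on circle f" "inj_on f circle" "f ` circle = circle"
    and F: "continuous_on UNIV F" "\<And>t. F (t + 2 * pi) = F t + 2 * pi" "\<And>t. f (cis t) = cis (F t)"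
  shows "f \<in> Homeo_set"
proof -
  obtain g where "homeomorphism circle circle f g"
    using homeomorphism_compact[OF compact_sphere f(2,4,3)] by blast
  then show ?thesis
    using f(1) F(1,3) lift_strict_mono[OF f(3) F] unfolding Homeo_set_def orientation_preserving_def by blast
qed

text \<open>With \<open>w = 1 + cnj a * cis t\<close> one has
  \<open>cis t + a = cis t * cnj w\<close>, and \<open>cnj w / w\<close> has the argument
  \<open>- 2 * Arg w\<close>. As \<open>w\<close> stays in the right half plane, the formula is
  continuous in the parameters too.\<close>

definition dm_lift :: "real \<Rightarrow> complex \<Rightarrow> real \<Rightarrow> real" where
  "dm_lift \<theta> a t = t + \<theta> - 2 * Arg (1 + cnj a * cis t)"

lemma one_plus_Re_pos:
  assumes "norm a < 1"
  shows "0 < Re (1 + cnj a * cis t)"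
  using abs_Re_le_cmod[of "cnj a * cis t"] assms by (simp add: norm_mult)

lemma dm_lift: 
  assumes a: "norm a < 1"
  shows "dm (cis \<theta>) a (cis t) = cis (dm_lift \<theta> a t)"
proof -
  define w where "w = 1 + cnj a * cis t"
  have "0 < Re w" unfolding w_def using a by (rule one_plus_Re_pos)
  then have w: "w \<noteq> 0" by auto
  have "cis t + a = cis t * cnj w" by (simp add: w_def algebra_simps cis_cnj cis_mult)
  then have "dm (cis \<theta>) a (cis t) = cis \<theta> * (cis t * cnj w) / w"
    by (simp only: dm_def w_def)
  then have "dm (cis \<theta>) a (cis t) = cis \<theta> * cis t * (cnj w / w)" by simp
  moreover have "cnj w / w = cis (- (2 * Arg w))"
  proof -
    have "cis (- (2 * Arg w)) = cnj (cis (Arg w)) / cis (Arg w)"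
      by (simp add: cis_cnj cis_divide)
    then show ?thesis using w by (simp add: cis_Arg sgn_eq)
  qed
  moreover have "dm_lift \<theta> a t = \<theta> + t + (- (2 * Arg w))" by (simp add: dm_lift_def w_def)
  ultimately show ?thesis by (simp only: cis_mult)
qed

lemma continuous_on_dm_lift:
  assumes "continuous_on A \<theta>" "continuous_on A a" "continuous_on A t" "\<And>x. x \<in> A \<Longrightarrow> norm (a x) < 1"
  shows "continuous_on A (\<lambda>x. dm_lift (\<theta> x) (a x) (t x))"
proof -
  have "continuous_on A (\<lambda>x. Arg (1 + cnj (a x) * cis (t x)))"
  proof (rule continuous_on_Arg')
    show "continuous_on A (\<lambda>x. 1 + cnj (a x) * cis (t x))"
      using assms unfolding cis_conv_exp by (intro continuous_intros)
    show "1 + cnj (a x) * cis (t x) \<notin> \<real>\<^sub>\<le>\<^sub>0" if "x \<in> A" for x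
      using one_plus_Re_pos[OF assms(4)[OF that], of "t x"] by (auto simp: complex_nonpos_Reals_iff)
  qed
  from continuous_on_diff[OF continuous_on_add[OF assms(3,1)] continuous_on_mult[OF continuous_on_const this]]
  show ?thesis unfolding dm_lift_def .
qed

lemma dm_lift_periodic: "dm_lift \<theta> a (t + 2 * pi) = dm_lift \<theta> a t + 2 * pi"
  by (simp add: dm_lift_def flip: cis_mult)

lemma norm_one_cis: "norm (u::complex) = 1 \<Longrightarrow> \<exists>\<theta>. u = cis \<theta>"
  using circle_iff_cis[of u] by simp

lemma dm_Homeo:
  assumes u: "norm u = 1" and a: "norm a < 1"
  shows "restrict (dm u a) circle \<in> Homeo_set"
proof -
  obtain \<theta> where \<theta>: "u = cis \<theta>" using norm_one_cis[OF u] by blast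
  show ?thesis
  proof (rule Homeo_setI)
    have "continuous_on circle (dm u a)"
      unfolding dm_def using dm_denominator[OF a] by (intro continuous_intros) auto
    then show "continuous_on circle (restrict (dm u a) circle)" by (rule continuous_on_eq) simp
    have "inj_on (dm u a) circle"
      using dm_inverse[OF u a] by (intro inj_on_inverseI[of _ "dm (cnj u) (- (u * a))"]) auto
    then show "inj_on (restrict (dm u a) circle) circle" by (simp add: inj_on_def)
    show "restrict (dm u a) circle ` circle = circle" using dm_image(2)[OF u a] by simp
    show "continuous_on UNIV (dm_lift \<theta> a)"
      using a by (intro continuous_on_dm_lift continuous_on_const continuous_on_id) auto
    show "restrict (dm u a) circle (cis t) = cis (dm_lift \<theta> a t)" for t
      using dm_lift[OF a] by (simp add: \<theta>)
  qed (simp_all add: dm_lift_periodic)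
qed

lemma PSL2R_Homeo: "PSL2R \<subseteq> Homeo_set"
  unfolding PSL2R_eq using dm_Homeo by blast

section \<open>\<open>PSL2R\<close> as a closed proper subgroup\<close>

lemma carrier_Homeo [simp]: "carrier Homeo = Homeo_set"
  by (simp add: Homeo_def)

lemma mult_Homeo:
  "f \<in> Homeo_set \<Longrightarrow> g \<in> Homeo_set \<Longrightarrow> f \<otimes>\<^bsub>Homeo\<^esub> g = compose circle f g"
  using Homeo_set_subset_Bij by (auto simp: Homeo_def BijGroup_def)

lemma one_Homeo: "\<one>\<^bsub>Homeo\<^esub> = (\<lambda>x\<in>circle. x)"
  by (simp add: Homeo_def BijGroup_def)

lemma inv_Homeo: "f \<in> Homeo_set \<Longrightarrow> m_inv Homeo f = (\<lambda>x\<in>circle. inv_into circle f x)"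
  using group.m_inv_consistent[OF group_BijGroup subgroup_Homeo_set, of f]
    Homeo_set_subset_Bij inv_BijGroup[of f circle] by (auto simp: Homeo_def)

lemma compose_restrict:
  assumes "\<And>z. z \<in> circle \<Longrightarrow> g z \<in> circle"
  shows "compose circle (restrict f circle) (restrict g circle) = restrict (f \<circ> g) circle"
  using assms by (auto simp: compose_def restrict_def)

lemma subgroup_PSL2R: "subgroup PSL2R Homeo"
proof (rule group.subgroupI[OF group_Homeo])
  show "PSL2R \<subseteq> carrier Homeo" using PSL2R_Homeo by simp
  have "norm (1::complex) = 1" "norm (0::complex) < 1" by auto
  then have "restrict (dm 1 0) circle \<in> PSL2R" unfolding PSL2R_eq by blast
  then show "PSL2R \<noteq> {}" by blast
next
  fix f assume "f \<in> PSL2R"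
  then obtain u a where f: "f = restrict (dm u a) circle" "norm u = 1" "norm a < 1"
    by (auto simp: PSL2R_eq)
  note par = dm_inverse_params(1,2)[OF f(2,3)]
  have fH: "f \<in> Homeo_set" using f dm_Homeo by blast
  have "m_inv Homeo f = restrict (dm (cnj u) (- (u * a))) circle"
  proof (rule group.inv_equality[OF group_Homeo])
    have "restrict (dm (cnj u) (- (u * a))) circle \<otimes>\<^bsub>Homeo\<^esub> f =
        compose circle (restrict (dm (cnj u) (- (u * a))) circle) f"
      using dm_Homeo[OF par] fH by (rule mult_Homeo)
    also have "\<dots> = (\<lambda>x\<in>circle. x)"
      unfolding f(1) using dm_norm_one[OF f(2,3)] dm_inverse[OF f(2,3)]
      by (subst compose_restrict) (auto simp: restrict_def)
    finally show "restrict (dm (cnj u) (- (u * a))) circle \<otimes>\<^bsub>Homeo\<^esub> f = \<one>\<^bsub>Homeo\<^esub>"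
      by (simp only: one_Homeo)
  qed (use fH dm_Homeo[OF par] in auto)
  then show "m_inv Homeo f \<in> PSL2R" using par unfolding PSL2R_eq by blast
next
  fix f g assume "f \<in> PSL2R" "g \<in> PSL2R"
  then obtain u a v b where f: "f = restrict (dm u a) circle" "norm u = 1" "norm a < 1"
    and g: "g = restrict (dm v b) circle" "norm v = 1" "norm b < 1"
    unfolding PSL2R_eq by blast
  obtain w c where w: "norm w = 1" "norm c < 1" "\<And>z. norm z \<le> 1 \<Longrightarrow> dm u a (dm v b z) = dm w c z"
    using dm_compose[OF f(2,3) g(2,3)] by metis
  have "f \<otimes>\<^bsub>Homeo\<^esub> g = compose circle f g" using f g dm_Homeo by (intro mult_Homeo) auto
  also have "\<dots> = restrict (dm w c) circle"
    unfolding f(1) g(1) using w(3) dm_norm_one[OF g(2,3)]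
    by (subst compose_restrict) (auto simp: restrict_def)
  finally show "f \<otimes>\<^bsub>Homeo\<^esub> g \<in> PSL2R" using w unfolding PSL2R_eq by blast
qed

lemma Homeo_dist_ge:
  assumes "f \<in> Homeo_set" "g \<in> Homeo_set" "z \<in> circle"
  shows "dist (f z) (g z) \<le> Homeo_dist f g"
  using cSUP_upper[OF assms(3) Homeo_dist_integrand_bdd[OF assms(1,2)]] assms
  by (simp add: Homeo_dist_def)

lemma Homeo_dist_le:
  assumes "f \<in> Homeo_set" "g \<in> Homeo_set"
    and "\<And>z. z \<in> circle \<Longrightarrow> dist (f z) (g z) \<le> e"
    and "\<And>z. z \<in> circle \<Longrightarrow> dist (inv_into circle f z) (inv_into circle g z) \<le> e"
  shows "Homeo_dist f g \<le> e"
proof -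
  have "1 \<in> circle" by simp
  then show ?thesis using assms unfolding Homeo_dist_def by (auto intro!: cSUP_least simp del: mem_sphere)
qed

lemma closedin_Homeo:
  "closedin Homeo_topology A \<longleftrightarrow> A \<subseteq> Homeo_set \<and>
     (\<forall>f\<in>Homeo_set. (\<forall>e>0. \<exists>g\<in>A. Homeo_dist f g < e) \<longrightarrow> f \<in> A)"
proof -
  interpret M: Metric_space Homeo_set Homeo_dist by (rule Metric_space_Homeo)
  have "(\<exists>r>0. disjnt A (M.mball f r)) \<longleftrightarrow> \<not> (\<forall>e>0. \<exists>g\<in>A. Homeo_dist f g < e)"
    if "A \<subseteq> Homeo_set" "f \<in> Homeo_set" for f
  proof -
    have "disjnt A (M.mball f r) \<longleftrightarrow> (\<forall>g\<in>A. \<not> Homeo_dist f g < r)" for r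
      using that unfolding disjnt_iff M.in_mball by blast
    then show ?thesis by simp
  qed
  then show ?thesis
    unfolding Homeo_topology_def M.closedin_metric by blast
qed

text \<open>A subsequence of the parameters converges in
  \<open>sphere 0 1 \<times> cball 0 1\<close>. A limit parameter \<open>b\<close> on the unit
  circle would make \<open>f\<close> constant away from \<open>- b\<close>, against
  injectivity.\<close>

lemma closedin_PSL2R: "closedin Homeo_topology PSL2R"
  unfolding closedin_Homeo
proof (intro conjI PSL2R_Homeo ballI impI)
  fix f assume f: "f \<in> Homeo_set" and lim: "\<forall>e>0. \<exists>g\<in>PSL2R. Homeo_dist f g < e"
  have "\<exists>u a. norm u = 1 \<and> norm a < 1 \<and> Homeo_dist f (restrict (dm u a) circle) < 1 / real (Suc n)" for n
    using lim[rule_format, of "1 / real (Suc n)"] unfolding PSL2R_eq by auto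
  then obtain u a where ua: "\<And>n. norm (u n) = 1" "\<And>n. norm (a n) < 1"
    "\<And>n. Homeo_dist f (restrict (dm (u n) (a n)) circle) < 1 / real (Suc n)" by metis
  have conv: "(\<lambda>n. dm (u n) (a n) z) \<longlonglongrightarrow> f z" if z: "norm z = 1" for z
  proof (rule metric_tendsto_imp_tendsto[of "\<lambda>n. 1 / real (Suc n)" 0])
    show "(\<lambda>n. 1 / real (Suc n)) \<longlonglongrightarrow> 0" using LIMSEQ_inverse_real_of_nat by (simp add: inverse_eq_divide)
    show "\<forall>\<^sub>F n in sequentially. dist (dm (u n) (a n) z) (f z) \<le> dist (1 / real (Suc n)) 0"
    proof (rule always_eventually, rule allI)
      fix n
      have "dist (f z) (restrict (dm (u n) (a n)) circle z) \<le> Homeo_dist f (restrict (dm (u n) (a n)) circle)"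
        using f ua z by (intro Homeo_dist_ge dm_Homeo) auto
      then have "dist (f z) (dm (u n) (a n) z) \<le> 1 / real (Suc n)"
        using ua(3)[of n] z by simp
      then show "dist (dm (u n) (a n) z) (f z) \<le> dist (1 / real (Suc n)) 0"
        by (simp add: dist_commute)
    qed
  qed
  have "compact (sphere (0::complex) 1 \<times> cball (0::complex) 1)" by (intro compact_Times) auto
  then obtain l r where l: "l \<in> sphere (0::complex) 1 \<times> cball (0::complex) 1" "strict_mono (r :: nat \<Rightarrow> nat)"
    "((\<lambda>n. (u n, a n)) \<circ> r) \<longlonglongrightarrow> l"
    unfolding compact_def using ua(1,2) by (metis (no_types, lifting) SigmaI less_imp_le mem_cball_0 mem_sphere_0)
  obtain v b where vb: "l = (v, b)" "norm v = 1" "norm b \<le> 1" using l(1) by (cases l) auto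
  have v: "(\<lambda>n. u (r n)) \<longlonglongrightarrow> v" and b: "(\<lambda>n. a (r n)) \<longlonglongrightarrow> b"
    using tendsto_fst[OF l(3)] tendsto_snd[OF l(3)] by (simp_all add: o_def vb)
  have fz: "f z = dm v b z" if z: "norm z = 1" "1 + cnj b * z \<noteq> 0" for z
  proof (rule LIMSEQ_unique)
    show "(\<lambda>n. dm (u (r n)) (a (r n)) z) \<longlonglongrightarrow> f z"
      using LIMSEQ_subseq_LIMSEQ[OF conv[OF z(1)] l(2)] by (simp add: o_def)
    show "(\<lambda>n. dm (u (r n)) (a (r n)) z) \<longlonglongrightarrow> dm v b z"
      unfolding dm_def using v b z(2) by (intro tendsto_intros)
  qed
  have "norm b < 1"
  proof (rule ccontr)
    assume "\<not> norm b < 1"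
    then have nb: "norm b = 1" using vb by simp
    then have bb: "cnj b * b = 1" by (rule unit_cnj)
    \<comment> \<open>\<open>b\<close> and \<open>\<i> * b\<close> are two points of the circle
      other than the pole \<open>- b\<close>, and the degenerate limit has the value
      \<open>v * b\<close> at both.\<close>
    then have "1 + cnj b * (\<i> * b) = 1 + \<i>" by (simp add: mult.left_commute)
    then have n: "1 + cnj b * b \<noteq> 0" "1 + cnj b * (\<i> * b) \<noteq> 0" using bb by (auto simp: complex_eq_iff)
    have "dm v b z = v * b" if "1 + cnj b * z \<noteq> 0" for z
    proof -
      have "z + b = b * (1 + cnj b * z)"
        using bb by (simp add: distrib_left flip: mult.assoc) (simp add: mult.commute)
      then show ?thesis using that by (simp add: dm_def)
    qed
    then have "f b = f (\<i> * b)"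
      using fz[OF nb n(1)] fz[of "\<i> * b", OF _ n(2)] n nb by (simp add: norm_mult)
    moreover have "b \<noteq> \<i> * b"
    proof
      assume "b = \<i> * b"
      then have "Re b = Re (\<i> * b)" "Im b = Im (\<i> * b)" by (rule arg_cong)+
      then have "Re b = 0" "Im b = 0" unfolding Re_i_times Im_i_times by linarith+
      then have "b = 0" by (simp add: complex_eq_iff)
      then show False using nb by simp
    qed
    moreover have "b \<in> circle" "\<i> * b \<in> circle" using nb by (simp_all add: norm_mult)
    ultimately show False using homeo_inj[OF f] by (metis inj_onD)
  qed
  then have "f z = dm v b z" if "norm z = 1" for z
    using fz that dm_denominator[of b z] by simp
  moreover have "f \<in> extensional circle" using f by (simp add: Homeo_set_def)
  ultimately have "f = restrict (dm v b) circle" by (intro extensionalityI[of f circle]) auto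
  then show "f \<in> PSL2R" using vb \<open>norm b < 1\<close> unfolding PSL2R_eq by blast
qed

text \<open>The witness fixes \<open>1\<close>, \<open>- 1\<close> and \<open>\<i>\<close>, which
  forces a Moebius map to be the identity, but it moves \<open>cis (pi / 4)\<close>. The factor 1/4
  keeps the derivative \<open>1 + cos (2 * t) / 2\<close> of its lift positive.\<close>

lemma PSL2R_proper: "PSL2R \<noteq> Homeo_set"
proof -
  define f where "f = (\<lambda>z\<in>circle. z * cis (Im (z\<^sup>2) / 4))"
  define F where "F t = t + sin (2 * t) / 4" for t :: real
  have fF: "f (cis t) = cis (F t)" for t
    
  proof -
    have "Im ((cis t)\<^sup>2) = sin (2 * t)" unfolding power2_eq_square cis_mult by simp
    then show ?thesis by (simp add: f_def F_def cis_mult)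
  qed
  have contF: "continuous_on UNIV F" unfolding F_def by (intro continuous_intros) simp
  have perF: "F (t + 2 * pi) = F t + 2 * pi" for t
  proof -
    have "sin (2 * (t + 2 * pi)) = sin (2 * t)"
      using sin.plus_of_nat[of "2 * t" 2] by (simp add: algebra_simps)
    then show ?thesis by (simp add: F_def)
  qed
  have mono: "F s < F t" if "s < t" for s t
  proof (rule DERIV_pos_imp_increasing[OF that])
    fix x
    have "(F has_real_derivative (1 + cos (2 * x) * 2 / 4)) (at x)"
      unfolding F_def by (auto intro!: derivative_eq_intros)
    moreover have "0 < 1 + cos (2 * x) * 2 / 4" using cos_ge_minus_one[of "2 * x"] by linarith
    ultimately show "\<exists>y. (F has_real_derivative y) (at x) \<and> 0 < y" by blast
  qed
  have injF: "inj F" using mono by (metis injI linorder_neqE_linordered_idom less_irrefl)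
  have inj: "inj_on f circle"
  proof (rule inj_onI)
    fix x y assume "x \<in> circle" "y \<in> circle" and e: "f x = f y"
    then obtain s t where st: "x = cis s" "y = cis t" using circle_iff_cis by blast
    then have "cis (F s) = cis (F t)" using e fF by simp
    then obtain k :: int where k: "F s = F t + of_int k * (2 * pi)" using cis_eq_iff by blast
    have "F (t + of_int k * (2 * pi)) = F t + of_int k * (2 * pi)"
    proof -
      have "2 * (t + of_int k * (2 * pi)) = 2 * t + of_int (2 * k) * (2 * pi)" by (simp add: algebra_simps)
      then have "cis (2 * (t + of_int k * (2 * pi))) = cis (2 * t)" using cis_eq_iff by blast
      then have "Im (cis (2 * (t + of_int k * (2 * pi)))) = Im (cis (2 * t))" by (rule arg_cong)
      then have "sin (2 * (t + of_int k * (2 * pi))) = sin (2 * t)" by (simp only: cis.sel)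
      then show ?thesis by (simp add: F_def)
    qed
    then have "s = t + of_int k * (2 * pi)" using injF k by (metis injD)
    then show "x = y" using st cis_eq_iff by blast
  qed
  have img: "f ` circle = circle"
  proof
    show "f ` circle \<subseteq> circle" by (auto simp: f_def norm_mult)
    show "circle \<subseteq> f ` circle"
    proof
      fix z assume "z \<in> circle"
      then obtain t where t: "z = cis t" using circle_iff_cis by blast
      obtain s where "F s = t" using lift_surj[OF contF perF] by (metis surjD)
      then show "z \<in> f ` circle" using fF[of s] t by (metis cis_in_circle image_eqI)
    qed
  qed
  have "continuous_on circle f"
  proof (rule continuous_on_eq)
    show "continuous_on circle (\<lambda>z. z * cis (Im (z\<^sup>2) / 4))"
      unfolding cis_conv_exp by (intro continuous_intros) auto
  qed (simp add: f_def)
  then have fH: "f \<in> Homeo_set"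
    using inj img contF perF fF by (intro Homeo_setI) (auto simp: f_def)
  have "f \<notin> PSL2R"
  proof
    assume "f \<in> PSL2R"
    then obtain u a where f: "f = restrict (dm u a) circle" and u: "norm u = 1" "norm a < 1"
      unfolding PSL2R_eq by blast
    have e: "cnj a * z\<^sup>2 + (1 - u) * z + (- (u * a)) = 0" if "z \<in> {1, - 1, \<i> * 1}" for z
    proof -
      have z: "norm z = 1" "Im (z\<^sup>2) = 0" using that by auto
      then have "f z = z" by (simp add: f_def)
      then have "dm u a z = z" using f z by simp
      moreover have "1 + cnj a * z \<noteq> 0" using u z by (intro dm_denominator) auto
      ultimately have "u * (z + a) = z * (1 + cnj a * z)" by (simp add: dm_def divide_eq_eq)
      then show ?thesis by (simp add: power2_eq_square algebra_simps)
    qed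
    have "a = 0" "u = 1" using quadratic_vanish[OF one_neq_zero e] by auto
    then have "f (cis (pi / 4)) = cis (pi / 4)" using f by simp
    then have "cis (F (pi / 4)) = cis (pi / 4)" using fF by simp
    then obtain k :: int where "F (pi / 4) = pi / 4 + of_int k * (2 * pi)" using cis_eq_iff by blast
    then have k: "1 / 4 = of_int k * (2 * pi)" by (simp add: F_def)
    have "0 < of_int k * (2 * pi)" unfolding k[symmetric] by simp
    then have "0 < k" by (simp add: zero_less_mult_iff)
    then have "1 * (2 * pi) \<le> of_int k * (2 * pi)" by (intro mult_right_mono) auto
    then show False using k pi_gt3 by linarith
  qed
  then show ?thesis using fH by blast
qed

section \<open>Highly transitive closed groups\<close>

definition lifts :: "(complex \<Rightarrow> complex) set \<Rightarrow> (real \<Rightarrow> real) set" where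
  "lifts G = {F. strict_mono F \<and> continuous_on UNIV F \<and> (\<exists>f\<in>G. \<forall>t. f (cis t) = cis (F t))}"

lemma lifts_mono: "G \<subseteq> H \<Longrightarrow> lifts G \<subseteq> lifts H"
  unfolding lifts_def by blast

lemma liftsE:
  assumes "F \<in> lifts G"
  obtains f where "f \<in> G" "\<And>t. f (cis t) = cis (F t)"
  using assms unfolding lifts_def by blast

lemma liftsI:
  assumes "f \<in> Homeo_set" "f \<in> G" "continuous_on UNIV F" "\<And>t. F (t + 2 * pi) = F t + 2 * pi"
    "\<And>t. f (cis t) = cis (F t)"
  shows "F \<in> lifts G"
  unfolding lifts_def using assms lift_strict_mono[OF homeo_inj[OF assms(1)] assms(3-5)] by blast

lemma Homeo_lift:
  assumes "f \<in> Homeo_set" "f \<in> G"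
  obtains F where "F \<in> lifts G" "\<And>t. f (cis t) = cis (F t)"
  using assms unfolding Homeo_set_def orientation_preserving_def lifts_def by blast

lemma inv_into_lift:
  assumes f: "f \<in> Homeo_set" and F: "surj F" "\<And>t. f (cis t) = cis (F t)"
  shows "inv_into circle f (cis y) = cis (inv F y)"
proof (rule inv_into_f_eq)
  show "inj_on f circle" using f by (rule homeo_inj)
  show "f (cis (inv F y)) = cis y" using F by (simp add: surj_f_inv_f)
qed simp

lemma lift_group_lifts:
  assumes "subgroup G Homeo"
  shows "lift_group (lifts G) (2 * pi)"
proof -
  have GH: "G \<subseteq> Homeo_set" using assms by (simp add: subgroup_def)
  have per: "F (t + 2 * pi) = F t + 2 * pi" if "F \<in> lifts G" for F t
    using that lift_periodic[OF homeo_inj] GH unfolding lifts_def by blast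
  have surj: "surj F" if "F \<in> lifts G" for F
    using that lift_surj[where F = F, OF _ per[OF that]] unfolding lifts_def by blast
  show ?thesis
  proof
    have "(\<lambda>x\<in>circle. x) \<in> G" using subgroup.one_closed[OF assms] by (simp add: one_Homeo)
    then show "id \<in> lifts G"
      unfolding lifts_def by (auto simp: strict_mono_def continuous_on_id' intro!: bexI[of _ "\<lambda>x\<in>circle. x"])
  next
    fix F H assume FH: "F \<in> lifts G" "H \<in> lifts G"
    obtain f where f: "f \<in> G" "\<And>t. f (cis t) = cis (F t)" using liftsE[OF FH(1)] by blast
    obtain h where h: "h \<in> G" "\<And>t. h (cis t) = cis (H t)" using liftsE[OF FH(2)] by blast
    have "compose circle f h \<in> G"
      using subgroup.m_closed[OF assms f(1) h(1)] mult_Homeo f(1) h(1) GH by (metis subsetD)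
    moreover have "compose circle f h (cis t) = cis ((F \<circ> H) t)" for t
      using f h by (simp add: compose_def)
    moreover have "strict_mono (F \<circ> H)"
      using FH unfolding lifts_def by (simp add: strict_mono_def)
    moreover have "continuous_on UNIV (F \<circ> H)"
      using FH continuous_on_compose[of UNIV H F] continuous_on_subset[of UNIV F "range H"]
      unfolding lifts_def by blast
    ultimately show "F \<circ> H \<in> lifts G" unfolding lifts_def by blast
  next
    fix F assume F: "F \<in> lifts G"
    obtain f where f: "f \<in> G" "\<And>t. f (cis t) = cis (F t)" using liftsE[OF F] by blast
    have fH: "f \<in> Homeo_set" using f GH by blast
    have mono: "strict_mono F" using F by (simp add: lifts_def)
    have FiF: "F (inv F y) = y" "inv F (F t) = t" for y t
      using surj[OF F] strict_mono_imp_inj_on[OF mono] by (simp_all add: surj_f_inv_f)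
    have smi: "strict_mono (inv F)"
      by (rule strict_monoI) (metis mono FiF(1) strict_mono_less)
    moreover have "range (inv F) = UNIV" by (metis FiF(2) surjI)
    then have "continuous_on UNIV (inv F)"
      by (intro continuous_onI_mono) (simp_all add: strict_mono_less_eq[OF smi])
    moreover have "(\<lambda>x\<in>circle. inv_into circle f x) \<in> G"
      using subgroup.m_inv_closed[OF assms f(1)] inv_Homeo[OF fH] by simp
    moreover have "(\<lambda>x\<in>circle. inv_into circle f x) (cis y) = cis (inv F y)" for y
      using inv_into_lift[OF fH surj[OF F] f(2)] by simp
    ultimately show "inv F \<in> lifts G" unfolding lifts_def by blast
  next
    show "strict_mono F" if "F \<in> lifts G" for F using that by (simp add: lifts_def)
  qed (use per surj in auto)
qed

lemma strict_mono_image_eq: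
  fixes f g :: "'a::linorder \<Rightarrow> 'b::linorder"
  assumes "finite A" "strict_mono f" "strict_mono g" "f ` A = g ` A" "x \<in> A"
  shows "f x = g x"
proof -
  let ?xs = "sorted_list_of_set A"
  have "sorted (map h ?xs)" "distinct (map h ?xs)" if "strict_mono h" for h :: "'a \<Rightarrow> 'b"
    using that strict_mono_imp_inj_on[OF that] inj_on_subset
    by (auto simp: sorted_map strict_mono_less_eq distinct_map)
  then have "map f ?xs = map g ?xs"
    using assms by (intro sorted_distinct_set_unique) auto
  then show ?thesis using assms(1,5) by simp
qed

lemma dist_cis_le: "dist (cis x) (cis y) \<le> \<bar>x - y\<bar>"
proof -
  have "(dist (cis x) (cis y))\<^sup>2 = (cos x - cos y)\<^sup>2 + (sin x - sin y)\<^sup>2"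
    by (simp add: dist_norm cmod_power2)
  also have "\<dots> = 2 - 2 * cos (x - y)"
    using sin_cos_squared_add[of x] sin_cos_squared_add[of y]
    by (simp add: cos_diff power2_diff algebra_simps)
  also have "\<dots> = (2 * sin ((x - y) / 2))\<^sup>2"
  proof -
    have e: "2 * ((x - y) / 2) = x - y" by simp
    have "cos (x - y) = 1 - 2 * (sin ((x - y) / 2))\<^sup>2"
      using cos_double_sin[of "(x - y) / 2"] unfolding e .
    then show ?thesis by (simp add: power_mult_distrib)
  qed
  finally have "dist (cis x) (cis y) = \<bar>2 * sin ((x - y) / 2)\<bar>"
    by (metis power2_abs power2_eq_iff_nonneg zero_le_dist abs_ge_zero)
  also have "\<dots> \<le> \<bar>x - y\<bar>" using abs_sin_x_le_abs_x[of "(x - y) / 2"] by (simp add: abs_mult)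
  finally show ?thesis .
qed

text \<open>Between neighbouring grid points both maps lie between the same two values, at most
  \<open>e\<close> apart by \<open>step\<close>; both preimages of \<open>t\<close> lie in the same
  grid cell, of length at most \<open>e\<close> by \<open>small\<close>.\<close>

lemma lifts_close:
  assumes FH: "strict_mono F" "strict_mono H" "surj F" "surj H"
    and per: "\<And>t. F (t + 2 * pi) = F t + 2 * pi" "\<And>t. H (t + 2 * pi) = H t + 2 * pi"
    and N: "0 < N" and agree: "\<And>i. i < N \<Longrightarrow> H (real i * (2 * pi / real N)) = F (real i * (2 * pi / real N))"
    and step: "\<And>s. 0 \<le> s \<Longrightarrow> s \<le> 2 * pi \<Longrightarrow> F (s + 2 * pi / real N) - F s \<le> e"
    and small: "2 * pi / real N \<le> e"
  shows "\<bar>F t - H t\<bar> \<le> e" "\<bar>inv F t - inv H t\<bar> \<le> e"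
proof -
  define h where "h = 2 * pi / real N"
  have h: "0 < h" "real N * h = 2 * pi" using N by (auto simp: h_def)
  have grid: "H (of_int j * h) = F (of_int j * h) \<and> F (of_int j * h + h) - F (of_int j * h) \<le> e" for j :: int
  proof -
    define i where "i = nat (j mod int N)"
    have i: "i < N" "int i = j mod int N" using N by (auto simp: i_def nat_less_iff)
    have "j = int i + int N * (j div int N)" using i by simp
    then have "(of_int j :: real) = real i + real N * of_int (j div int N)"
      by (metis of_int_add of_int_mult of_int_of_nat_eq)
    then have j: "of_int j * h = real i * h + of_int (j div int N) * (2 * pi)"
      using h(2) by (simp add: algebra_simps flip: h(2))
    have "real i * h \<le> real N * h" using i h by (intro mult_right_mono) auto
    then have "F (real i * h + h) - F (real i * h) \<le> e"
      using step[of "real i * h"] h by (simp add: h_def)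
    moreover have j': "of_int j * h + h = (real i * h + h) + of_int (j div int N) * (2 * pi)" using j by simp
    have "F (of_int j * h + h) = F (real i * h + h) + of_int (j div int N) * (2 * pi)"
      unfolding j' by (rule shift_of_int[where F = F, OF per(1)])
    moreover have "F (of_int j * h) = F (real i * h) + of_int (j div int N) * (2 * pi)"
      unfolding j by (rule shift_of_int[where F = F, OF per(1)])
    moreover have "H (of_int j * h) = H (real i * h) + of_int (j div int N) * (2 * pi)"
      unfolding j by (rule shift_of_int[where F = H, OF per(2)])
    moreover have "H (real i * h) = F (real i * h)" using agree[OF i(1)] by (simp add: h_def)
    ultimately show ?thesis by linarith
  qed
  have cell: "\<exists>j::int. of_int j * h \<le> s \<and> s \<le> of_int j * h + h" for s
  proof -
    have "of_int \<lfloor>s / h\<rfloor> \<le> s / h" "s / h \<le> of_int \<lfloor>s / h\<rfloor> + 1" by linarith+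
    then have "of_int \<lfloor>s / h\<rfloor> * h \<le> s" "s \<le> (of_int \<lfloor>s / h\<rfloor> + 1) * h"
      by (simp_all only: pos_le_divide_eq[OF h(1)] pos_divide_le_eq[OF h(1)])
    then show ?thesis by (intro exI[of _ "\<lfloor>s / h\<rfloor>"]) (simp add: distrib_right)
  qed
  have grid': "H (of_int j * h + h) = F (of_int j * h + h)" for j :: int
    using grid[of "j + 1"] by (simp add: distrib_right)
  obtain j :: int where j: "of_int j * h \<le> t" "t \<le> of_int j * h + h" using cell by blast
  have "F (of_int j * h) \<le> F t" "F t \<le> F (of_int j * h + h)" "H (of_int j * h) \<le> H t" "H t \<le> H (of_int j * h + h)"
    using j FH by (simp_all add: strict_mono_less_eq)
  then show "\<bar>F t - H t\<bar> \<le> e" using grid[of j] grid'[of j] by linarith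
  obtain k :: int where k: "of_int k * h \<le> inv F t" "inv F t \<le> of_int k * h + h" using cell by blast
  have FF: "F (inv F t) = t" "H (inv H t) = t" using FH by (simp_all add: surj_f_inv_f)
  have "F (of_int k * h) \<le> t" "t \<le> F (of_int k * h + h)"
    using k FH(1) FF(1) strict_mono_less_eq[OF FH(1)] by metis+
  then have "of_int k * h \<le> inv H t" "inv H t \<le> of_int k * h + h"
    using grid[of k] grid'[of k] FF(2) strict_mono_less_eq[OF FH(2)] by metis+
  then show "\<bar>inv F t - inv H t\<bar> \<le> e" using k small by (simp add: h_def)
qed

lemma closed_highly_transitive:
  assumes G: "subgroup G Homeo" and cl: "closedin Homeo_topology G"
    and tr: "\<And>n. 3 \<le> n \<Longrightarrow> lift_group.transitive (lifts G) (2 * pi) n"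
  shows "G = Homeo_set"
proof
  interpret \<Gamma>: lift_group "lifts G" "2 * pi" using G by (rule lift_group_lifts)
  show GH: "G \<subseteq> Homeo_set" using G by (simp add: subgroup_def)
  show "Homeo_set \<subseteq> G"
  proof
    fix f assume f: "f \<in> Homeo_set"
    obtain F where F: "F \<in> lifts Homeo_set" "\<And>t. f (cis t) = cis (F t)"
      using Homeo_lift[OF f f] by blast
    have mono: "strict_mono F" and contF: "continuous_on UNIV F" using F by (auto simp: lifts_def)
    have perF: "F (t + 2 * pi) = F t + 2 * pi" for t
      using lift_periodic[OF homeo_inj[OF f] contF mono F(2)] .
    have surjF: "surj F" using lift_surj[OF contF perF] .
    have "\<exists>g\<in>G. Homeo_dist f g < e" if e: "0 < e" for e
    proof -
      \<comment> \<open>Two periods, so that \<open>s + h\<close> stays in the interval for every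
        \<open>s\<close> in the first one.\<close>
      have "uniformly_continuous_on {0..4 * pi} F"
        using contF by (intro compact_uniformly_continuous) (auto intro: continuous_on_subset)
      then obtain d where d: "0 < d" "\<And>s t. s \<in> {0..4 * pi} \<Longrightarrow> t \<in> {0..4 * pi} \<Longrightarrow> dist t s < d \<Longrightarrow> dist (F t) (F s) < e / 2"
        unfolding uniformly_continuous_on_def using e by (meson half_gt_zero)
      obtain N0 :: nat where N0: "2 * pi / min d (e / 2) < real N0" using reals_Archimedean2 by blast
      define N where "N = max 3 N0"
      have N: "3 \<le> N" "0 < real N" by (auto simp: N_def)
      define h where "h = 2 * pi / real N"
      have "2 * pi / min d (e / 2) < real N" using N0 by (simp add: N_def)
      then have "2 * pi < real N * min d (e / 2)" using d e by (simp add: pos_divide_less_eq)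
      then have hmin: "h < min d (e / 2)" unfolding h_def pos_divide_less_eq[OF N(2)] by (simp only: mult.commute)
      have h: "0 < h" "h < d" "h < e / 2" "real N * h = 2 * pi" "h < 2 * pi"
        using hmin N by (auto simp: h_def divide_less_eq)
      define P where "P = (\<lambda>i. real i * h) ` {..<N}"
      have "card P = N" unfolding P_def using h by (subst card_image) (auto simp: inj_on_def)
      \<comment> \<open>The grid contains \<open>0\<close> and \<open>cfg\<close> asks for an open
        window, hence the offset by \<open>h / 2\<close>.\<close>
      have Pb: "- (h / 2) < t \<and> t < - (h / 2) + 2 * pi" if tP: "t \<in> P" for t
      proof -
        obtain i where i: "i < N" "t = real i * h" using tP by (auto simp: P_def)
        then have "real i + 1 \<le> real N" by simp
        then have "(real i + 1) * h \<le> real N * h" using h by (intro mult_right_mono) auto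
        then have "t + h \<le> 2 * pi" using i h(4) by (simp add: distrib_right)
        moreover have "0 \<le> t" using i h by simp
        ultimately show ?thesis using h(1) by linarith
      qed
      have fin: "finite P" by (simp add: P_def)
      have c1: "\<Gamma>.cfg N P" unfolding \<Gamma>.cfg_def using fin \<open>card P = N\<close> Pb by (auto intro!: exI[of _ "- (h / 2)"])
      have "F t \<in> {F (- (h / 2))<..<F (- (h / 2)) + 2 * pi}" if "t \<in> P" for t
        using Pb[OF that] mono perF[of "- (h / 2)"] by (auto simp: strict_mono_less simp flip: perF)
      moreover have "card (F ` P) = N"
        using \<open>card P = N\<close> mono by (simp add: card_image strict_mono_imp_inj_on inj_on_subset)
      ultimately have c2: "\<Gamma>.cfg N (F ` P)"
        unfolding \<Gamma>.cfg_def using fin by (blast intro: exI[of _ "F (- (h / 2))"])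
      obtain H where H: "H \<in> lifts G" "H ` P = F ` P"
        using tr[OF N(1)] c1 c2 unfolding \<Gamma>.transitive_def by blast
      obtain g where g: "g \<in> G" "\<And>t. g (cis t) = cis (H t)" using liftsE[OF H(1)] by blast
      have gH: "g \<in> Homeo_set" using g GH by blast
      have monoH: "strict_mono H" using H by (simp add: lifts_def)
      have agree: "H (real i * (2 * pi / real N)) = F (real i * (2 * pi / real N))" if "i < N" for i
        using strict_mono_image_eq[OF fin monoH mono H(2), of "real i * h"] that by (auto simp: P_def h_def)
      have step: "F (s + 2 * pi / real N) - F s \<le> e / 2" if s: "0 \<le> s" "s \<le> 2 * pi" for s
      proof -
        have "dist (F (s + h)) (F s) < e / 2" using d(2)[of s "s + h"] s h by (auto simp: dist_real_def)
        then show ?thesis unfolding h_def dist_real_def by linarith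
      qed
      have small: "2 * pi / real N \<le> e / 2" using h by (simp add: h_def)
      have N': "0 < N" using N by simp
      note close = lifts_close[OF mono monoH surjF \<Gamma>.surj[OF H(1)] perF \<Gamma>.periodic[OF H(1)] N' agree step small]
      have "Homeo_dist f g \<le> e / 2"
      proof (rule Homeo_dist_le[OF f gH])
        fix z assume "z \<in> circle"
        then obtain t where t: "z = cis t" using circle_iff_cis by blast
        show "dist (f z) (g z) \<le> e / 2"
          unfolding t F(2) g(2) using dist_cis_le close(1) by (rule order_trans)
        show "dist (inv_into circle f z) (inv_into circle g z) \<le> e / 2"
          unfolding t inv_into_lift[OF f surjF F(2)] inv_into_lift[OF gH \<Gamma>.surj[OF H(1)] g(2)]
          using dist_cis_le close(2) by (rule order_trans)
      qed
      then show ?thesis using g e by (intro bexI[of _ g]) auto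
    qed
    then show "f \<in> G" using cl f unfolding closedin_Homeo by blast
  qed
qed

section \<open>Groups containing all Moebius transformations\<close>

lemma dm_lift_PSL2R: "norm a < 1 \<Longrightarrow> dm_lift \<theta> a \<in> lifts PSL2R"
proof -
  assume a: "norm a < 1"
  have n: "norm (cis \<theta>) = 1" by simp
  show ?thesis
  proof (rule liftsI[OF dm_Homeo[OF n a]])
    show "restrict (dm (cis \<theta>) a) circle \<in> PSL2R" using n a unfolding PSL2R_eq by blast
    show "continuous_on UNIV (dm_lift \<theta> a)"
      using a by (intro continuous_on_dm_lift continuous_on_const continuous_on_id) auto
  qed (simp_all add: dm_lift_periodic dm_lift[OF a])
qed

lemma dm_lift_zero: "dm_lift \<theta> 0 = (\<lambda>t. t + \<theta>)"
  by (simp add: dm_lift_def fun_eq_iff)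

lemma dm_lift_0_0: "dm_lift 0 0 = id"
  by (simp add: dm_lift_def fun_eq_iff)

lemma rotation_PSL2R: "(\<lambda>t. t + \<theta>) \<in> lifts PSL2R"
  using dm_lift_PSL2R[of 0 \<theta>] by (simp add: dm_lift_zero)

locale PSL2R_extension =
  fixes G :: "(complex \<Rightarrow> complex) set"
  assumes G: "subgroup G Homeo" and PSL: "PSL2R \<subseteq> G"

sublocale PSL2R_extension \<subseteq> lift_group "lifts G" "2 * pi"
  using G by (rule lift_group_lifts)

context PSL2R_extension begin

lemma dm_lift_mem: "norm a < 1 \<Longrightarrow> dm_lift \<theta> a \<in> lifts G"
  using dm_lift_PSL2R lifts_mono[OF PSL] by blast

lemma rotation_mem: "(\<lambda>t. t + \<theta>) \<in> lifts G"
  using rotation_PSL2R lifts_mono[OF PSL] by blast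

text \<open>The path scales \<open>a\<close> down to \<open>0\<close>, while \<open>\<theta>\<close>
  supplies a rotation that compensates for the motion of \<open>P\<close>.\<close>

lemma dm_lift_path_Q:
  assumes \<theta>: "continuous_on {0..1} \<theta>" "\<theta> 0 = 0" and a: "norm a < 1"
    and stay: "\<And>s p. s \<in> {0..1} \<Longrightarrow> p \<in> P \<Longrightarrow> dm_lift (\<theta> s) (of_real s * a) p = p"
  shows "dm_lift (\<theta> 1) a \<in> Q P"
proof (rule Q_I)
  let ?\<gamma> = "\<lambda>s. dm_lift (\<theta> s) (of_real s * a)"
  have small: "norm (of_real s * a) < 1" if "s \<in> {0..1}" for s
    using that a mult_left_le_one_le[of "norm a" s] by (simp add: norm_mult)
  have "continuous_on {0..1} ?\<gamma>"
    by (rule continuous_on_coordinatewise_then_product, rule continuous_on_dm_lift)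
      (use \<theta> small in \<open>auto intro!: continuous_intros\<close>)
  then show "compact (?\<gamma> ` {0..1})" "connected (?\<gamma> ` {0..1})"
    by (auto intro: compact_continuous_image connected_continuous_image)
  show "id \<in> ?\<gamma> ` {0..1}" using \<theta>(2) dm_lift_0_0 by (auto simp: image_iff intro!: bexI[of _ 0])
  show "?\<gamma> ` {0..1} \<subseteq> fixers P" using stay small dm_lift_mem by (auto simp: fixers_def)
  show "dm_lift (\<theta> 1) a \<in> ?\<gamma> ` {0..1}" by (auto simp: image_iff intro!: bexI[of _ 1])
qed

lemma hyperbolic_Q:
  assumes "\<bar>b\<bar> < 1"
  shows "dm_lift 0 (of_real b) \<in> Q {0, pi}"
proof (rule dm_lift_path_Q[of "\<lambda>s. 0"])
  fix s p :: real assume s: "s \<in> {0..1}" and p: "p \<in> {0, pi}"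
  have "\<bar>s * b\<bar> < 1" using s assms mult_left_le_one_le[of "\<bar>b\<bar>" s] by (simp add: abs_mult)
  then have "Arg (of_real (1 + s * b)) = 0" "Arg (of_real (1 - s * b)) = 0"
    by (simp_all only: Arg_of_real) auto
  then show "dm_lift 0 (of_real s * of_real b) p = p" using p by (auto simp: dm_lift_def)
qed (use assms in auto)

lemma hyperbolic_moves:
  assumes "sin y \<noteq> 0"
  shows "dm_lift 0 (1 / 2) y \<noteq> y"
proof -
  have "Im (1 + cis y / 2) \<noteq> 0" using assms by simp
  then have "Arg (1 + cis y / 2) \<noteq> 0" by (metis Arg_eq_0_iff complex_is_Real_iff)
  then show ?thesis by (simp add: dm_lift_def)
qed

text \<open>The hyperbolic map with fixed points \<open>0\<close> and \<open>pi\<close> moves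
  everything but the multiples of \<open>pi\<close>; at the odd ones a transvection along
  \<open>\<i>\<close> followed by a rotation takes over.\<close>

lemma moved_off_point:
  assumes y: "y \<notin> shifts {0}"
  shows "\<exists>q\<in>Q {0}. q y \<noteq> y"
proof (cases "sin y = 0")
  case False
  have "dm_lift 0 (1 / 2) \<in> Q {0, pi}" using hyperbolic_Q[of "1 / 2"] by simp
  then have "dm_lift 0 (1 / 2) \<in> Q {0}" using Q_mono[of "{0}" "{0, pi}"] by blast
  then show ?thesis using hyperbolic_moves[OF False] by blast
next
  case True
  then obtain i :: int where i: "y = of_int i * pi" using sin_zero_iff_int2 by blast
  have "odd i"
  proof
    assume "even i"
    then obtain k where "i = 2 * k" by blast
    then have "y = 0 + of_int k * (2 * pi)" using i by simp
    then show False using y shiftsI[of 0 "{0}" k] by simp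
  qed
  then obtain k where "i = 2 * k + 1" by (auto elim: oddE)
  then have yk: "y = pi + of_int k * (2 * pi)" using i by (simp add: algebra_simps)
  \<comment> \<open>This rotation angle returns the image of \<open>0\<close> to \<open>0\<close> at
    every time of the path.\<close>
  define \<theta> where "\<theta> s = - dm_lift 0 (of_real s * (\<i> / 2)) 0" for s :: real
  have small: "norm (of_real s * (\<i> / 2)) < 1" if "s \<in> {0..1}" for s
    using that by (simp add: norm_mult norm_divide)
  have "dm_lift (\<theta> 1) (\<i> / 2) \<in> Q {0}"
  proof (rule dm_lift_path_Q)
    show "continuous_on {0..1} \<theta>"
      unfolding \<theta>_def using small
      by (intro continuous_on_minus continuous_on_dm_lift) (auto intro!: continuous_intros)
    show "\<theta> 0 = 0" by (simp add: \<theta>_def dm_lift_0_0)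
    show "norm (\<i> / 2) < 1" by (simp add: norm_divide)
    show "dm_lift (\<theta> s) (of_real s * (\<i> / 2)) p = p" if "p \<in> {0}" for s p
      using that by (simp add: \<theta>_def dm_lift_def)
  qed
  moreover have "dm_lift (\<theta> 1) (\<i> / 2) pi \<noteq> pi"
  proof -
    have "Arg (1 + \<i> / 2) > 0" "Arg (1 - \<i> / 2) < 0" by (simp_all add: Arg_pos_iff Arg_neg_iff)
    then show ?thesis by (simp add: \<theta>_def dm_lift_def)
  qed
  ultimately show ?thesis
    unfolding yk using periodic_int[of "dm_lift (\<theta> 1) (\<i> / 2)" pi k] Q_mem
    by (intro bexI[of _ "dm_lift (\<theta> 1) (\<i> / 2)"]) auto
qed

lemma inv_rotation: "inv (\<lambda>t. t + \<theta> :: real) = (\<lambda>t. t - \<theta>)"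
  by (rule inv_equality) auto

lemma transitive_2: "transitive 2"
proof -
  have "transitive (Suc 1)"
  proof (rule transitive_Suc)
    show "transitive 1"
      unfolding transitive_def
    proof (intro allI impI)
      fix P R assume "cfg 1 P" "cfg 1 R"
      then obtain p r where "P = {p}" "R = {r}" by (auto simp: cfg_def card_1_singleton_iff)
      then show "\<exists>g\<in>lifts G. g ` P = R" using rotation_mem[of "r - p"] by (auto intro!: bexI[of _ "\<lambda>t. t + (r - p)"])
    qed
    fix P assume "cfg 1 P"
    then obtain p where P: "P = {p}" by (auto simp: cfg_def card_1_singleton_iff)
    show "gap_transitive P"
    proof (rule gap_transitiveI)
      fix y assume y: "y \<notin> shifts P"
      have "y - p \<notin> shifts {0}"
      proof
        assume "y - p \<in> shifts {0}"
        then obtain k :: int where "y - p = of_int k * (2 * pi)" by (auto simp: shifts_def)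
        then have "y = p + of_int k * (2 * pi)" by simp
        then show False using y shiftsI[of p P k] P by simp
      qed
      then obtain q where q: "q \<in> Q {0}" "q (y - p) \<noteq> y - p" using moved_off_point by blast
      have "(\<lambda>t. t + p) \<circ> q \<circ> inv (\<lambda>t. t + p) \<in> Q P"
        using Q_conj[OF rotation_mem q(1), of p] P by simp
      moreover have "((\<lambda>t. t + p) \<circ> q \<circ> inv (\<lambda>t. t + p)) y \<noteq> y"
        using q(2) by (simp add: inv_rotation)
      ultimately show "\<exists>q\<in>Q P. q y \<noteq> y" by blast
    qed
  qed simp
  then show ?thesis by (simp add: numeral_2_eq_2)
qed

lemma cfg_0_pi: "cfg 2 {0, pi}"
  unfolding cfg_def using pi_gt3 by (auto intro!: exI[of _ "-1"])

lemma Q_2_nontrivial: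
  assumes "cfg 2 P"
  shows "Q P \<noteq> {id}"
proof
  assume "Q P = {id}"
  then have "Q {0, pi} = {id}" using transitive_transfer_trivial[OF transitive_2 assms _ cfg_0_pi] by blast
  then have "dm_lift 0 (1 / 2) = id" using hyperbolic_Q[of "1 / 2"] by auto
  then show False using hyperbolic_moves[of "pi / 2"] by simp
qed

lemma transitive_3: "transitive 3"
proof -
  have "gap_transitive P" if "cfg 2 P" for P
    using moved_off_shifts[OF transitive_2 order_refl that Q_2_nontrivial[OF that]]
    by (intro gap_transitiveI)
  then have "transitive (Suc 2)" using transitive_2 by (intro transitive_Suc) auto
  then show ?thesis by (simp add: numeral_3_eq_3 numeral_2_eq_2)
qed

end

section \<open>Conjugates of transvections and rotations\<close>

interpretation PSL: PSL2R_extension PSL2R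
  by (rule PSL2R_extension.intro[OF subgroup_PSL2R order_refl])

lemma one_plus_i_tan:
  assumes "cos \<phi> \<noteq> 0"
  shows "1 + \<i> * of_real (tan \<phi>) = cis \<phi> * of_real (1 / cos \<phi>)"
  using assms by (simp add: complex_eq_iff tan_def)

lemma tan_small: "\<bar>\<phi>\<bar> < pi / 4 \<Longrightarrow> \<bar>tan \<phi>\<bar> < 1"
  using tan_monotone[of \<phi> "pi / 4"] tan_monotone[of "- (pi / 4)" \<phi>] by (auto simp: tan_45 abs_less_iff)

lemma cos_small: "\<bar>\<phi>\<bar> < pi / 4 \<Longrightarrow> 0 < cos \<phi>"
  by (rule cos_gt_zero_pi) auto

context PSL2R_extension begin

lemma cfg_image:
  assumes g: "g \<in> lifts G" and P: "cfg n P"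
  shows "cfg n (g ` P)"
proof -
  obtain a where a: "P \<subseteq> {a<..<a + 2 * pi}" "finite P" "card P = n" using P by (auto simp: cfg_def)
  have "inj_on g P" using inj[OF g] inj_on_subset by blast
  moreover have "g ` P \<subseteq> {g a<..<g a + 2 * pi}"
    using a(1) g by (auto simp flip: periodic[OF g])
  ultimately show ?thesis using a unfolding cfg_def by (auto simp: card_image intro!: exI[of _ "g a"])
qed

text \<open>Triviality for three points makes an element of \<open>Q {0, pi}\<close> determined by
  its value at \<open>pi / 2\<close>, and the hyperbolic maps already take every possible value
  there.\<close>

lemma Q_0_pi_hyperbolic:
  assumes triv: "\<And>P. cfg 3 P \<Longrightarrow> Q P = {id}" and q: "q \<in> Q {0, pi}"
  shows "q \<in> lifts PSL2R"
proof -
  have qm: "q \<in> lifts G" and q0: "q 0 = 0" and qp: "q pi = pi" using q Q_mem Q_fix by auto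
  have "pi / 2 \<notin> shifts {0, pi}"
    using shifts_window[of "{0, pi}" 0 "pi / 2"] by auto
  then have "config (Suc 2) (insert (pi / 2) {0, pi})"
    using cfg_0_pi by (intro config_insert) (auto simp: config_def)
  then have free: "Q (insert (pi / 2) {0, pi}) = {id}"
    using config_Q[of 3 "insert (pi / 2) {0, pi}" "{id}"] triv by (simp add: numeral_3_eq_3 numeral_2_eq_2)
  \<comment> \<open>\<open>1 + \<i> * tan \<phi>\<close> has the argument \<open>\<phi>\<close>, so
    the hyperbolic map with parameter \<open>tan \<phi>\<close> takes \<open>pi / 2\<close> to
    \<open>pi / 2 - 2 * \<phi> = q (pi / 2)\<close>.\<close>
  define \<phi> where "\<phi> = (pi / 2 - q (pi / 2)) / 2"
  have "0 < q (pi / 2)" "q (pi / 2) < pi"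
    using less_iff[OF qm, of 0 "pi / 2"] less_iff[OF qm, of "pi / 2" pi] q0 qp by auto
  moreover have "\<phi> = pi / 4 - q (pi / 2) / 2" by (simp add: \<phi>_def field_simps)
  ultimately have "\<phi> < pi / 4" "- \<phi> < pi / 4" by simp_all
  then have \<phi>: "\<bar>\<phi>\<bar> < pi / 4" by (simp add: abs_less_iff)
  have b: "\<bar>tan \<phi>\<bar> < 1" using \<phi> by (rule tan_small)
  have "Arg (1 + \<i> * of_real (tan \<phi>)) = Arg (cis \<phi>)"
    using cos_small[OF \<phi>] by (subst one_plus_i_tan) (auto simp del: of_real_divide)
  also have "\<dots> = \<phi>" using \<phi> pi_gt_zero by (intro Arg_cis) (auto simp: abs_less_iff)
  finally have "dm_lift 0 (of_real (tan \<phi>)) (pi / 2) = q (pi / 2)"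
    by (simp add: dm_lift_def \<phi>_def mult.commute)
  then have "dm_lift 0 (of_real (tan \<phi>)) = q"
    using Q_free_eq[OF free hyperbolic_Q[OF b] q] by blast
  then show ?thesis using dm_lift_PSL2R[of "of_real (tan \<phi>)" 0] b by simp
qed

text \<open>The conjugating element has to be Moebius itself; it comes from the transitivity of
  \<open>PSL2R\<close> on pairs, for which \<open>PSL2R\<close> was interpreted as an extension of
  itself.\<close>

lemma Q_2_hyperbolic:
  assumes triv: "\<And>P. cfg 3 P \<Longrightarrow> Q P = {id}" and T: "cfg 2 T" and q: "q \<in> Q T"
  shows "q \<in> lifts PSL2R"
proof -
  obtain g where g: "g \<in> lifts PSL2R" "g ` {0, pi} = T"
    using PSL.transitive_2 cfg_0_pi T unfolding PSL.transitive_def by blast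
  have gG: "g \<in> lifts G" using g lifts_mono[OF PSL] by blast
  have "inv g \<circ> q \<circ> g \<in> lifts PSL2R"
    using Q_0_pi_hyperbolic[OF triv] Q_conj_inv[OF gG g(2) q] by blast
  then have "g \<circ> (inv g \<circ> q \<circ> g) \<circ> inv g \<in> lifts PSL2R"
    using g(1) PSL.comp_mem PSL.inv_mem by blast
  moreover have "g \<circ> (inv g \<circ> q \<circ> g) \<circ> inv g = q" using gG by (auto simp: fun_eq_iff)
  ultimately show ?thesis by simp
qed

text \<open>A transvection is a rotated hyperbolic map and so belongs to \<open>Q\<close> of its two
  fixed points; conjugation by \<open>F\<close> turns it into an element of \<open>Q\<close> of
  another pair.\<close>

lemma conj_transvection:
  assumes triv: "\<And>P. cfg 3 P \<Longrightarrow> Q P = {id}" and F: "F \<in> lifts G" and a: "norm a < 1"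
  shows "F \<circ> dm_lift 0 a \<circ> inv F \<in> lifts PSL2R"
proof -
  define \<phi> where "\<phi> = Arg a"
  have a': "a = of_real (norm a) * cis \<phi>" using rcis_cmod_Arg[of a] by (simp add: \<phi>_def rcis_def)
  have ca: "cnj a * cis t = of_real (norm a) * cis (t - \<phi>)" for t
  proof -
    have "cnj a = of_real (norm a) * cis (- \<phi>)" by (subst a') (simp add: cis_cnj)
    then have "cnj a * cis t = of_real (norm a) * (cis (- \<phi>) * cis t)" by simp
    then show ?thesis unfolding cis_mult by simp
  qed
  let ?r = "\<lambda>t. t + \<phi>"
  have q: "?r \<circ> dm_lift 0 (of_real (norm a)) \<circ> inv ?r \<in> Q (?r ` {0, pi})"
    using rotation_mem hyperbolic_Q[of "norm a"] a by (intro Q_conj) auto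
  moreover have "?r \<circ> dm_lift 0 (of_real (norm a)) \<circ> inv ?r = dm_lift 0 a"
    by (simp add: fun_eq_iff inv_rotation dm_lift_def ca)
  ultimately have "dm_lift 0 a \<in> Q (?r ` {0, pi})" by simp
  then have "F \<circ> dm_lift 0 a \<circ> inv F \<in> Q (F ` ?r ` {0, pi})" using F by (intro Q_conj)
  moreover have "cfg 2 (F ` ?r ` {0, pi})" using cfg_image F rotation_mem cfg_0_pi by blast
  ultimately show ?thesis using Q_2_hyperbolic[OF triv] by blast
qed

text \<open>Rotations are products of three transvections \<open>z \<mapsto> (z + a) / (1 + cnj a z)\<close>.\<close>

lemma conj_rotation_small:
  assumes triv: "\<And>P. cfg 3 P \<Longrightarrow> Q P = {id}" and F: "F \<in> lifts G" and \<theta>: "\<bar>\<theta>\<bar> < pi / 2"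
  shows "\<exists>u a. norm u = 1 \<and> norm a < 1 \<and> (\<forall>s. dm u a (cis (F s)) = cis (F (s + \<theta>)))"
proof -
  define \<phi> where "\<phi> = \<theta> / 2"
  have \<phi>: "\<bar>\<phi>\<bar> < pi / 4" using \<theta> by (simp add: \<phi>_def)
  define \<tau> where "\<tau> = tan \<phi>"
  have \<tau>: "\<bar>\<tau>\<bar> < 1" unfolding \<tau>_def using \<phi> by (rule tan_small)
  \<comment> \<open>Since \<open>\<rho> * b = - \<i> * \<tau>\<close>, the product of the
    transvections with parameters \<open>\<rho>\<close> and \<open>b\<close> has the rotational part
    \<open>(1 + \<i> * \<tau>) / (1 - \<i> * \<tau>)\<close>, which is \<open>cis \<theta>\<close>
    for \<open>\<tau> = tan (\<theta> / 2)\<close>. Choosing \<open>\<rho>\<close> between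
    \<open>\<bar>\<tau>\<bar>\<close> and 1 keeps both parameters in the disc.\<close>
  define \<rho> where "\<rho> = (1 + \<bar>\<tau>\<bar>) / 2"
  have \<rho>: "0 < \<rho>" "\<rho> < 1" "\<bar>\<tau>\<bar> < \<rho>" using \<tau> by (auto simp: \<rho>_def)
  define b where "b = - \<i> * of_real (\<tau> / \<rho>)"
  have n1: "norm (1::complex) = 1" by simp
  have nr: "norm (of_real \<rho> :: complex) < 1" using \<rho> by simp
  have nb: "norm b < 1" using \<rho> by (simp add: b_def norm_mult norm_divide divide_less_eq)
  obtain w c where wc: "norm w = 1" "norm c < 1"
      "\<And>z. norm z \<le> 1 \<Longrightarrow> dm 1 (of_real \<rho>) (dm 1 b z) = dm w c z"
      "w = 1 * 1 * cnj (1 + cnj (of_real \<rho>) * 1 * b) / (1 + cnj (of_real \<rho>) * 1 * b)"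
    using dm_compose[OF n1 nr n1 nb] by metis
  have D: "1 + cnj (of_real \<rho>) * 1 * b = cnj (1 + \<i> * of_real \<tau>)"
    using \<rho> by (simp add: b_def)
  have cp: "cos \<phi> \<noteq> 0" using cos_small[OF \<phi>] by simp
  have "w = (1 + \<i> * of_real \<tau>) / cnj (1 + \<i> * of_real \<tau>)" using wc(4) unfolding D by simp
  also have "\<dots> = cis \<phi> / cis (- \<phi>)"
    unfolding \<tau>_def one_plus_i_tan[OF cp] using cp by (simp add: cis_cnj)
  also have "\<dots> = cis \<theta>" by (simp add: cis_divide \<phi>_def)
  finally have w: "w = cis \<theta>" .
  \<comment> \<open>The third transvection, with parameter \<open>- c\<close>, cancels the factor
    \<open>dm 1 c\<close> that accompanies the rotation.\<close>
  define \<gamma> where "\<gamma> = dm_lift 0 (of_real \<rho>) \<circ> dm_lift 0 b \<circ> dm_lift 0 (- c)"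
  have nc: "norm (- c) < 1" using wc(2) by simp
  have c\<gamma>: "cis (\<gamma> t) = cis (t + \<theta>)" for t
  proof -
    define z where "z = dm 1 (- c) (cis t)"
    have z: "norm z = 1" unfolding z_def using nc by (intro dm_norm_one) auto
    have "cis (\<gamma> t) = dm 1 (of_real \<rho>) (dm 1 b (dm 1 (- c) (cis t)))"
      unfolding \<gamma>_def using dm_lift[OF nr, of 0] dm_lift[OF nb, of 0] dm_lift[OF nc, of 0] by simp
    also have "\<dots> = dm w c z" using wc(3)[of z] z by (simp add: z_def)
    also have "\<dots> = w * dm 1 c z" by (simp add: dm_def)
    also have "dm 1 c z = cis t"
      unfolding z_def using dm_inverse'[of 1 c "cis t"] wc(2) by simp
    finally show ?thesis by (simp add: w cis_mult add.commute)
  qed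
  have \<gamma>m: "\<gamma> \<in> lifts G" unfolding \<gamma>_def using nr nb nc by (intro comp_mem dm_lift_mem)
  have "F \<circ> \<gamma> \<circ> inv F = (F \<circ> dm_lift 0 (of_real \<rho>) \<circ> inv F) \<circ> (F \<circ> dm_lift 0 b \<circ> inv F) \<circ> (F \<circ> dm_lift 0 (- c) \<circ> inv F)"
    using F by (simp add: \<gamma>_def fun_eq_iff)
  then have "F \<circ> \<gamma> \<circ> inv F \<in> lifts PSL2R"
    using conj_transvection[OF triv F] nr nb nc PSL.comp_mem by auto
  then obtain p where p: "p \<in> PSL2R" "\<And>t. p (cis t) = cis ((F \<circ> \<gamma> \<circ> inv F) t)" by (rule liftsE) blast
  then obtain u a where u: "p = restrict (dm u a) circle" "norm u = 1" "norm a < 1"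
    unfolding PSL2R_eq by blast
  have "dm u a (cis (F s)) = cis (F (s + \<theta>))" for s
  proof -
    have "dm u a (cis (F s)) = cis (F (\<gamma> s))" using p(2)[of "F s"] F by (simp add: u(1))
    moreover obtain k :: int where "\<gamma> s = s + \<theta> + of_int k * (2 * pi)" using c\<gamma> cis_eq_iff by blast
    then have "F (\<gamma> s) = F (s + \<theta>) + of_int k * (2 * pi)" using periodic_int[OF F] by simp
    ultimately show ?thesis using cis_eq_iff by metis
  qed
  then show ?thesis using u by blast
qed

lemma conj_rotation:
  assumes triv: "\<And>P. cfg 3 P \<Longrightarrow> Q P = {id}" and F: "F \<in> lifts G"
  shows "\<exists>u a. norm u = 1 \<and> norm a < 1 \<and> (\<forall>s. dm u a (cis (F s)) = cis (F (s + \<theta>)))"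
proof -
  obtain n :: nat where "\<bar>\<theta>\<bar> / (pi / 2) < real n" using reals_Archimedean2 by blast
  then have n: "\<bar>\<theta>\<bar> < real n * (pi / 2)" by (simp add: pos_divide_less_eq)
  then have n0: "0 < real n" using abs_ge_zero[of \<theta>] by (smt (verit) mult_nonneg_nonneg mult_nonpos_nonneg pi_half_ge_zero of_nat_0_le_iff)
  define \<phi> where "\<phi> = \<theta> / real n"
  have "\<bar>\<phi>\<bar> < pi / 2" using n n0 by (simp add: \<phi>_def pos_divide_less_eq mult.commute)
  then obtain u a where u: "norm u = 1" "norm a < 1" "\<And>s. dm u a (cis (F s)) = cis (F (s + \<phi>))"
    using conj_rotation_small[OF triv F] by blast
  have "\<exists>u a. norm u = 1 \<and> norm a < 1 \<and> (\<forall>s. dm u a (cis (F s)) = cis (F (s + real k * \<phi>)))" for k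
  proof (induction k)
    case 0
    have "norm (1::complex) = 1" "norm (0::complex) < 1" by auto
    then show ?case by (intro exI[of _ "1::complex"] exI[of _ "0::complex"] conjI) auto
  next
    case (Suc k)
    then obtain v b where v: "norm v = 1" "norm b < 1" "\<And>s. dm v b (cis (F s)) = cis (F (s + real k * \<phi>))" by blast
    obtain w c where w: "norm w = 1" "norm c < 1" "\<And>z. norm z \<le> 1 \<Longrightarrow> dm v b (dm u a z) = dm w c z"
      using dm_compose[OF v(1,2) u(1,2)] by metis
    have "dm w c (cis (F s)) = cis (F (s + real (Suc k) * \<phi>))" for s
      using w(3)[of "cis (F s)"] by (simp add: u(3) v(3) algebra_simps)
    then show ?case using w(1,2) by blast
  qed
  from this[of n] show ?thesis using n0 by (simp add: \<phi>_def)
qed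

end

text \<open>\<open>A\<close> is the identity on the multiples of \<open>2 * pi\<close>, so by
  monotonicity it stays within \<open>2 * pi\<close> of the identity everywhere, and a bounded
  additive function vanishes.\<close>

lemma additive_periodic_identity:
  fixes A :: "real \<Rightarrow> real"
  assumes add: "\<And>s t. A (s + t) = A s + A t" and mono: "strict_mono A" and per: "\<And>t. A (t + 2 * pi) = A t + 2 * pi"
  shows "A t = t"
proof -
  have bound: "\<bar>A s - s\<bar> \<le> 2 * pi" for s
  proof -
    define k where "k = \<lfloor>s / (2 * pi)\<rfloor>"
    have "of_int k \<le> s / (2 * pi)" "s / (2 * pi) \<le> of_int k + 1" unfolding k_def by linarith+
    then have k: "of_int k * (2 * pi) \<le> s" "s \<le> (of_int k + 1) * (2 * pi)"
      by (simp_all add: pos_le_divide_eq pos_divide_le_eq)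
    have Ak: "A (of_int j * (2 * pi)) = of_int j * (2 * pi)" for j :: int
    proof -
      have 0: "A 0 = 0" using add[of 0 0] by simp
      show ?thesis using shift_of_int[where F = A, OF per, of 0 j] 0 by simp
    qed
    have "A (of_int k * (2 * pi)) \<le> A s" "A s \<le> A ((of_int k + 1) * (2 * pi))"
      using k mono by (simp_all add: strict_mono_less_eq)
    then have "of_int k * (2 * pi) \<le> A s" "A s \<le> (of_int k + 1) * (2 * pi)"
      using Ak[of k] Ak[of "k + 1"] by simp_all
    then show ?thesis using k unfolding distrib_right by linarith
  qed
  have mult: "A (real n * t) = real n * A t" for n
  proof (induction n)
    case 0
    then show ?case using add[of 0 0] by simp
  next
    case (Suc n)
    then show ?case using add[of "real n * t" t] by (simp add: distrib_right add.commute)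
  qed
  have "real n * \<bar>A t - t\<bar> \<le> 2 * pi" for n
  proof -
    have "\<bar>real n * (A t - t)\<bar> \<le> 2 * pi"
      using bound[of "real n * t"] unfolding mult by (simp only: right_diff_distrib)
    then show ?thesis by (simp add: abs_mult)
  qed
  moreover have "\<exists>n. 2 * pi < real n * \<bar>A t - t\<bar>" if "A t \<noteq> t"
    using reals_Archimedean3[of "\<bar>A t - t\<bar>"] that by auto
  ultimately show ?thesis by (meson not_less)
qed

text \<open>The half turn is conjugate to a fixed-point-free map of the circle, so its Moebius extension
  has a fixed point in the open disc, which may be moved to \<open>0\<close>. What commutes with \<open>z \<mapsto> - z\<close>
  fixes \<open>0\<close>, so all rotations are then conjugate to rotations and the conjugating lift is
  additive up to a constant.\<close>

lemma normalizes_rotations_imp_PSL2R: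
  assumes f: "f \<in> Homeo_set" and F: "continuous_on UNIV F" "strict_mono F" "\<And>t. f (cis t) = cis (F t)"
    and conj: "\<And>\<theta>. \<exists>u a. norm u = 1 \<and> norm a < 1 \<and> (\<forall>s. dm u a (cis (F s)) = cis (F (s + \<theta>)))"
  shows "f \<in> PSL2R"
proof -
  have perF: "F (t + 2 * pi) = F t + 2 * pi" for t
    using lift_periodic[OF homeo_inj[OF f] F] .
  have surjF: "surj F" using lift_surj[OF F(1) perF] .
  have no_half: "cis (F (s + pi)) \<noteq> cis (F s)" for s
  proof
    assume "cis (F (s + pi)) = cis (F s)"
    then have "f (cis (s + pi)) = f (cis s)" using F(3) by simp
    then have "cis (s + pi) = cis s" using homeo_inj[OF f] by (metis cis_in_circle inj_onD)
    then have "cis s * cis pi = cis s" by (simp only: cis_mult)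
    then show False by simp
  qed
  obtain u a where u: "norm u = 1" "norm a < 1" "\<And>s. dm u a (cis (F s)) = cis (F (s + pi))"
    using conj[of pi] by blast
  have "continuous_on (cball 0 1) (dm u a)"
    unfolding dm_def using dm_denominator[OF u(2)] by (intro continuous_intros) auto
  moreover have "dm u a \<in> cball 0 1 \<rightarrow> cball 0 1" using dm_norm_le[OF u(1,2)] by auto
  ultimately obtain z where z: "norm z \<le> 1" "dm u a z = z"
    using brouwer_ball[of 1 0 "dm u a"] by auto
  have z1: "norm z < 1"
  proof (rule ccontr)
    assume "\<not> norm z < 1"
    then obtain t where "z = cis t" using z(1) norm_one_cis[of z] by auto
    moreover obtain s where "F s = t" using surjF by (metis surjD)
    ultimately show False using u(3)[of s] z(2) no_half[of s] by simp
  qed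
  have n1: "norm (1::complex) = 1" by simp
  have mz: "norm (- z) < 1" using z1 by simp
  \<comment> \<open>\<open>\<kappa>\<close> is the curve \<open>f (cis s)\<close> after the fixed
    point \<open>z\<close> has been moved to the centre of the disc.\<close>
  define \<kappa> where "\<kappa> s = dm 1 (- z) (cis (F s))" for s
  have \<kappa>n: "norm (\<kappa> s) = 1" for s unfolding \<kappa>_def using mz by (intro dm_norm_one) auto
  have ret: "dm 1 z (\<kappa> s) = cis (F s)" for s
    unfolding \<kappa>_def using dm_inverse'[of 1 z "cis (F s)"] z1 by simp
  have forth: "dm 1 (- z) (dm 1 z x) = x" if "norm x \<le> 1" for x
    using dm_inverse[of 1 z x] z1 that by simp
  have surj\<kappa>: "\<exists>s. x = \<kappa> s" if x: "norm x = 1" for x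
  proof -
    have "norm (dm 1 z x) = 1" using z1 x by (intro dm_norm_one) auto
    then obtain t where t: "dm 1 z x = cis t" using norm_one_cis by blast
    obtain s where "F s = t" using surjF by (metis surjD)
    then have "\<kappa> s = x" using t forth[of x] x by (simp add: \<kappa>_def)
    then show ?thesis by blast
  qed
  have conj\<kappa>: "\<exists>w c. norm w = 1 \<and> norm c < 1 \<and> (\<forall>s. dm w c (\<kappa> s) = \<kappa> (s + \<theta>)) \<and>
      (\<forall>x. norm x \<le> 1 \<longrightarrow> dm w c x = dm 1 (- z) (dm v b (dm 1 z x)))"
    if v: "norm v = 1" "norm b < 1" "\<And>s. dm v b (cis (F s)) = cis (F (s + \<theta>))" for v b \<theta>
  proof -
    obtain w1 c1 where 1: "norm w1 = 1" "norm c1 < 1" "\<And>x. norm x \<le> 1 \<Longrightarrow> dm v b (dm 1 z x) = dm w1 c1 x"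
      using dm_compose[OF v(1,2) n1 z1] by metis
    obtain w c where 2: "norm w = 1" "norm c < 1" "\<And>x. norm x \<le> 1 \<Longrightarrow> dm 1 (- z) (dm w1 c1 x) = dm w c x"
      using dm_compose[OF n1 mz 1(1,2)] by metis
    have e: "dm w c x = dm 1 (- z) (dm v b (dm 1 z x))" if "norm x \<le> 1" for x
      using 1(3) 2(3) that by simp
    have "dm w c (\<kappa> s) = \<kappa> (s + \<theta>)" for s
      using e[of "\<kappa> s"] \<kappa>n[of s] by (simp add: ret v(3)) (simp add: \<kappa>_def)
    then show ?thesis using 2(1,2) e by blast
  qed
  obtain w c where w: "norm w = 1" "norm c < 1" "\<And>s. dm w c (\<kappa> s) = \<kappa> (s + pi)"
    "\<And>x. norm x \<le> 1 \<Longrightarrow> dm w c x = dm 1 (- z) (dm u a (dm 1 z x))"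
    using conj\<kappa>[OF u] by blast
  have "dm w c 0 = 0" using w(4)[of 0] z(2) by (simp add: dm_def)
  then have "c = 0" using w(1) by (auto simp: dm_def)
  then have half: "\<kappa> (s + pi) = w * \<kappa> s" for s using w(3)[of s] by (simp add: dm_def)
  \<comment> \<open>Two half turns make a full period, so \<open>w * w = 1\<close>, while
    \<open>w = 1\<close> would identify points half a period apart.\<close>
  have "w * w * \<kappa> 0 = \<kappa> 0"
  proof -
    have "\<kappa> (0 + 2 * pi) = \<kappa> 0" unfolding \<kappa>_def perF by (simp flip: cis_mult)
    moreover have "\<kappa> (0 + 2 * pi) = w * w * \<kappa> 0" using half[of pi] half[of 0] by simp
    ultimately show ?thesis by simp
  qed
  moreover have "\<kappa> 0 \<noteq> 0" using \<kappa>n[of 0] by auto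
  ultimately have "w * w = 1" by simp
  moreover have "w \<noteq> 1"
  proof
    assume "w = 1"
    then have "dm 1 z (\<kappa> (0 + pi)) = dm 1 z (\<kappa> 0)" using half[of 0] by simp
    then show False using no_half[of 0] unfolding ret by simp
  qed
  ultimately have w1: "w = - 1" by (metis square_eq_1_iff)
  have rot: "\<exists>v. norm v = 1 \<and> (\<forall>s. \<kappa> (s + \<theta>) = v * \<kappa> s)" for \<theta>
  proof -
    obtain v b where "norm v = 1" "norm b < 1" "\<And>s. dm v b (cis (F s)) = cis (F (s + \<theta>))"
      using conj[of \<theta>] by blast
    then obtain v b where v: "norm v = 1" "norm b < 1" "\<And>s. dm v b (\<kappa> s) = \<kappa> (s + \<theta>)"
      using conj\<kappa> by blast
    \<comment> \<open>Both sides are the shift by \<open>\<theta>\<close> combined with the half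
      turn, in the two possible orders; uniqueness of the parameters then gives
      \<open>- b = b\<close>.\<close>
    have "dm (- v) (- b) x = dm (- v) b x" if x: "norm x = 1" for x
    proof -
      obtain s where s: "x = \<kappa> s" using surj\<kappa>[OF x] by blast
      have "dm (- v) (- b) x = dm v b (- x)" by (simp add: dm_def field_simps)
      also have "- x = \<kappa> (s + pi)" using half w1 s by simp
      also have "dm v b \<dots> = \<kappa> ((s + \<theta>) + pi)" using v(3)[of "s + pi"] by (simp add: add_ac)
      also have "\<dots> = - dm v b x" using half w1 v(3) s by simp
      also have "\<dots> = dm (- v) b x" by (simp add: dm_def)
      finally show ?thesis .
    qed
    then have "- b = b" using v by (intro dm_unique(2)[of "- v" "- b" "- v" b]) auto
    then have "b = 0" by (simp add: neg_equal_iff_equal)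
    then show ?thesis using v by (auto simp: dm_def intro!: exI[of _ v])
  qed
  define K where "K s = dm_lift 0 (- z) (F s)" for s
  have cK: "cis (K s) = \<kappa> s" for s
    using dm_lift[OF mz, of 0 "F s"] by (simp add: K_def \<kappa>_def)
  have contK: "continuous_on UNIV K"
    unfolding K_def using mz F(1) by (intro continuous_on_dm_lift continuous_on_const) auto
  have perK: "K (t + 2 * pi) = K t + 2 * pi" for t
    unfolding K_def perF dm_lift_periodic ..
  have "strict_mono (dm_lift 0 (- z))"
    using dm_lift_PSL2R[OF mz] by (simp add: lifts_def)
  then have monoK: "strict_mono K" using F(2) by (simp add: K_def strict_mono_def)
  define A where "A s = K s - K 0" for s
  \<comment> \<open>The increments \<open>K (s + \<theta>) - K s\<close> are all arguments of the
    same \<open>v\<close>, and by continuity in \<open>s\<close> they cannot jump by a multiple of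
    \<open>2 * pi\<close>.\<close>
  have add: "A (s + \<theta>) = A s + A \<theta>" for s \<theta>
  proof -
    obtain v where v: "norm v = 1" "\<And>s. \<kappa> (s + \<theta>) = v * \<kappa> s" using rot by blast
    have "K (s + \<theta>) - K s = K \<theta> - K 0"
    proof (rule continuous_lift_unique[of "UNIV :: real set" "\<lambda>s. K (s + \<theta>) - K s" "\<lambda>s. K \<theta> - K 0" 0])
      show "continuous_on UNIV (\<lambda>s. K (s + \<theta>) - K s)"
        by (intro continuous_on_diff contK continuous_on_compose2[OF contK continuous_on_add[OF continuous_on_id continuous_on_const]])
          auto
      show "cis (K (y + \<theta>) - K y) = cis (K \<theta> - K 0)" for y
      proof -
        have "cis (K (x + \<theta>) - K x) = v" for x
        proof -
          have "\<kappa> x \<noteq> 0" using \<kappa>n[of x] by auto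
          have "cis (K (x + \<theta>) - K x) = \<kappa> (x + \<theta>) / \<kappa> x" by (simp only: cK flip: cis_divide)
          then show ?thesis using v(2)[of x] \<open>\<kappa> x \<noteq> 0\<close> by simp
        qed
        from this[of y] this[of 0] show ?thesis by simp
      qed
    qed auto
    then show ?thesis by (simp add: A_def)
  qed
  have monoA: "strict_mono A" using monoK by (simp add: A_def strict_mono_def)
  have perA: "A (t + 2 * pi) = A t + 2 * pi" for t using perK[of t] by (simp add: A_def)
  have AK: "A s = s" for s by (rule additive_periodic_identity[OF add monoA perA])
  have n2: "norm (cis (K 0)) = 1" "norm (0::complex) < 1" by auto
  obtain v b where v: "norm v = 1" "norm b < 1"
    "\<And>x. norm x \<le> 1 \<Longrightarrow> dm 1 z (dm (cis (K 0)) 0 x) = dm v b x"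
    using dm_compose[OF n1 z1 n2] by metis
  have "f x = restrict (dm v b) circle x" if x: "x \<in> circle" for x
  proof -
    obtain s where s: "x = cis s" using x circle_iff_cis by blast
    have "K s = K 0 + s" using AK[of s] by (simp add: A_def)
    then have "\<kappa> s = cis (K 0) * cis s" using cK[of s] by (simp add: cis_mult)
    then have "dm (cis (K 0)) 0 (cis s) = \<kappa> s" by (simp add: dm_def)
    then show ?thesis using v(3)[of "cis s"] F(3)[of s] ret[of s] s by simp
  qed
  then have "f = restrict (dm v b) circle"
    using f by (intro extensionalityI[of f circle]) (auto simp: Homeo_set_def)
  then show ?thesis using v unfolding PSL2R_eq by blast
qed

lemma PSL2R_maximal:
  assumes "closed_subgroup G" "PSL2R \<subseteq> G" "G \<noteq> PSL2R"
  shows "G = carrier Homeo"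
proof -
  interpret PSL2R_extension G
    using assms by (intro PSL2R_extension.intro) (auto simp: closed_subgroup_def)
  have GH: "G \<subseteq> Homeo_set" using G by (simp add: subgroup_def)
  obtain f where f: "f \<in> G" "f \<notin> PSL2R" using assms by blast
  have fH: "f \<in> Homeo_set" using f GH by blast
  have "Q P \<noteq> {id}" if P: "cfg 3 P" for P
  proof
    assume "Q P = {id}"
    then have triv: "Q R = {id}" if "cfg 3 R" for R
      using transitive_transfer_trivial[OF transitive_3 P _ that] by blast
    obtain F where F: "F \<in> lifts G" "\<And>t. f (cis t) = cis (F t)" using Homeo_lift[OF fH f(1)] by blast
    have "f \<in> PSL2R"
      using F conj_rotation[OF triv F(1)]
      by (intro normalizes_rotations_imp_PSL2R[OF fH, of F]) (auto simp: lifts_def)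
    then show False using f by blast
  qed
  then have "transitive n" if "3 \<le> n" for n using highly_transitive[OF transitive_3 _ that] by blast
  then show ?thesis
    using closed_highly_transitive[OF G] assms(1) by (simp add: closed_subgroup_def)
qed

theorem theorem1p3:
  shows "closed_subgroup PSL2R \<and> PSL2R \<noteq> carrier Homeo \<and>
    (\<forall>G. closed_subgroup G \<and> PSL2R \<subseteq> G \<longrightarrow> G = PSL2R \<or> G = carrier Homeo)"
  using subgroup_PSL2R closedin_PSL2R PSL2R_proper PSL2R_maximal
  unfolding closed_subgroup_def carrier_Homeo by blast

end
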